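(* Let $S(t)$, $t\geq 0$, be the stationary Gaussian process with continuous sample paths, mean $0$, variance $1$ and autocorrelation function $R(s)=\max\{0,1-|s|\}$. Let $h\in\mathbb{R}$, let $n$ be a positive integer, and let $x<h$. Then $$\Pr\big\{S(t)<h \text{ for all } t\in[0,n]\ \big|\ S(0)=x\big\}=\frac{1}{\varphi(x)}\int_{-\infty}^h\cdots\int_{-\infty}^h \det\big[\varphi(s_i+a_{i,j})\big]_{i,j=0}^{n}\,ds_1\cdots ds_n,$$ where $s_0=x$ and, for $i,j\in\{0,1,\ldots,n\}$, $$a_{i,j}=\begin{cases}0 & \text{for } i=j,\\ (i-j)h-s_{j+1}-\cdots-s_{i} & \text{for } i>j,\\ (i-j)h+s_{i+1}+\cdots+s_{j} & \text{for } i<j.\end{cases}$$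
   Context: $\varphi(x)=\frac{1}{\sqrt{2\pi}}e^{-x^2/2}$ is the standard normal density. The determinant is that of the $(n+1)\times(n+1)$ matrix with entries $\varphi(s_i+a_{i,j})$, rows indexed by $i$ and columns by $j$, $0\le i,j\le n$. Conditioning on $S(0)=x$ is understood in the usual Gaussian sense: the conditional law of $(S(t))_{t\ge0}$ given $S(0)=x$ is that of the continuous Gaussian process with mean $xR(t)$ and covariance $R(t-s)-R(s)R(t)$. *)

theory Defs
  imports "HOL-Probability.Probability" "Jordan_Normal_Form.Determinant"
begin

text \<open>A random variable is Gaussian with mean \<open>\<mu>\<close> and standard deviation \<open>\<sigma>\<close>.  The degenerate case
  \<open>\<sigma> = 0\<close> is needed, since the value at time \<open>0\<close> is deterministic after conditioning.\<close>

definition normal_rv :: "'a measure \<Rightarrow> ('a \<Rightarrow> real) \<Rightarrow> real \<Rightarrow> real \<Rightarrow> bool" where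
  "normal_rv M X \<mu> \<sigma> \<longleftrightarrow> X \<in> borel_measurable M \<and> 0 \<le> \<sigma> \<and>
     (if \<sigma> = 0 then (AE \<omega> in M. X \<omega> = \<mu>) else distributed M lborel X (normal_density \<mu> \<sigma>))"

definition gaussian_process :: "'a measure \<Rightarrow> 't set \<Rightarrow> ('t \<Rightarrow> 'a \<Rightarrow> real) \<Rightarrow> bool" where
  "gaussian_process M T X \<longleftrightarrow> prob_space M \<and> (\<forall>t\<in>T. X t \<in> borel_measurable M) \<and>
     (\<forall>I c. finite I \<and> I \<subseteq> T \<longrightarrow> (\<exists>\<mu> \<sigma>. normal_rv M (\<lambda>\<omega>. \<Sum>t\<in>I. c t * X t \<omega>) \<mu> \<sigma>))"

definition mean_fn :: "'a measure \<Rightarrow> ('t \<Rightarrow> 'a \<Rightarrow> real) \<Rightarrow> 't \<Rightarrow> real" where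
  "mean_fn M X t = (\<integral>\<omega>. X t \<omega> \<partial>M)"

definition cov_fn :: "'a measure \<Rightarrow> ('t \<Rightarrow> 'a \<Rightarrow> real) \<Rightarrow> 't \<Rightarrow> 't \<Rightarrow> real" where
  "cov_fn M X s t = (\<integral>\<omega>. (X s \<omega> - mean_fn M X s) * (X t \<omega> - mean_fn M X t) \<partial>M)"

text \<open>For Gaussian processes, a constant mean and a covariance that depends only on the time lag
  amount to strict stationarity.\<close>

definition stationary_gaussian_process ::
    "'a measure \<Rightarrow> (real \<Rightarrow> 'a \<Rightarrow> real) \<Rightarrow> (real \<Rightarrow> real) \<Rightarrow> bool" where
  "stationary_gaussian_process M S R \<longleftrightarrow>
     gaussian_process M {0..} S \<and>
     (\<forall>\<omega>\<in>space M. continuous_on {0..} (\<lambda>t. S t \<omega>)) \<and>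
     (\<forall>t\<ge>0. mean_fn M S t = 0) \<and>
     (\<forall>t\<ge>0. cov_fn M S t t = 1) \<and>
     (\<forall>s\<ge>0. \<forall>t\<ge>0. cov_fn M S s t = R (t - s))"

definition slepian_R :: "real \<Rightarrow> real" where
  "slepian_R s = max 0 (1 - \<bar>s\<bar>)"

text \<open>Continuous paths on \<open>[0, \<infinity>)\<close> (extended by \<open>undefined\<close> to negative times, as in
  \<^const>\<open>PiM\<close>), with the \<open>\<sigma>\<close>-algebra generated by the coordinate maps.\<close>

definition path_space :: "(real \<Rightarrow> real) measure" where
  "path_space = restrict_space (Pi\<^sub>M {0..} (\<lambda>_. borel)) {f. continuous_on {0..} f}"

text \<open>\<open>P\<close> is the conditional law of the paths of \<open>S\<close> given \<open>S 0 = x\<close> in the Gaussian sense: the law of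
  the continuous Gaussian process with the usual conditional mean and covariance.  See
  \<open>conditional_law_slepian_iff\<close> below for the centred case with unit variance.\<close>

definition gaussian_conditional_law ::
    "'a measure \<Rightarrow> (real \<Rightarrow> 'a \<Rightarrow> real) \<Rightarrow> real \<Rightarrow> (real \<Rightarrow> real) measure \<Rightarrow> bool" where
  "gaussian_conditional_law M S x P \<longleftrightarrow>
     sets P = sets path_space \<and>
     gaussian_process P {0..} (\<lambda>t f. f t) \<and>
     (\<forall>t\<ge>0. mean_fn P (\<lambda>t f. f t) t =
        mean_fn M S t + cov_fn M S 0 t / cov_fn M S 0 0 * (x - mean_fn M S 0)) \<and>
     (\<forall>s\<ge>0. \<forall>t\<ge>0. cov_fn P (\<lambda>t f. f t) s t =
        cov_fn M S s t - cov_fn M S 0 s * cov_fn M S 0 t / cov_fn M S 0 0)"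

lemma conditional_law_slepian_iff:
  assumes "stationary_gaussian_process M S slepian_R"
  shows "gaussian_conditional_law M S x P \<longleftrightarrow>
     sets P = sets path_space \<and>
     gaussian_process P {0..} (\<lambda>t f. f t) \<and>
     (\<forall>t\<ge>0. mean_fn P (\<lambda>t f. f t) t = x * slepian_R t) \<and>
     (\<forall>s\<ge>0. \<forall>t\<ge>0. cov_fn P (\<lambda>t f. f t) s t =
        slepian_R (t - s) - slepian_R s * slepian_R t)"
  using assms
  by (simp add: gaussian_conditional_law_def stationary_gaussian_process_def mult.commute)

text \<open>The shifts \<open>a\<^sub>i\<^sub>j\<close>, as a function of the variables \<open>s\<close>.\<close>

definition shift :: "real \<Rightarrow> (nat \<Rightarrow> real) \<Rightarrow> nat \<Rightarrow> nat \<Rightarrow> real" where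
  "shift h s i j =
     (if i = j then 0
      else if j < i then (real i - real j) * h - (\<Sum>k = j+1..i. s k)
      else (real i - real j) * h + (\<Sum>k = i+1..j. s k))"

definition shift_matrix :: "real \<Rightarrow> nat \<Rightarrow> (nat \<Rightarrow> real) \<Rightarrow> real mat" where
  "shift_matrix h n s =
     Matrix.mat (n + 1) (n + 1) (\<lambda>(i, j). std_normal_density (s i + shift h s i j))"

text \<open>The conditional law is attained, by the law of \<open>S t - R t * S 0 + R t * x\<close>; so the predicate
  \<^const>\<open>gaussian_conditional_law\<close> is not vacuous.\<close>

lemma normal_rv_affine:
  assumes "prob_space M" "normal_rv M X \<mu> \<sigma>"
  shows "normal_rv M (\<lambda>\<omega>. b + X \<omega>) (b + \<mu>) \<sigma>"
proof -
  interpret prob_space M by fact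
  show ?thesis
  proof (cases "\<sigma> = 0")
    case True then show ?thesis using assms(2) by (auto simp: normal_rv_def)
  next
    case False
    then have s: "\<sigma> > 0" and d: "distributed M lborel X (normal_density \<mu> \<sigma>)"
      using assms(2) by (auto simp: normal_rv_def)
    have "distributed M lborel (\<lambda>x. b + 1 * X x) (normal_density (b + 1 * \<mu>) (\<bar>1\<bar> * \<sigma>))"
      by (rule normal_density_affine[OF d s]) simp
    then show ?thesis using s assms(2) by (auto simp: normal_rv_def)
  qed
qed

lemma normal_rv_square_integrable:
  assumes "prob_space M" "normal_rv M X \<mu> \<sigma>"
  shows "integrable M (\<lambda>\<omega>. (X \<omega>)\<^sup>2)"
proof -
  interpret prob_space M by fact
  have [measurable]: "X \<in> borel_measurable M" using assms by (simp add: normal_rv_def)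
  show ?thesis
  proof (cases "\<sigma> = 0")
    case True
    then have ae: "AE \<omega> in M. X \<omega> = \<mu>" using assms(2) by (auto simp: normal_rv_def)
    have "integrable M (\<lambda>\<omega>. (X \<omega>)\<^sup>2) \<longleftrightarrow> integrable M (\<lambda>\<omega>. \<mu>\<^sup>2)"
      by (rule integrable_cong_AE) (use ae in auto)
    then show ?thesis by simp
  next
    case False
    then have s: "\<sigma> > 0" and d: "distributed M lborel X (normal_density \<mu> \<sigma>)"
      using assms(2) by (auto simp: normal_rv_def)
    have "integrable lborel (\<lambda>x. normal_density \<mu> \<sigma> x * (x - \<mu>)^2 + (2 * \<mu>) * (normal_density \<mu> \<sigma> x * x) - \<mu>^2 * normal_density \<mu> \<sigma> x)"
      by (intro Bochner_Integration.integrable_add Bochner_Integration.integrable_diff integrable_mult_right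
           integrable_normal_moment integrable_normal_moment_nz_1 integrable_normal_density s)
    also have "(\<lambda>x. normal_density \<mu> \<sigma> x * (x - \<mu>)^2 + (2 * \<mu>) * (normal_density \<mu> \<sigma> x * x) - \<mu>^2 * normal_density \<mu> \<sigma> x)
       = (\<lambda>x. normal_density \<mu> \<sigma> x * x^2)"
      by (auto simp: power2_eq_square algebra_simps)
    finally show ?thesis
      using distributed_integrable[OF d, of "\<lambda>x. x^2"] by simp
  qed
qed

lemma gaussian_conditional_law_exists:
  assumes S: "stationary_gaussian_process M S slepian_R"
  shows "\<exists>P. gaussian_conditional_law M S x P"
proof -
  let ?R = slepian_R
  have g: "gaussian_process M {0..} S" using S by (simp add: stationary_gaussian_process_def)
  interpret prob_space M using g by (simp add: gaussian_process_def)
  have meas[measurable]: "S t \<in> borel_measurable M" if "t \<ge> 0" for t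
    using g that by (simp add: gaussian_process_def)
  have lin: "\<exists>\<mu> \<sigma>. normal_rv M (\<lambda>\<omega>. \<Sum>t\<in>I. c t * S t \<omega>) \<mu> \<sigma>" if "finite I" "I \<subseteq> {0..}" for I c
    using g that by (simp add: gaussian_process_def)
  have sq: "integrable M (\<lambda>\<omega>. (S t \<omega>)\<^sup>2)" if t: "t \<ge> 0" for t
    using lin[of "{t}" "\<lambda>_. 1"] t normal_rv_square_integrable[OF prob_space_axioms] by auto
  have i1: "integrable M (S t)" if t: "t \<ge> 0" for t
    by (rule square_integrable_imp_integrable[OF meas[OF t] sq[OF t]])
  have i2: "integrable M (\<lambda>\<omega>. S s \<omega> * S t \<omega>)" if "s \<ge> 0" "t \<ge> 0" for s t
  proof (rule Bochner_Integration.integrable_bound)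
    show "integrable M (\<lambda>\<omega>. (S s \<omega>)\<^sup>2 + (S t \<omega>)\<^sup>2)" using that sq by simp
    show "(\<lambda>\<omega>. S s \<omega> * S t \<omega>) \<in> borel_measurable M" using that by measurable
    have "\<bar>a * b\<bar> \<le> a\<^sup>2 + b\<^sup>2" for a b :: real
      using sum_squares_bound[of "\<bar>a\<bar>" "\<bar>b\<bar>"] zero_le_power2[of a] zero_le_power2[of b]
        abs_ge_zero[of "a * b"] unfolding abs_mult power2_abs by linarith
    then show "AE \<omega> in M. norm (S s \<omega> * S t \<omega>) \<le> norm ((S s \<omega>)\<^sup>2 + (S t \<omega>)\<^sup>2)" by simp
  qed
  have m0: "(\<integral>\<omega>. S t \<omega> \<partial>M) = 0" if "t \<ge> 0" for t
    using S that by (simp add: stationary_gaussian_process_def mean_fn_def)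
  have c0: "(\<integral>\<omega>. S s \<omega> * S t \<omega> \<partial>M) = ?R (t - s)" if "s \<ge> 0" "t \<ge> 0" for s t
  proof -
    have "cov_fn M S s t = ?R (t - s)"
      using S that by (auto simp: stationary_gaussian_process_def)
    then show ?thesis using m0[OF that(1)] m0[OF that(2)] by (simp add: cov_fn_def mean_fn_def)
  qed
  define Y where "Y t \<omega> = S t \<omega> - ?R t * S 0 \<omega> + ?R t * x" for t \<omega>
  define F where "F \<omega> = (\<lambda>t\<in>{0..}. Y t \<omega>)" for \<omega>
  have Ym[measurable]: "Y t \<in> borel_measurable M" if "t \<ge> 0" for t
    unfolding Y_def using that by measurable
  have F[measurable]: "F \<in> measurable M path_space"
    unfolding path_space_def
  proof (rule measurable_restrict_space2)
    show "F \<in> space M \<rightarrow> {f. continuous_on {0..} f}"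
    proof safe
      fix \<omega> assume "\<omega> \<in> space M"
      then have "continuous_on {0..} (\<lambda>t. S t \<omega>)" using S by (simp add: stationary_gaussian_process_def)
      then have "continuous_on {0..} (\<lambda>t. Y t \<omega>)"
        unfolding Y_def slepian_R_def by (intro continuous_intros)
      then show "continuous_on {0..} (F \<omega>)"
        by (rule continuous_on_eq) (simp add: F_def)
    qed
    show "F \<in> measurable M (Pi\<^sub>M {0..} (\<lambda>_. borel))"
      unfolding F_def by (rule measurable_restrict) (simp add: Ym)
  qed
  let ?P = "distr M path_space F"
  have coord[measurable]: "(\<lambda>f. f t) \<in> borel_measurable path_space" if "t \<ge> 0" for t :: real
    unfolding path_space_def
    by (rule measurable_restrict_space1, rule measurable_component_singleton) (use that in auto)
  have Ft: "F \<omega> t = Y t \<omega>" if "t \<ge> 0" for t \<omega> using that by (simp add: F_def)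
  have Ylin: "\<exists>\<mu> \<sigma>. normal_rv M (\<lambda>\<omega>. \<Sum>t\<in>I. c t * Y t \<omega>) \<mu> \<sigma>" if I: "finite I" "I \<subseteq> {0..}" for I c
  proof -
    let ?r = "\<Sum>t\<in>I. c t * ?R t"
    define d where "d t = (if t \<in> I then c t else 0) - (if t = 0 then ?r else 0)" for t
    have "(\<Sum>t\<in>I. c t * Y t \<omega>) = ?r * x + (\<Sum>t\<in>insert 0 I. d t * S t \<omega>)" for \<omega>
    proof -
      have "(\<Sum>t\<in>insert 0 I. d t * S t \<omega>) = 
         (\<Sum>t\<in>insert 0 I. (if t \<in> I then c t * S t \<omega> else 0)) - (\<Sum>t\<in>insert 0 I. (if t = 0 then ?r * S t \<omega> else 0))"
        unfolding d_def sum_subtractf[symmetric] by (intro sum.cong) (auto simp: algebra_simps)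
      also have "(\<Sum>t\<in>insert 0 I. (if t \<in> I then c t * S t \<omega> else 0)) = (\<Sum>t\<in>I. c t * S t \<omega>)"
        using I by (intro sum.mono_neutral_cong_right) auto
      also have "(\<Sum>t\<in>insert 0 I. (if t = 0 then ?r * S t \<omega> else 0)) = ?r * S 0 \<omega>"
        using I by (subst sum.delta) auto
      finally show ?thesis
        by (simp add: Y_def algebra_simps sum.distrib sum_subtractf sum_distrib_left sum_distrib_right)
    qed
    moreover obtain \<mu> \<sigma> where "normal_rv M (\<lambda>\<omega>. \<Sum>t\<in>insert 0 I. d t * S t \<omega>) \<mu> \<sigma>"
      using lin[of "insert 0 I" d] I by auto
    ultimately have "normal_rv M (\<lambda>\<omega>. \<Sum>t\<in>I. c t * Y t \<omega>) (?r * x + \<mu>) \<sigma>"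
      using normal_rv_affine[OF prob_space_axioms, of "\<lambda>\<omega>. \<Sum>t\<in>insert 0 I. d t * S t \<omega>" \<mu> \<sigma> "?r * x"] by presburger
    then show ?thesis by blast
  qed
  have gp: "gaussian_process ?P {0..} (\<lambda>t f. f t)"
    unfolding gaussian_process_def
  proof (intro conjI ballI allI impI)
    show "prob_space ?P" by (rule prob_space_distr) (rule F)
    fix t :: real assume "t \<in> {0..}" then show "(\<lambda>f. f t) \<in> borel_measurable ?P" by (simp add: coord)
  next
    fix I :: "real set" and c assume I: "finite I \<and> I \<subseteq> {0..}"
    obtain \<mu> \<sigma> where n: "normal_rv M (\<lambda>\<omega>. \<Sum>t\<in>I. c t * Y t \<omega>) \<mu> \<sigma>" using Ylin I by blast
    have eq: "(\<Sum>t\<in>I. c t * F \<omega> t) = (\<Sum>t\<in>I. c t * Y t \<omega>)" for \<omega>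
      using I by (intro sum.cong) (auto simp: Ft)
    have ms[measurable]: "(\<lambda>f. \<Sum>t\<in>I. c t * f t) \<in> borel_measurable path_space"
      using I by (intro borel_measurable_sum borel_measurable_times borel_measurable_const coord) auto
    have "normal_rv ?P (\<lambda>f. \<Sum>t\<in>I. c t * f t) \<mu> \<sigma>"
      using n by (auto simp: normal_rv_def AE_distr_iff distributed_def distr_distr comp_def eq split: if_splits)
    then show "\<exists>\<mu> \<sigma>. normal_rv ?P (\<lambda>f. \<Sum>t\<in>I. c t * f t) \<mu> \<sigma>" by blast
  qed
  have mP: "mean_fn ?P (\<lambda>t f. f t) t = x * ?R t" if t: "t \<ge> 0" for t
  proof -
    have "mean_fn ?P (\<lambda>t f. f t) t = (\<integral>\<omega>. Y t \<omega> \<partial>M)"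
      unfolding mean_fn_def using t by (subst integral_distr[OF F coord]) (auto simp: Ft)
    also have "\<dots> = x * ?R t"
      unfolding Y_def using t by (simp add: i1 m0 prob_space)
    finally show ?thesis .
  qed
  have cP: "cov_fn ?P (\<lambda>t f. f t) s t = ?R (t - s) - ?R s * ?R t" if st: "s \<ge> 0" "t \<ge> 0" for s t
  proof -
    have R00: "(\<integral>\<omega>. S 0 \<omega> * S 0 \<omega> \<partial>M) = 1" using c0[of 0 0] by (simp add: slepian_R_def)
    have "cov_fn ?P (\<lambda>t f. f t) s t = (\<integral>\<omega>. (Y s \<omega> - x * ?R s) * (Y t \<omega> - x * ?R t) \<partial>M)"
      unfolding cov_fn_def using st
      by (subst integral_distr[OF F]) (auto simp: Ft mP coord intro!: borel_measurable_times borel_measurable_diff)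
    also have "\<dots> = (\<integral>\<omega>. S s \<omega> * S t \<omega> - ?R t * (S 0 \<omega> * S s \<omega>) - ?R s * (S 0 \<omega> * S t \<omega>) + ?R s * ?R t * (S 0 \<omega> * S 0 \<omega>) \<partial>M)"
      by (intro Bochner_Integration.integral_cong) (auto simp: Y_def algebra_simps)
    also have "\<dots> = ?R (t - s) - ?R s * ?R t"
      using st by (simp add: i2 c0 R00)
    finally show ?thesis .
  qed
  have "gaussian_conditional_law M S x ?P"
    unfolding conditional_law_slepian_iff[OF S] using gp mP cP by simp
  then show ?thesis by blast
qed

end

theory Submission
  imports Defs
begin

text \<open>Let \<open>W\<close> be a Brownian motion.  The process \<open>W (t + 1) - W t\<close> has the covariance of \<open>S\<close>, and it stays
  below \<open>h\<close> on \<open>[0, n]\<close> exactly when the \<open>n + 1\<close> paths \<open>t \<mapsto> W (i + t) - i h\<close>, \<open>0 \<le> t \<le> 1\<close>, remain in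
  strictly decreasing order.  With \<open>W 0 = 0\<close> and \<open>W (i + 1) = W i + s\<^sub>i\<close> these paths lead from the points
  \<open>W i - i h\<close> to the points \<open>W (i + 1) - i h\<close>, and the Karlin--McGregor formula gives the density of the paths
  that do not collide as the determinant of the heat kernels between the two sets of points, which is
  \<open>det [\<phi> (s\<^sub>i + a\<^sub>i\<^sub>j)]\<close>.

  The argument works on the grid of times \<open>k / m\<close>.  Let \<open>D\<^sub>t a b\<close> be the determinant of the heat kernels and
  \<open>p\<^sub>t a b\<close> the product of its diagonal entries.  Three facts carry the proof.  The kernels \<open>D\<^sub>t\<close> form a semigroup
  on the chamber of decreasing points (\<open>km_det_semigroup\<close>), so \<open>D\<^sub>1\<close> is the integral over chamber-valued grid
  paths of a product of \<open>m\<close> factors \<open>D\<close> at time \<open>1 / m\<close> (\<open>chain_density_integral\<close>).  On the chamber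
  \<open>0 \<le> D\<^sub>t \<le> p\<^sub>t\<close> (\<open>km_det_bounds\<close>, from the total positivity of \<open>exp (x y)\<close>).  Between points whose gaps are at
  least \<open>\<epsilon>\<close>, \<open>D\<^sub>t \<ge> (1 - (n + 1)! exp (- \<epsilon>\<^sup>2 / t)) p\<^sub>t\<close> (\<open>km_det_lower\<close>).  Replacing each \<open>D\<close> by \<open>p\<close> turns the
  integral into a probability for a Gaussian random walk; hence the integral of the determinant lies between the
  probability that the grid values stay below \<open>h\<close> and \<open>1 - o(1)\<close> times the probability that they stay below
  \<open>h - \<epsilon>\<close> (\<open>det_mass_upper\<close>, \<open>det_mass_lower\<close>).  As \<open>m\<close> grows this becomes a sandwich for the path itself, and
  since the determinant integral is continuous in \<open>h\<close> (\<open>det_integral_tendsto\<close>) the two sides agree in the limit.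

  The walk and the law \<open>P\<close> are compared through characteristic functions (\<open>box_probability_unique\<close>).  The walk is
  not conditioned, so the starting value of \<open>P\<close> is randomized: adding \<open>R t (z - x)\<close> with an independent standard
  normal \<open>z\<close> to a path of \<open>P\<close> restores the stationary covariance (\<open>restarted_char\<close>).  This gives the sandwich after
  integration over starting values near \<open>x\<close>, and the continuity of the determinant integral in the starting value
  localizes it at \<open>x\<close>.\<close>

section \<open>Determinants of exponential kernels\<close>

text \<open>The new zeros are again increasing and lie to the left of the last old zero; this is what an induction on the
  number of exponents consumes.\<close>

lemma exp_sum_rolle:
  fixes F F' :: "real \<Rightarrow> real" and x :: "nat \<Rightarrow> real"
  assumes x: "strict_mono_on {..N} x" and z: "\<And>i. i \<le> N \<Longrightarrow> F (x i) = 0"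
    and D: "\<And>s. (F has_real_derivative F' s) (at s)"
  obtains \<xi> where "strict_mono_on {..<N} \<xi>" "\<And>i. i < N \<Longrightarrow> F' (\<xi> i) = 0" "\<And>i. i < N \<Longrightarrow> \<xi> i < x N"
proof -
  have "\<exists>u. x i < u \<and> u < x (Suc i) \<and> F' u = 0" if "i < N" for i
  proof -
    have "x i < x (Suc i)" using x that by (auto simp: strict_mono_on_def)
    moreover have "F (x i) = F (x (Suc i))" using z that by simp
    moreover have "continuous_on {x i..x (Suc i)} F"
      by (intro continuous_at_imp_continuous_on ballI DERIV_isCont[OF D])
    ultimately obtain u where u: "x i < u" "u < x (Suc i)" "(F has_real_derivative 0) (at u)"
      using Rolle[of "x i" "x (Suc i)" F] D real_differentiable_def by blast
    then show ?thesis using DERIV_unique[OF D] by blast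
  qed
  then obtain \<xi> where \<xi>: "\<And>i. i < N \<Longrightarrow> x i < \<xi> i" "\<And>i. i < N \<Longrightarrow> \<xi> i < x (Suc i)" "\<And>i. i < N \<Longrightarrow> F' (\<xi> i) = 0"
    by metis
  have mono: "x i \<le> x j" if "i \<le> j" "j \<le> N" for i j
    using x that by (cases "i = j") (auto simp: strict_mono_on_def less_imp_le)
  show ?thesis
  proof
    show "strict_mono_on {..<N} \<xi>"
    proof (rule strict_mono_onI)
      fix r s assume rs: "r \<in> {..<N}" "s \<in> {..<N}" "r < s"
      then have "\<xi> r < x (Suc r)" "x (Suc r) \<le> x s" "x s < \<xi> s" using \<xi> mono by auto
      then show "\<xi> r < \<xi> s" by linarith
    qed
    show "\<xi> i < x N" if "i < N" for i
      using \<xi>(2)[OF that] mono[of "Suc i" N] that by linarith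
  qed (use \<xi> in auto)
qed

text \<open>Descartes' rule of signs for exponential sums.  Dividing by the term of smallest exponent and differentiating
  removes that term, costs one zero by Rolle, and keeps the leading coefficient positive; so the derivative is
  positive from the last zero on.\<close>

lemma exp_sum_pos:
  fixes a x y :: "nat \<Rightarrow> real"
  assumes "strict_mono_on {..N} y" "strict_mono_on {..<N} x"
    and "\<And>i. i < N \<Longrightarrow> (\<Sum>j\<le>N. a j * exp (y j * x i)) = 0"
    and "a N > 0" and "\<And>i. i < N \<Longrightarrow> x i < t"
  shows "(\<Sum>j\<le>N. a j * exp (y j * t)) > 0"
  using assms
proof (induction N arbitrary: a x y t)
  case 0
  then show ?case by simp
next
  case (Suc N)
  define F where "F s = (\<Sum>j\<le>Suc N. a j * exp ((y j - y 0) * s))" for s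
  define F' where "F' s = (\<Sum>j\<le>N. (a (Suc j) * (y (Suc j) - y 0)) * exp ((y (Suc j) - y 0) * s))" for s
  have F_alt: "F s = exp (- y 0 * s) * (\<Sum>j\<le>Suc N. a j * exp (y j * s))" for s
    unfolding F_def sum_distrib_left
    by (intro sum.cong refl) (simp add: algebra_simps flip: exp_add)
  have D: "(F has_real_derivative F' s) (at s)" for s
    unfolding F_def F'_def
    by (subst sum.atMost_Suc_shift) (auto intro!: derivative_eq_intros sum.cong simp: algebra_simps)
  have y0: "y 0 < y (Suc j)" if "j \<le> N" for j using Suc.prems(1) that by (auto simp: strict_mono_on_def)
  have xm: "strict_mono_on {..N} x" using Suc.prems(2) by (simp add: lessThan_Suc_atMost)
  have z: "F (x i) = 0" if "i \<le> N" for i using Suc.prems(3)[of i] that by (simp add: F_alt)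
  obtain \<xi> where \<xi>: "strict_mono_on {..<N} \<xi>" "\<And>i. i < N \<Longrightarrow> F' (\<xi> i) = 0" "\<And>i. i < N \<Longrightarrow> \<xi> i < x N"
    using exp_sum_rolle[OF xm z D] by blast
  have pos: "F' s > 0" if s: "s \<ge> x N" for s
    unfolding F'_def
  proof (rule Suc.IH)
    show "strict_mono_on {..N} (\<lambda>j. y (Suc j) - y 0)"
      using Suc.prems(1) by (auto simp: strict_mono_on_def)
    show "\<xi> i < s" if "i < N" for i using \<xi>(3)[OF that] s by simp
    show "0 < a (Suc N) * (y (Suc N) - y 0)" using Suc.prems(4) y0[of N] by simp
  qed (use \<xi> in \<open>auto simp: F'_def\<close>)
  have "F (x N) < F t"
    using Suc.prems(5)[of N] D pos by (intro DERIV_pos_imp_increasing[of "x N" t F]) auto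
  then show ?case using z[of N] by (simp add: F_alt zero_less_mult_iff)
qed

definition exp_mat :: "nat \<Rightarrow> (nat \<Rightarrow> real) \<Rightarrow> (nat \<Rightarrow> real) \<Rightarrow> real mat" where
  "exp_mat N x y = Matrix.mat N N (\<lambda>(i, j). exp (x i * y j))"

lemma exp_mat_expand_last_row:
  "Determinant.det (exp_mat (Suc N) (x(N := t)) y) =
     (\<Sum>j\<le>N. ((-1) ^ (N + j) * Determinant.det (exp_mat N x (\<lambda>k. y (insert_index j k)))) * exp (y j * t))"
proof -
  let ?A = "exp_mat (Suc N) (x(N := t)) y"
  have "Determinant.det ?A = (\<Sum>j<Suc N. ?A $$ (N, j) * cofactor ?A N j)"
    by (rule laplace_expansion_row) (auto simp: exp_mat_def)
  also have "\<dots> = (\<Sum>j\<le>N. ((-1) ^ (N + j) * Determinant.det (exp_mat N x (\<lambda>k. y (insert_index j k)))) * exp (y j * t))"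
    unfolding lessThan_Suc_atMost
  proof (intro sum.cong refl)
    fix j assume j: "j \<in> {..N}"
    have "mat_delete ?A N j = exp_mat N x (\<lambda>k. y (insert_index j k))"
      by (rule eq_matI) (use j in \<open>auto simp: mat_delete_def exp_mat_def insert_index_def\<close>)
    then show "?A $$ (N, j) * cofactor ?A N j =
        ((-1) ^ (N + j) * Determinant.det (exp_mat N x (\<lambda>k. y (insert_index j k)))) * exp (y j * t)"
      using j by (simp add: cofactor_def exp_mat_def mult.commute)
  qed
  finally show ?thesis .
qed

text \<open>The determinant is an exponential sum in its last row variable.  It vanishes at the earlier row variables and
  its coefficients are signed minors, so positivity is \<open>exp_sum_pos\<close>.  Divided by its leading exponential, the sum
  has a derivative of the same kind; hence it increases beyond its last zero towards the leading minor, which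
  bounds it.\<close>

lemma exp_mat_det_bounds:
  assumes "strict_mono_on {..<N} x" "strict_mono_on {..<N} y"
  shows "0 < Determinant.det (exp_mat N x y) \<and> Determinant.det (exp_mat N x y) \<le> (\<Prod>i<N. exp (x i * y i))"
  using assms
proof (induction N arbitrary: x y)
  case 0
  then show ?case by (simp add: exp_mat_def)
next
  case (Suc N)
  define c where "c j = (-1) ^ (N + j) * Determinant.det (exp_mat N x (\<lambda>k. y (insert_index j k)))" for j
  define f where "f t = (\<Sum>j\<le>N. c j * exp (y j * t))" for t
  have xm: "strict_mono_on {..<N} x" using Suc.prems(1) by (auto simp: strict_mono_on_def)
  have ym: "strict_mono_on {..N} y" using Suc.prems(2) by (simp add: lessThan_Suc_atMost)
  have minor: "0 < Determinant.det (exp_mat N x (\<lambda>k. y (insert_index j k)))"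
    "Determinant.det (exp_mat N x (\<lambda>k. y (insert_index j k))) \<le> (\<Prod>i<N. exp (x i * y (insert_index j i)))" if "j \<le> N" for j
    using Suc.IH[OF xm, of "\<lambda>k. y (insert_index j k)"] ym that
    by (auto simp: strict_mono_on_def insert_index_def)
  have f_det: "f t = Determinant.det (exp_mat (Suc N) (x(N := t)) y)" for t
    by (simp add: f_def c_def exp_mat_expand_last_row)
  have f0: "f (x i) = 0" if "i < N" for i
    unfolding f_det
    by (rule det_identical_rows[where n = "Suc N" and i = i and j = N])
       (use that in \<open>auto simp: exp_mat_def intro!: eq_vecI\<close>)
  have fN: "f (x N) = Determinant.det (exp_mat (Suc N) x y)"
    by (simp add: f_det)
  have cN: "c N = Determinant.det (exp_mat N x (\<lambda>k. y (insert_index N k)))"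
    by (simp add: c_def power_add flip: power_mult_distrib)
  have xN: "x i < x N" if "i < N" for i using Suc.prems(1) that by (auto simp: strict_mono_on_def)
  have "f (x N) > 0"
    unfolding f_def
    by (rule exp_sum_pos[OF ym xm]) (use f0 cN minor[of N] xN in \<open>auto simp: f_def\<close>)
  moreover have "f (x N) \<le> c N * exp (x N * y N)"
  proof (cases N)
    case 0
    then show ?thesis by (simp add: f_def mult.commute)
  next
    case N: (Suc K)
    \<comment> \<open>The quotient by the leading exponential; its limit at infinity is the leading minor.\<close>
    define F where "F s = (\<Sum>j\<le>N. c j * exp ((y j - y N) * s))" for s
    define F' where "F' s = (\<Sum>j\<le>K. (c j * (y j - y N)) * exp ((y j - y N) * s))" for s
    have F_alt: "F s = exp (- y N * s) * f s" for s
      unfolding F_def f_def sum_distrib_left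
      by (intro sum.cong refl) (simp add: algebra_simps flip: exp_add)
    have D: "(F has_real_derivative F' s) (at s)" for s
      unfolding F_def F'_def N
      by (auto intro!: derivative_eq_intros sum.cong simp: algebra_simps)
    have xK: "strict_mono_on {..K} x" using xm N by (simp add: lessThan_Suc_atMost)
    have z: "F (x i) = 0" if "i \<le> K" for i using f0[of i] that N by (simp add: F_alt)
    obtain \<xi> where \<xi>: "strict_mono_on {..<K} \<xi>" "\<And>i. i < K \<Longrightarrow> F' (\<xi> i) = 0" "\<And>i. i < K \<Longrightarrow> \<xi> i < x K"
      using exp_sum_rolle[OF xK z D] by blast
    have "c K = - Determinant.det (exp_mat N x (\<lambda>k. y (insert_index K k)))"
      by (simp add: c_def N power_add flip: power_mult_distrib)
    then have cK: "c K < 0" using minor[of K] N by simp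
    have pos: "F' s > 0" if s: "s \<ge> x K" for s
      unfolding F'_def
    proof (rule exp_sum_pos)
      show "strict_mono_on {..K} (\<lambda>j. y j - y N)"
        using ym N by (auto simp: strict_mono_on_def)
      show "\<xi> i < s" if "i < K" for i using \<xi>(3)[OF that] s by simp
      show "0 < c K * (y K - y N)" using cK ym N by (auto simp: strict_mono_on_def mult_neg_neg)
    qed (use \<xi> in \<open>auto simp: F'_def\<close>)
    have mono: "F (x N) \<le> F s" if "s \<ge> x N" for s
    proof (rule DERIV_nonneg_imp_nondecreasing[OF that])
      fix u assume "x N \<le> u"
      then have "u \<ge> x K" using xN[of K] N by simp
      then show "\<exists>v. DERIV F u :> v \<and> 0 \<le> v" using D pos by (meson less_imp_le)
    qed
    have "((\<lambda>s. exp ((y j - y N) * s)) \<longlongrightarrow> (if j = N then 1 else 0)) at_top" if "j \<le> N" for j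
    proof (cases "j = N")
      case False
      then have "y j - y N < 0" using ym that by (auto simp: strict_mono_on_def)
      then have "filterlim (\<lambda>s. (y j - y N) * s) at_bot at_top"
        by (simp add: filterlim_tendsto_neg_mult_at_bot[OF tendsto_const _ filterlim_ident])
      then show ?thesis using False by (auto intro: filterlim_compose[OF exp_at_bot])
    qed simp
    then have "(F \<longlongrightarrow> (\<Sum>j\<le>N. c j * (if j = N then 1 else 0))) at_top"
      unfolding F_def by (intro tendsto_intros) auto
    then have "(F \<longlongrightarrow> c N) at_top" by (simp add: if_distrib[of "\<lambda>x. _ * x"] cong: if_cong)
    then have "F (x N) \<le> c N"
      by (rule tendsto_lowerbound) (auto simp: eventually_at_top_linorder intro!: exI[of _ "x N"] mono)
    then have "F (x N) * exp (x N * y N) \<le> c N * exp (x N * y N)" by (rule mult_right_mono) simp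
    moreover have "F (x N) * exp (x N * y N) = f (x N)"
      unfolding F_alt by (simp add: mult.commute[of "y N"] mult.assoc[symmetric] mult.commute[of _ "f (x N)"] exp_minus)
    ultimately show ?thesis by simp
  qed
  moreover have le: "c N \<le> (\<Prod>i<N. exp (x i * y i))"
    using minor(2)[of N] unfolding cN by (simp add: insert_index_def)
  moreover have "c N * exp (x N * y N) \<le> (\<Prod>i<N. exp (x i * y i)) * exp (x N * y N)"
    using le by (rule mult_right_mono) simp
  ultimately show ?case unfolding fN[symmetric] prod.lessThan_Suc by linarith
qed

section \<open>The Karlin--McGregor determinant of the heat kernel\<close>

abbreviation heat :: "real \<Rightarrow> real \<Rightarrow> real" where
  "heat \<tau> \<equiv> normal_density 0 (sqrt \<tau>)"

text \<open>The Karlin--McGregor kernel: for ordered points, the density of \<open>d\<close> independent Brownian motions going from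
  \<open>a\<close> to \<open>b\<close> in time \<open>\<tau>\<close> without collision.\<close>

definition km_det :: "nat \<Rightarrow> real \<Rightarrow> (nat \<Rightarrow> real) \<Rightarrow> (nat \<Rightarrow> real) \<Rightarrow> real" where
  "km_det d \<tau> a b = Determinant.det (Matrix.mat d d (\<lambda>(i, j). heat \<tau> (a i - b j)))"

definition chamber :: "nat \<Rightarrow> (nat \<Rightarrow> real) set" where
  "chamber d = {a. \<forall>i. Suc i < d \<longrightarrow> a (Suc i) < a i}"

lemma chamber_less:
  assumes "a \<in> chamber d" "i < j" "j < d"
  shows "a j < a i"
  using assms(2,3)
proof (induction j)
  case (Suc j)
  have "a (Suc j) < a j" using assms(1) Suc.prems by (auto simp: chamber_def)
  then show ?case using Suc by (cases "i = j") auto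
qed simp

lemma leibniz_det:
  "Determinant.det (Matrix.mat d d f) = (\<Sum>p | p permutes {..<d}. of_int (sign p) * (\<Prod>i<d. f (i, p i)))"
proof -
  have "p permutes {..<d} \<Longrightarrow> i < d \<Longrightarrow> p i < d" for p i
    using permutes_in_image[of p "{..<d}" i] by simp
  then show ?thesis
    unfolding Determinant.det_def
    by (auto simp: atLeast0LessThan intro!: sum.cong prod.cong)
qed

lemma km_det_leibniz:
  "km_det d \<tau> a b = (\<Sum>p | p permutes {..<d}. of_int (sign p) * (\<Prod>i<d. heat \<tau> (a i - b (p i))))"
  by (simp add: km_det_def leibniz_det)

lemma normal_density_diff:
  assumes "\<tau> > 0"
  shows "heat \<tau> (u - v) =
    1 / sqrt (2 * pi * \<tau>) * exp (- u\<^sup>2 / (2 * \<tau>)) * exp (- v\<^sup>2 / (2 * \<tau>)) * exp (u * v / \<tau>)"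
  using assms by (simp add: normal_density_def field_simps power2_eq_square flip: exp_add)

text \<open>Up to factors that depend on one endpoint only, the heat kernel is the exponential kernel; these factors come
  out of every permutation product alike.\<close>

lemma km_det_weight:
  assumes "\<tau> > 0"
  obtains C where "C > 0" "km_det d \<tau> a b = C * Determinant.det (exp_mat d (\<lambda>i. - a i / \<tau>) (\<lambda>i. - b i))"
    "\<And>p. p permutes {..<d} \<Longrightarrow>
      (\<Prod>i<d. heat \<tau> (a i - b (p i))) = C * (\<Prod>i<d. exp (a i * b (p i) / \<tau>))"
proof
  let ?C = "(\<Prod>i<d. 1 / sqrt (2 * pi * \<tau>) * exp (- (a i)\<^sup>2 / (2 * \<tau>))) * (\<Prod>i<d. exp (- (b i)\<^sup>2 / (2 * \<tau>)))"
  show "?C > 0" using assms by (intro mult_pos_pos prod_pos) auto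
  show *: "(\<Prod>i<d. heat \<tau> (a i - b (p i))) = ?C * (\<Prod>i<d. exp (a i * b (p i) / \<tau>))"
    if p: "p permutes {..<d}" for p
  proof -
    have "(\<Prod>i<d. exp (- (b (p i))\<^sup>2 / (2 * \<tau>))) = (\<Prod>i<d. exp (- (b i)\<^sup>2 / (2 * \<tau>)))"
      by (rule prod.permute[OF p, symmetric, unfolded comp_def])
    then show ?thesis unfolding normal_density_diff[OF assms] prod.distrib by simp
  qed
  show "km_det d \<tau> a b = ?C * Determinant.det (exp_mat d (\<lambda>i. - a i / \<tau>) (\<lambda>i. - b i))"
    unfolding km_det_leibniz exp_mat_def leibniz_det sum_distrib_left
    by (intro sum.cong refl) (simp add: *)
qed

lemma km_det_bounds:
  assumes "\<tau> > 0" "a \<in> chamber d" "b \<in> chamber d"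
  shows "0 \<le> km_det d \<tau> a b" "km_det d \<tau> a b \<le> (\<Prod>i<d. heat \<tau> (a i - b i))"
proof -
  obtain C where C: "C > 0" "km_det d \<tau> a b = C * Determinant.det (exp_mat d (\<lambda>i. - a i / \<tau>) (\<lambda>i. - b i))"
    "\<And>p. p permutes {..<d} \<Longrightarrow>
      (\<Prod>i<d. heat \<tau> (a i - b (p i))) = C * (\<Prod>i<d. exp (a i * b (p i) / \<tau>))"
    using km_det_weight[OF assms(1), of d a b] by blast
  have m: "strict_mono_on {..<d} (\<lambda>i. - a i / \<tau>)" "strict_mono_on {..<d} (\<lambda>i. - b i)"
    using chamber_less[OF assms(2)] chamber_less[OF assms(3)] assms(1)
    by (auto simp: strict_mono_on_def divide_strict_right_mono)
  note bd = exp_mat_det_bounds[OF m]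
  show "0 \<le> km_det d \<tau> a b" using C bd by simp
  show "km_det d \<tau> a b \<le> (\<Prod>i<d. heat \<tau> (a i - b i))"
    using C(3)[OF permutes_id] C(1) bd unfolding C(2) by (simp add: mult_left_mono)
qed

text \<open>Only the indices exchanged between \<open>{..<k}\<close> and its image contribute.  Equally many enter as leave, and each
  exchange gains at least the gap \<open>e\<close>.\<close>

lemma rearrangement_tail:
  fixes b :: "nat \<Rightarrow> real"
  assumes p: "p permutes {..<d}" and b: "\<And>i j. i < j \<Longrightarrow> j < d \<Longrightarrow> b i - b j \<ge> e" and e: "e \<ge> 0"
    and k: "k \<le> d"
  shows "(\<Sum>i<k. b i - b (p i)) \<ge> (if p ` {..<k} = {..<k} then 0 else e)"
proof -
  let ?U = "{..<k}" and ?T = "p ` {..<k}"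
  have inj: "inj_on p ?U" using permutes_inj[OF p] inj_on_subset by blast
  have Td: "?T \<subseteq> {..<d}" using permutes_image[OF p] k by (metis image_mono lessThan_subset_iff)
  have card: "card ?T = card ?U" by (simp add: card_image[OF inj])
  have cd: "card (?T - ?U) = card (?U - ?T)"
    using card by (simp add: card_Diff_subset_Int Int_commute)
  have "(\<Sum>i<k. b i - b (p i)) = sum b ?U - sum b ?T"
    by (simp add: sum_subtractf sum.reindex[OF inj])
  also have "sum b ?U = sum b (?U \<inter> ?T) + sum b (?U - ?T)"
    by (rule sum.Int_Diff) simp
  also have "sum b ?T = sum b (?T \<inter> ?U) + sum b (?T - ?U)"
    by (rule sum.Int_Diff) simp
  finally have eq: "(\<Sum>i<k. b i - b (p i)) = sum b (?U - ?T) - sum b (?T - ?U)"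
    by (simp add: Int_commute)
  show ?thesis
  proof (cases "?T = ?U")
    case True
    then show ?thesis using eq by simp
  next
    case False
    then have "?U - ?T \<noteq> {}" using card card_subset_eq[of ?T ?U] by auto
    then have k0: "k > 0" and c: "card (?U - ?T) \<ge> 1"
      by (auto simp: Suc_le_eq card_gt_0_iff simp del: Diff_eq_empty_iff)
    have "sum b (?U - ?T) \<ge> of_nat (card (?U - ?T)) * b (k - 1)"
    proof (rule sum_bounded_below)
      fix i assume "i \<in> ?U - ?T"
      then have "i < k - 1 \<or> i = k - 1" by auto
      then show "b (k - 1) \<le> b i" using b[of i "k - 1"] k k0 e by (auto; linarith)
    qed
    moreover have "sum b (?T - ?U) \<le> of_nat (card (?T - ?U)) * (b (k - 1) - e)"
    proof (rule sum_bounded_above)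
      fix i assume "i \<in> ?T - ?U"
      then have "k - 1 < i" "i < d" using k0 Td by auto
      then show "b i \<le> b (k - 1) - e" using b[of "k - 1" i] by linarith
    qed
    ultimately have "(\<Sum>i<k. b i - b (p i)) \<ge> real (card (?U - ?T)) * e"
      unfolding eq cd by (simp add: algebra_simps)
    moreover have "real (card (?U - ?T)) * e \<ge> 1 * e"
      by (rule mult_right_mono) (use c e in auto)
    ultimately show ?thesis using False by simp
  qed
qed

text \<open>A quantitative rearrangement inequality by Abel summation: a permutation other than the identity moves some
  initial segment, and that segment alone contributes the square of the gap.\<close>

lemma rearrangement_gap:
  fixes a b :: "nat \<Rightarrow> real"
  assumes p: "p permutes {..<d}" "p \<noteq> id" and e: "e \<ge> 0"
    and a: "\<And>i. Suc i < d \<Longrightarrow> a i - a (Suc i) \<ge> e" and b: "\<And>i. Suc i < d \<Longrightarrow> b i - b (Suc i) \<ge> e"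
  shows "(\<Sum>i<d. a i * b i) - (\<Sum>i<d. a i * b (p i)) \<ge> e\<^sup>2"
proof -
  define g where "g i = b i - b (p i)" for i
  define s where "s k = (\<Sum>i<k. g i)" for k
  have gap: "b i - b j \<ge> e" if "i < j" "j < d" for i j
    using that
  proof (induction j)
    case (Suc j)
    show ?case using Suc b[of j] e by (cases "i = j") auto
  qed simp
  have s_ge: "s k \<ge> (if p ` {..<k} = {..<k} then 0 else e)" if "k \<le> d" for k
    unfolding s_def g_def by (rule rearrangement_tail[OF p(1) _ e that]) (rule gap)
  have s_nn: "s k \<ge> 0" if "k \<le> d" for k using s_ge[OF that] e by (auto split: if_splits)
  have sd: "s d = 0"
    unfolding s_def g_def sum_subtractf using sum.permute[OF p(1), of b] by (simp add: comp_def)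
  have abel: "(\<Sum>i<k. a i * g i) = (\<Sum>i<k - 1. (a i - a (Suc i)) * s (Suc i)) + a (k - 1) * s k" for k
  proof (induction k)
    case 0
    show ?case by (simp add: s_def)
  next
    case (Suc k)
    show ?case
    proof (cases k)
      case 0
      then show ?thesis by (simp add: s_def)
    next
      case (Suc l)
      have "s (Suc k) = s k + g k" by (simp add: s_def)
      then show ?thesis using Suc.IH by (simp add: Suc algebra_simps)
    qed
  qed
  have "\<exists>k<d. p ` {..<k} \<noteq> {..<k}"
  proof (rule ccontr)
    assume "\<not> (\<exists>k<d. p ` {..<k} \<noteq> {..<k})"
    then have im: "p ` {..<k} = {..<k}" if "k < d" for k using that by blast
    have im': "p ` {..<k} = {..<k}" if "k \<le> d" for k
      using im[of k] permutes_image[OF p(1)] that by (cases "k = d") auto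
    have "p i = i" for i
    proof (cases "i < d")
      case True
      have "p ` {..<Suc i} - p ` {..<i} = {..<Suc i} - {..<i}" using im'[of "Suc i"] im'[of i] True by simp
      moreover have "p ` {..<Suc i} - p ` {..<i} = {p i}"
        using permutes_inj[OF p(1)] by (auto simp: inj_def lessThan_Suc)
      moreover have "{..<Suc i} - {..<i} = {i}" by auto
      ultimately show ?thesis by simp
    next
      case False
      then show ?thesis using permutes_not_in[OF p(1)] by simp
    qed
    then show False using p(2) by auto
  qed
  then obtain k where k: "k < d" "p ` {..<k} \<noteq> {..<k}" by blast
  then have k0: "k > 0" by (cases k) auto
  have "e * e \<le> (a (k - 1) - a (Suc (k - 1))) * s (Suc (k - 1))"
    using a[of "k - 1"] s_ge[of k] k k0 e by (intro mult_mono) auto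
  also have "\<dots> \<le> (\<Sum>i<d - 1. (a i - a (Suc i)) * s (Suc i))"
  proof (rule member_le_sum)
    fix i assume i: "i \<in> {..<d - 1} - {k - 1}"
    then have "e \<le> a i - a (Suc i)" using a[of i] by auto
    then have "0 \<le> a i - a (Suc i)" using e by linarith
    then show "0 \<le> (a i - a (Suc i)) * s (Suc i)" using s_nn[of "Suc i"] i by auto
  qed (use k k0 in auto)
  also have "\<dots> = (\<Sum>i<d. a i * g i)" using abel[of d] sd by simp
  finally show ?thesis by (simp add: g_def algebra_simps sum_subtractf power2_eq_square)
qed

text \<open>Over a short time, particles with wide gaps do not collide: each of the fewer than \<open>d!\<close> non-identical
  assignments in the Leibniz sum is suppressed by the rearrangement gap.\<close>

lemma km_det_lower:
  assumes t: "\<tau> > 0" and e: "e \<ge> 0"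
    and a: "\<And>i. Suc i < d \<Longrightarrow> a i - a (Suc i) \<ge> e" and b: "\<And>i. Suc i < d \<Longrightarrow> b i - b (Suc i) \<ge> e"
  shows "km_det d \<tau> a b \<ge> (1 - fact d * exp (- e\<^sup>2 / \<tau>)) * (\<Prod>i<d. heat \<tau> (a i - b i))"
proof -
  let ?P = "{p. p permutes {..<d}}"
  define g where "g p = (\<Prod>i<d. heat \<tau> (a i - b (p i)))" for p
  have g_nn: "g p \<ge> 0" for p unfolding g_def by (intro prod_nonneg) simp
  obtain C where C: "C > 0"
    "\<And>p. p permutes {..<d} \<Longrightarrow> g p = C * (\<Prod>i<d. exp (a i * b (p i) / \<tau>))"
  proof (rule km_det_weight[OF t, of d a b], goal_cases)
    case (1 C)
    from 1(1)[OF 1(2)] 1(4) show ?case by (simp add: g_def)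
  qed
  have g_le: "g p \<le> exp (- e\<^sup>2 / \<tau>) * g id" if p: "p permutes {..<d}" "p \<noteq> id" for p
  proof -
    have E: "(\<Prod>i<d. exp (a i * b (p i) / \<tau>)) = exp ((\<Sum>i<d. a i * b (p i)) / \<tau>)" for p
      by (simp add: exp_sum sum_divide_distrib)
    have "(\<Sum>i<d. a i * b (p i)) \<le> - e\<^sup>2 + (\<Sum>i<d. a i * b i)"
      using rearrangement_gap[where a = a and b = b, OF p e] a b by simp
    then have "(\<Sum>i<d. a i * b (p i)) / \<tau> \<le> (- e\<^sup>2 + (\<Sum>i<d. a i * b i)) / \<tau>"
      using t by (simp add: divide_right_mono)
    then have "exp ((\<Sum>i<d. a i * b (p i)) / \<tau>) \<le> exp (- e\<^sup>2 / \<tau>) * exp ((\<Sum>i<d. a i * b i) / \<tau>)"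
      by (simp add: add_divide_distrib diff_divide_distrib flip: exp_add)
    then have "C * exp ((\<Sum>i<d. a i * b (p i)) / \<tau>) \<le> C * (exp (- e\<^sup>2 / \<tau>) * exp ((\<Sum>i<d. a i * b i) / \<tau>))"
      using C(1) by simp
    then show ?thesis using C(2)[OF p(1)] C(2)[OF permutes_id] E by (simp add: mult_ac)
  qed
  have fin: "finite ?P" by (simp add: finite_permutations)
  have "km_det d \<tau> a b = g id + (\<Sum>p\<in>?P - {id}. of_int (sign p) * g p)"
    unfolding km_det_leibniz g_def[symmetric]
    by (subst sum.remove[OF fin, of id]) (auto simp: permutes_id)
  moreover have "(\<Sum>p\<in>?P - {id}. - (exp (- e\<^sup>2 / \<tau>) * g id)) \<le> (\<Sum>p\<in>?P - {id}. of_int (sign p) * g p)"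
  proof (rule sum_mono)
    fix p assume "p \<in> ?P - {id}"
    then show "- (exp (- e\<^sup>2 / \<tau>) * g id) \<le> of_int (sign p) * g p"
      using g_le[of p] g_nn[of p] g_nn[of id] by (auto simp: sign_def)
  qed
  moreover have "(\<Sum>p\<in>?P - {id}. - (exp (- e\<^sup>2 / \<tau>) * g id)) \<ge> - (fact d * exp (- e\<^sup>2 / \<tau>) * g id)"
  proof -
    have "card (?P - {id}) \<le> fact d"
      using card_mono[OF fin, of "?P - {id}"] card_permutations[of "{..<d}" d] by simp
    then have "real (card (?P - {id})) \<le> fact d" by (metis of_nat_fact of_nat_le_iff)
    then have "real (card (?P - {id})) * (exp (- e\<^sup>2 / \<tau>) * g id) \<le> fact d * (exp (- e\<^sup>2 / \<tau>) * g id)"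
      using g_nn by (intro mult_right_mono) auto
    then show ?thesis by simp
  qed
  ultimately have "km_det d \<tau> a b \<ge> (1 - fact d * exp (- e\<^sup>2 / \<tau>)) * g id"
    by (simp add: algebra_simps)
  then show ?thesis by (simp add: g_def)
qed

section \<open>Lebesgue measure on finite products of lines\<close>

interpretation lborel_prod: product_sigma_finite "\<lambda>_::nat. lborel :: real measure"
  by standard

abbreviation leb_on :: "nat set \<Rightarrow> (nat \<Rightarrow> real) measure" where
  "leb_on I \<equiv> Pi\<^sub>M I (\<lambda>_. lborel)"

text \<open>Serves both to permute coordinates and to carry one time slice of a path, shifted by multiples of \<open>h\<close>, to a
  standard index set.\<close>

lemma distr_PiM_lborel_reindex:
  fixes c :: "nat \<Rightarrow> real"
  assumes [simp]: "finite L" and bij: "bij_betw e L K"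
  shows "distr (leb_on K) (leb_on L) (\<lambda>w. \<lambda>i\<in>L. w (e i) - c i) = leb_on L"
proof (rule lborel_prod.PiM_eqI)
  have finK: "finite K" using bij bij_betw_finite assms(1) by blast
  have eK: "e i \<in> K" if "i \<in> L" for i using bij that by (auto simp: bij_betw_def)
  let ?T = "\<lambda>w. \<lambda>i\<in>L. w (e i) - c i"
  have T[measurable]: "?T \<in> leb_on K \<rightarrow>\<^sub>M leb_on L"
    by (rule measurable_restrict) (use eK in measurable)
  fix A :: "nat \<Rightarrow> real set" assume A: "\<And>i. i \<in> L \<Longrightarrow> A i \<in> sets lborel"
  define B where "B k = (\<lambda>y. y - c (inv_into L e k)) -` A (inv_into L e k)" for k
  have inv: "inv_into L e (e i) = i" if "i \<in> L" for i
    using bij that by (auto simp: bij_betw_def)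
  have shift: "(\<lambda>y. y - u) -` D \<in> sets lborel \<and> emeasure lborel ((\<lambda>y. y - u) -` D) = emeasure lborel D"
    if D: "D \<in> sets lborel" for u :: real and D
  proof -
    have m: "(\<lambda>y. y - u) -` D \<in> sets borel"
      using measurable_sets[of "\<lambda>y. y - u" borel borel D] D by simp
    have "(+) (- u) = (\<lambda>y. y - u)" by auto
    then have "emeasure lborel D = emeasure (distr lborel borel (\<lambda>y. y - u)) D"
      using lborel_distr_plus[of "- u"] by simp
    also have "\<dots> = emeasure lborel ((\<lambda>y. y - u) -` D)"
      using D by (subst emeasure_distr) auto
    finally show ?thesis using m by simp
  qed
  have BL: "B (e i) \<in> sets lborel" "emeasure lborel (B (e i)) = emeasure lborel (A i)" if "i \<in> L" for i
    unfolding B_def inv[OF that] using shift[OF A[OF that]] by auto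
  have BK: "B k \<in> sets lborel" if "k \<in> K" for k
    using BL(1) that bij by (auto simp: bij_betw_def)
  have "?T -` Pi\<^sub>E L A \<inter> space (leb_on K) = Pi\<^sub>E K B"
  proof (rule equalityI; rule subsetI)
    fix w assume w: "w \<in> ?T -` Pi\<^sub>E L A \<inter> space (leb_on K)"
    show "w \<in> Pi\<^sub>E K B"
    proof (rule PiE_I)
      fix k assume "k \<in> K"
      then obtain i where "i \<in> L" "k = e i" using bij by (auto simp: bij_betw_def)
      then show "w k \<in> B k" using w by (auto simp: B_def inv PiE_iff)
    qed (use w in \<open>auto simp: space_PiM PiE_iff extensional_def\<close>)
  next
    fix w assume "w \<in> Pi\<^sub>E K B"
    then show "w \<in> ?T -` Pi\<^sub>E L A \<inter> space (leb_on K)"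
      using eK by (fastforce simp: B_def inv space_PiM PiE_iff)
  qed
  then have "emeasure (distr (leb_on K) (leb_on L) ?T) (Pi\<^sub>E L A) = emeasure (leb_on K) (Pi\<^sub>E K B)"
    using A by (subst emeasure_distr[OF T]) (auto intro!: sets_PiM_I_finite)
  also have "\<dots> = (\<Prod>k\<in>K. emeasure lborel (B k))"
    using BK finK by (simp add: lborel_prod.emeasure_PiM)
  also have "\<dots> = (\<Prod>i\<in>L. emeasure lborel (B (e i)))"
    by (rule prod.reindex_bij_betw[OF bij, symmetric])
  also have "\<dots> = (\<Prod>i\<in>L. emeasure lborel (A i))"
    by (intro prod.cong refl BL(2))
  finally show "emeasure (distr (leb_on K) (leb_on L) ?T) (Pi\<^sub>E L A) = (\<Prod>i\<in>L. emeasure lborel (A i))" .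
qed auto

lemma nn_integral_PiM_lborel_reindex:
  fixes c :: "nat \<Rightarrow> real"
  assumes "finite L" "bij_betw e L K" "f \<in> borel_measurable (leb_on L)"
  shows "(\<integral>\<^sup>+w. f (\<lambda>i\<in>L. w (e i) - c i) \<partial>leb_on K) = (\<integral>\<^sup>+w. f w \<partial>leb_on L)"
proof -
  have eK: "e i \<in> K" if "i \<in> L" for i using assms(2) that by (auto simp: bij_betw_def)
  have T: "(\<lambda>w. \<lambda>i\<in>L. w (e i) - c i) \<in> leb_on K \<rightarrow>\<^sub>M leb_on L"
    by (rule measurable_restrict) (use eK in measurable)
  show ?thesis
    using nn_integral_distr[OF T, of f] assms(3) unfolding distr_PiM_lborel_reindex[OF assms(1,2)] by simp
qed

lemma integral_PiM_lborel_permute: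
  fixes f :: "(nat \<Rightarrow> real) \<Rightarrow> real"
  assumes L: "finite L" "p permutes L" and f: "f \<in> borel_measurable (leb_on L)"
  shows "(\<integral>w. f (\<lambda>i\<in>L. w (p i)) \<partial>leb_on L) = (\<integral>w. f w \<partial>leb_on L)"
    and "integrable (leb_on L) (\<lambda>w. f (\<lambda>i\<in>L. w (p i))) \<longleftrightarrow> integrable (leb_on L) f"
proof -
  have bij: "bij_betw p L L" by (rule permutes_imp_bij[OF L(2)])
  have T: "(\<lambda>w. \<lambda>i\<in>L. w (p i)) \<in> leb_on L \<rightarrow>\<^sub>M leb_on L"
    by (rule measurable_restrict, rule measurable_component_singleton) (simp add: permutes_in_image[OF L(2)])
  have D: "distr (leb_on L) (leb_on L) (\<lambda>w. \<lambda>i\<in>L. w (p i)) = leb_on L"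
    using distr_PiM_lborel_reindex[OF L(1) bij, of "\<lambda>_. 0"] by simp
  show "(\<integral>w. f (\<lambda>i\<in>L. w (p i)) \<partial>leb_on L) = (\<integral>w. f w \<partial>leb_on L)"
    using integral_distr[OF T f] unfolding D by simp
  show "integrable (leb_on L) (\<lambda>w. f (\<lambda>i\<in>L. w (p i))) \<longleftrightarrow> integrable (leb_on L) f"
    using integrable_distr_eq[OF T f] unfolding D by simp
qed

lemma AE_PiM_lborel_inj:
  assumes I: "finite I"
  shows "AE v in leb_on I. inj_on v I"
proof -
  have "AE v in leb_on I. v i \<noteq> v j" if ij: "i \<in> I" "j \<in> I" "i \<noteq> j" for i j
  proof -
    let ?J = "I - {i}" and ?N = "{v \<in> space (leb_on I). v i = v j}"
    have iJ: "insert i ?J = I" using ij by auto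
    have N: "?N \<in> sets (leb_on I)" using ij by measurable
    have "emeasure (leb_on I) ?N = (\<integral>\<^sup>+v. indicator ?N v \<partial>leb_on (insert i ?J))"
      using nn_integral_indicator[OF N] unfolding iJ by simp
    also have "\<dots> = (\<integral>\<^sup>+x. (\<integral>\<^sup>+y. indicator ?N (x(i := y)) \<partial>lborel) \<partial>leb_on ?J)"
      by (rule lborel_prod.product_nn_integral_insert)
         (use I borel_measurable_indicator[OF N] in \<open>auto simp only: iJ\<close>)
    also have "\<dots> \<le> (\<integral>\<^sup>+x. 0 \<partial>leb_on ?J)"
    proof (rule nn_integral_mono)
      fix x
      have "(\<integral>\<^sup>+y. indicator ?N (x(i := y)) \<partial>lborel) \<le> (\<integral>\<^sup>+y. indicator {x j} y \<partial>lborel)"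
        using ij by (intro nn_integral_mono) (auto simp: indicator_def)
      then show "(\<integral>\<^sup>+y. indicator ?N (x(i := y)) \<partial>lborel) \<le> 0" by simp
    qed
    finally have "emeasure (leb_on I) ?N = 0" by simp
    then show ?thesis using N by (intro AE_I[of _ _ ?N]) auto
  qed
  then have "AE v in leb_on I. \<forall>i\<in>I. \<forall>j\<in>I. i \<noteq> j \<longrightarrow> v i \<noteq> v j"
    using I by (intro AE_finite_allI) auto
  then show ?thesis by (auto simp: inj_on_def elim!: eventually_mono)
qed

section \<open>The semigroup property on the chamber\<close>

text \<open>The rank of a coordinate among all of them is the inverse of the sorting permutation.\<close>

lemma ex1_sorting_permutation:
  fixes v :: "nat \<Rightarrow> real"
  assumes inj: "inj_on v {..<d}"
  shows "\<exists>!p. p permutes {..<d} \<and> (\<lambda>i. v (p i)) \<in> chamber d"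
proof -
  define r where "r i = card {j \<in> {..<d}. v i < v j}" for i
  have r_less: "r k < r i" if "v i < v k" "k < d" for i k
    unfolding r_def by (rule psubset_card_mono) (use that in auto)
  have r_inj: "inj_on r {..<d}"
  proof (rule inj_onI)
    fix i k assume ik: "i \<in> {..<d}" "k \<in> {..<d}" "r i = r k"
    then have "v i = v k" using r_less[of i k] r_less[of k i] by (cases "v i" "v k" rule: linorder_cases) auto
    then show "i = k" using inj ik by (auto dest: inj_onD)
  qed
  have r_lt: "r i < d" if "i < d" for i
  proof -
    have "r i < card {..<d}" unfolding r_def by (rule psubset_card_mono) (use that in auto)
    then show ?thesis by simp
  qed
  have r_im: "r ` {..<d} = {..<d}"
    by (rule endo_inj_surj) (use r_inj r_lt in auto)
  have rank: "r (p i) = i" if p: "p permutes {..<d}" "(\<lambda>i. v (p i)) \<in> chamber d" and i: "i < d" for p i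
  proof -
    have "v (p i) < v (p k) \<longleftrightarrow> k < i" if "k < d" for k
      using chamber_less[OF p(2), of k i] chamber_less[OF p(2), of i k] i that
      by (cases k i rule: linorder_cases) auto
    then have "{j \<in> p ` {..<d}. v (p i) < v j} = p ` {..<i}"
      using i by (auto simp: image_iff)
    then have "r (p i) = card (p ` {..<i})" by (simp add: r_def permutes_image[OF p(1)])
    then show ?thesis using card_image[OF inj_on_subset[OF permutes_inj[OF p(1)]], of "{..<i}"] by simp
  qed
  define q where "q i = (if i < d then inv_into {..<d} r i else i)" for i
  have rq: "r (q i) = i" "q i < d" if "i < d" for i
    using that f_inv_into_f[of i r "{..<d}"] inv_into_into[of i r "{..<d}"] by (auto simp: q_def r_im)
  have "bij_betw q {..<d} {..<d}"
  proof -
    have "bij_betw (inv_into {..<d} r) {..<d} {..<d}"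
      by (rule bij_betw_inv_into) (simp add: bij_betw_def r_inj r_im)
    then show ?thesis by (rule bij_betw_cong[THEN iffD1, rotated]) (simp add: q_def)
  qed
  then have "q permutes {..<d}" by (rule bij_imp_permutes) (simp add: q_def)
  moreover have "(\<lambda>i. v (q i)) \<in> chamber d"
    unfolding chamber_def
  proof safe
    fix i assume i: "Suc i < d"
    have "v (q i) \<noteq> v (q (Suc i))"
      using inj_onD[OF inj, of "q i" "q (Suc i)"] rq(1)[of i] rq[of "Suc i"] rq(2)[of i] i by force
    moreover have "\<not> v (q i) < v (q (Suc i))" using r_less[of "q i" "q (Suc i)"] rq[of i] rq[of "Suc i"] i by auto
    ultimately show "v (q (Suc i)) < v (q i)" by simp
  qed
  ultimately show ?thesis
  proof (intro ex1I[of _ q])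
    fix p assume p: "p permutes {..<d} \<and> (\<lambda>i. v (p i)) \<in> chamber d"
    show "p = q"
    proof
      fix i show "p i = q i"
      proof (cases "i < d")
        case True
        have "p i < d" using permutes_in_image[of p "{..<d}" i] p True by simp
        then show ?thesis using inj_onD[OF r_inj, of "p i" "q i"] rank[of p i] p rq[of i] True by simp
      next
        case False
        then show ?thesis using p permutes_not_in[of p "{..<d}" i] by (simp add: q_def)
      qed
    qed
  qed auto
qed

lemma normal_density_convolution:
  fixes a b :: real
  assumes s: "s > 0" and t: "t > 0"
  shows "has_bochner_integral lborel (\<lambda>y. heat s (a - y) * heat t (y - b))
     (heat (s + t) (a - b))"
proof (rule has_bochner_integral_nn_integral)
  have "(\<integral>\<^sup>+y. ennreal (heat s (a - y) * heat t (y - b)) \<partial>lborel)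
     = (\<integral>\<^sup>+y. ennreal (heat s ((a - b) - y) * heat t y) \<partial>lborel)"
    by (subst nn_integral_real_affine[where c = 1 and t = b]) (auto simp: algebra_simps)
  also have "\<dots> = ennreal (heat (s + t) (a - b))"
    using conv_normal_density_zero_mean[of "sqrt s" "sqrt t"] s t by (auto dest: fun_cong)
  finally show "(\<integral>\<^sup>+y. ennreal (heat s (a - y) * heat t (y - b)) \<partial>lborel)
     = ennreal (heat (s + t) (a - b))" .
qed auto

lemma km_det_measurable[measurable (raw)]:
  assumes "\<And>i. i < d \<Longrightarrow> (\<lambda>w. A w i) \<in> borel_measurable M" "\<And>i. i < d \<Longrightarrow> (\<lambda>w. B w i) \<in> borel_measurable M"
  shows "(\<lambda>w. km_det d \<tau> (A w) (B w)) \<in> borel_measurable M"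
proof -
  have "p permutes {..<d} \<Longrightarrow> i < d \<Longrightarrow> p i < d" for p i
    using permutes_in_image[of p "{..<d}" i] by simp
  then show ?thesis
    unfolding km_det_leibniz
    by (intro borel_measurable_sum borel_measurable_times borel_measurable_const borel_measurable_prod
        measurable_compose[OF _ borel_measurable_normal_density] borel_measurable_diff assms) auto
qed

lemma chamber_measurable[measurable (raw)]:
  assumes "\<And>i. i < d \<Longrightarrow> (\<lambda>w. A w i) \<in> borel_measurable M"
  shows "Measurable.pred M (\<lambda>w. A w \<in> chamber d)"
proof -
  have eq: "A w \<in> chamber d \<longleftrightarrow> (\<forall>i\<in>{i. Suc i < d}. A w (Suc i) < A w i)" for w
    by (auto simp: chamber_def)
  have "Measurable.pred M (\<lambda>w. \<forall>i\<in>{i. Suc i < d}. A w (Suc i) < A w i)"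
    by (rule pred_intros_countable_bounded) (auto intro!: borel_measurable_pred_less assms)
  then show ?thesis unfolding eq .
qed

lemma km_det_cong:
  assumes "\<And>i. i < d \<Longrightarrow> a i = a' i" "\<And>i. i < d \<Longrightarrow> b i = b' i"
  shows "km_det d \<tau> a b = km_det d \<tau> a' b'"
  unfolding km_det_def by (rule arg_cong[where f = Determinant.det], rule eq_matI) (auto simp: assms)

lemma chamber_cong:
  assumes "\<And>i. i < d \<Longrightarrow> a i = a' i"
  shows "a \<in> chamber d \<longleftrightarrow> a' \<in> chamber d"
  using assms by (auto simp: chamber_def)

lemma km_det_permute:
  assumes "p permutes {..<d}"
  shows "km_det d \<tau> (\<lambda>i. a (p i)) b = of_int (sign p) * km_det d \<tau> a b"
proof -
  let ?A = "Matrix.mat d d (\<lambda>(i, j). heat \<tau> (a i - b j))"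
  have p: "p permutes {0..<d}" using assms by (simp add: atLeast0LessThan)
  have "i < d \<Longrightarrow> p i < d" for i using permutes_in_image[OF assms, of i] by simp
  then have "Matrix.mat d d (\<lambda>(i, j). ?A $$ (p i, j)) = Matrix.mat d d (\<lambda>(i, j). heat \<tau> (a (p i) - b j))"
    by (intro eq_matI) auto
  then show ?thesis using det_permute_rows[of ?A d p] p by (simp add: km_det_def)
qed

text \<open>In each term of the Leibniz sum the coordinates of \<open>v\<close> separate, and each contributes a convolution of two heat
  kernels.\<close>

lemma km_det_convolution:
  assumes s: "s > 0" and t: "t > 0"
  shows "has_bochner_integral (leb_on {..<d})
    (\<lambda>v. (\<Prod>i<d. heat s (a i - v i)) * km_det d t v b) (km_det d (s + t) a b)"
proof -
  have 1: "has_bochner_integral (leb_on {..<d})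
      (\<lambda>v. \<Prod>i<d. heat s (a i - v i) * heat t (v i - b (p i)))
      (\<Prod>i<d. heat (s + t) (a i - b (p i)))" for p
  proof -
    note c = normal_density_convolution[OF s t]
    have i: "integrable lborel (\<lambda>y. heat s (a i - y) * heat t (y - b (p i)))" for i
      using c by (rule integrable.intros)
    show ?thesis
      unfolding has_bochner_integral_iff
      using lborel_prod.product_integrable_prod[OF _ i, of "{..<d}" "\<lambda>i. i"]
        lborel_prod.product_integral_prod[OF _ i, of "{..<d}" "\<lambda>i. i"]
      by (simp add: has_bochner_integral_integral_eq[OF c])
  qed
  have eq: "(\<Prod>i<d. heat s (a i - v i)) * km_det d t v b =
      (\<Sum>p | p permutes {..<d}. of_int (sign p) *
        (\<Prod>i<d. heat s (a i - v i) * heat t (v i - b (p i))))" for v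
    unfolding km_det_leibniz sum_distrib_left prod.distrib by (intro sum.cong) (auto simp: mult_ac)
  show ?thesis
    unfolding eq km_det_leibniz[of d "s + t"]
    by (intro has_bochner_integral_sum has_bochner_integral_mult_right 1)
qed

text \<open>Andreief's identity restricted to the chamber.  Almost every \<open>v\<close> is sorted by exactly one permutation, so the
  integral of \<open>km_det_convolution\<close> over all of space splits into images of the chamber.  Carrying each image back
  permutes the arguments of the product and produces the sign from the determinant; the sum of the signed products
  is the first determinant.\<close>

lemma km_det_semigroup:
  assumes s: "s > 0" and t: "t > 0" and a: "a \<in> chamber d" and b: "b \<in> chamber d"
  shows "(\<integral>\<^sup>+v. ennreal (km_det d s a v) * ennreal (km_det d t v b) * indicator (chamber d) v \<partial>leb_on {..<d})
    = ennreal (km_det d (s + t) a b)"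
proof -
  let ?L = "leb_on {..<d}" and ?P = "{p. p permutes {..<d}}"
  define f where "f v = (\<Prod>i<d. heat s (a i - v i)) * km_det d t v b" for v
  define ch :: "(nat \<Rightarrow> real) \<Rightarrow> real" where "ch v = indicator (chamber d) v" for v
  have conv: "has_bochner_integral ?L f (km_det d (s + t) a b)"
    unfolding f_def by (rule km_det_convolution[OF s t])
  have fm[measurable]: "f \<in> borel_measurable ?L" unfolding f_def by measurable
  have coord: "(\<lambda>v. v (p i)) \<in> borel_measurable ?L" if "p permutes {..<d}" "i < d" for p i
    using measurable_component_singleton[of "p i" "{..<d}" "\<lambda>_. lborel"] permutes_in_image[OF that(1), of i] that(2) by simp
  have chm: "(\<lambda>v. ch (\<lambda>i. v (p i))) \<in> borel_measurable ?L" if p: "p permutes {..<d}" for p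
    using chamber_measurable[of d "\<lambda>v i. v (p i)" ?L, OF coord[OF p]]
    unfolding ch_def pred_def by (intro borel_measurable_indicator') auto
  have chm'[measurable]: "ch \<in> borel_measurable ?L" using chm[OF permutes_id] by simp
  have inv_lt: "inv_into UNIV p i < d" "p i < d" if "p permutes {..<d}" "i < d" for p i
    using permutes_in_image[OF that(1), of i] permutes_in_image[OF permutes_inv[OF that(1)], of i] that by auto
  define g where "g p v = f (\<lambda>i. v (inv_into UNIV p i)) * ch v" for p v
  have gm: "g p \<in> borel_measurable ?L" if p: "p permutes {..<d}" for p
    unfolding g_def f_def using coord[OF permutes_inv[OF p]]
    by (intro borel_measurable_times borel_measurable_prod km_det_measurable chm'
        measurable_compose[OF _ borel_measurable_normal_density] borel_measurable_diff) auto
  have fcong: "f v = f v'" if "\<And>i. i < d \<Longrightarrow> v i = v' i" for v v'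
    unfolding f_def using km_det_cong[of d v v' b b t] that by simp
  have chcong: "ch v = ch v'" if "\<And>i. i < d \<Longrightarrow> v i = v' i" for v v'
    unfolding ch_def indicator_def using chamber_cong[of d v v'] that by auto
  have g_eq: "g p (\<lambda>i\<in>{..<d}. v (p i)) = f v * ch (\<lambda>i. v (p i))" if p: "p permutes {..<d}" for p v
    unfolding g_def
    by (rule arg_cong2[where f = "(*)"], rule fcong)
       (auto simp: inv_lt[OF p] permutes_inverses[OF p] intro!: chcong)
  have int_fch: "integrable ?L (\<lambda>v. f v * ch (\<lambda>i. v (p i)))" if p: "p permutes {..<d}" for p
  proof (rule Bochner_Integration.integrable_bound)
    show "integrable ?L f" using conv by (rule integrable.intros)
    show "(\<lambda>v. f v * ch (\<lambda>i. v (p i))) \<in> borel_measurable ?L" using chm[OF p] by measurable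
  qed (auto simp: ch_def indicator_def)
  have int_g: "integrable ?L (g p)" and Lg: "(\<integral>v. f v * ch (\<lambda>i. v (p i)) \<partial>?L) = (\<integral>v. g p v \<partial>?L)"
    if p: "p permutes {..<d}" for p
    using integral_PiM_lborel_permute[OF _ p gm[OF p]] int_fch[OF p] by (auto simp: g_eq[OF p])
  have sum_g: "(\<Sum>p\<in>?P. g p v) = km_det d s a v * km_det d t v b * ch v" for v
  proof -
    have "(\<Sum>p\<in>?P. g p v) = (\<Sum>p\<in>?P. f (\<lambda>i. v (p i)) * ch v)"
      unfolding g_def by (rule sum_permutations_inverse[symmetric])
    also have "\<dots> = (\<Sum>p\<in>?P. of_int (sign p) * (\<Prod>i<d. heat s (a i - v (p i))) * km_det d t v b * ch v)"
      by (intro sum.cong refl) (simp add: f_def km_det_permute)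
    also have "\<dots> = km_det d s a v * km_det d t v b * ch v"
      unfolding km_det_leibniz[of d s] by (simp add: sum_distrib_right)
    finally show ?thesis .
  qed
  have "km_det d (s + t) a b = (\<integral>v. f v \<partial>?L)"
    using has_bochner_integral_integral_eq[OF conv] by simp
  also have "\<dots> = (\<integral>v. (\<Sum>p\<in>?P. f v * ch (\<lambda>i. v (p i))) \<partial>?L)"
  proof (rule integral_cong_AE)
    show "AE v in ?L. f v = (\<Sum>p\<in>?P. f v * ch (\<lambda>i. v (p i)))"
      using AE_PiM_lborel_inj[OF finite_lessThan, of d]
    proof (rule AE_mp, intro AE_I2 impI)
      fix v :: "nat \<Rightarrow> real" assume inj: "inj_on v {..<d}"
      obtain q where q: "q permutes {..<d} \<and> (\<lambda>i. v (q i)) \<in> chamber d"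
          and uniq: "\<forall>p. p permutes {..<d} \<and> (\<lambda>i. v (p i)) \<in> chamber d \<longrightarrow> p = q"
        by (rule ex1E[OF ex1_sorting_permutation[OF inj]])
      have "(\<Sum>p\<in>?P. ch (\<lambda>i. v (p i))) = (\<Sum>p\<in>?P. if p = q then 1 else 0)"
      proof (rule sum.cong[OF refl])
        fix p assume "p \<in> ?P"
        then have "(\<lambda>i. v (p i)) \<in> chamber d \<longleftrightarrow> p = q" using uniq q by blast
        then show "ch (\<lambda>i. v (p i)) = (if p = q then 1 else 0)" by (auto simp: ch_def q)
      qed
      also have "\<dots> = 1" using q by (subst sum.delta) (auto simp: finite_permutations)
      finally show "f v = (\<Sum>p\<in>?P. f v * ch (\<lambda>i. v (p i)))"
        unfolding sum_distrib_left[symmetric] by simp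
    qed
    show "(\<lambda>v. \<Sum>p\<in>?P. f v * ch (\<lambda>i. v (p i))) \<in> borel_measurable ?L"
      by (intro borel_measurable_sum borel_measurable_times fm chm) auto
  qed (rule fm)
  also have "\<dots> = (\<Sum>p\<in>?P. \<integral>v. g p v \<partial>?L)"
  proof (subst Bochner_Integration.integral_sum)
    show "(\<Sum>p\<in>?P. \<integral>v. f v * ch (\<lambda>i. v (p i)) \<partial>?L) = (\<Sum>p\<in>?P. \<integral>v. g p v \<partial>?L)"
      by (rule sum.cong[OF refl]) (rule Lg, simp)
  qed (rule int_fch, simp)
  also have "\<dots> = (\<integral>v. km_det d s a v * km_det d t v b * ch v \<partial>?L)"
    unfolding sum_g[symmetric] by (rule Bochner_Integration.integral_sum[symmetric]) (rule int_g, simp)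
  finally have eq: "km_det d (s + t) a b = (\<integral>v. km_det d s a v * km_det d t v b * ch v \<partial>?L)" .
  have int: "integrable ?L (\<lambda>v. km_det d s a v * km_det d t v b * ch v)"
    unfolding sum_g[symmetric] by (rule Bochner_Integration.integrable_sum) (rule int_g, simp)
  have nn: "0 \<le> km_det d s a v * km_det d t v b * ch v" for v
    using km_det_bounds(1)[OF s a, of v] km_det_bounds(1)[OF t _ b, of v]
    by (cases "v \<in> chamber d") (simp_all add: ch_def)
  have "(\<integral>\<^sup>+v. ennreal (km_det d s a v) * ennreal (km_det d t v b) * indicator (chamber d) v \<partial>?L)
      = (\<integral>\<^sup>+v. ennreal (km_det d s a v * km_det d t v b * ch v) \<partial>?L)"
  proof (rule nn_integral_cong)
    fix v
    show "ennreal (km_det d s a v) * ennreal (km_det d t v b) * indicator (chamber d) v =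
        ennreal (km_det d s a v * km_det d t v b * ch v)"
      using km_det_bounds(1)[OF s a, of v]
      by (cases "v \<in> chamber d") (simp_all add: ch_def ennreal_mult')
  qed
  also have "\<dots> = ennreal (km_det d (s + t) a b)"
    unfolding eq using nn by (intro nn_integral_eq_integral int) auto
  finally show ?thesis .
qed

section \<open>Partial sums preserve Lebesgue measure\<close>

text \<open>The change of variables is unipotent: the last coordinate is merely translated by the sum of the others.\<close>

lemma nn_integral_PiM_lborel_partial_sums:
  assumes "f \<in> borel_measurable (leb_on {a..<a+N})"
  shows "(\<integral>\<^sup>+w. f (\<lambda>i\<in>{a..<a+N}. \<Sum>j=a..i. w j) \<partial>leb_on {a..<a+N}) =
    (\<integral>\<^sup>+w. f w \<partial>leb_on {a..<a+N})"
  using assms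
proof (induction N arbitrary: f)
  case 0
  then show ?case by (simp add: PiM_empty nn_integral_count_space_finite restrict_def)
next
  case (Suc N)
  let ?I = "{a..<a+N}" and ?b = "a + N" and ?J = "{a..<a + Suc N}"
  let ?cs = "\<lambda>I w. \<lambda>i\<in>I. \<Sum>j=a..i. w j"
  have J: "?J = insert ?b ?I" by auto
  note f[measurable] = Suc.prems[unfolded J]
  have cs_m[measurable]: "?cs I \<in> leb_on I \<rightarrow>\<^sub>M leb_on I" if "I \<in> {?I, ?J}" for I
    by (rule measurable_restrict, simp, rule borel_measurable_sum, rule measurable_component_singleton[where M = "\<lambda>_. lborel", simplified])
       (use that in auto)
  define g where "g z = (\<integral>\<^sup>+y. f (z(?b := y)) \<partial>lborel)" for z
  have g[measurable]: "g \<in> borel_measurable (leb_on ?I)"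
    unfolding g_def
  proof (rule lborel.borel_measurable_nn_integral)
    have "(\<lambda>(z, y). z(?b := y)) \<in> leb_on ?I \<Otimes>\<^sub>M lborel \<rightarrow>\<^sub>M leb_on (insert ?b ?I)"
      by (rule measurable_add_dim)
    from measurable_compose[OF this f]
    show "(\<lambda>(z, y). f (z(?b := y))) \<in> borel_measurable (leb_on ?I \<Otimes>\<^sub>M lborel)"
      by (simp add: case_prod_beta')
  qed
  have fcs: "(\<lambda>w. f (?cs ?J w)) \<in> borel_measurable (leb_on (insert ?b ?I))"
  proof -
    have "?J \<in> {?I, ?J}" by simp
    from measurable_compose[OF cs_m[OF this] Suc.prems] show ?thesis unfolding J .
  qed
  have "(\<integral>\<^sup>+w. f (?cs ?J w) \<partial>leb_on ?J) =
      (\<integral>\<^sup>+x. (\<integral>\<^sup>+y. f (?cs ?J (x(?b := y))) \<partial>lborel) \<partial>leb_on ?I)"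
    unfolding J by (rule lborel_prod.product_nn_integral_insert) (simp, simp, rule fcs[unfolded J])
  also have "\<dots> = (\<integral>\<^sup>+x. g (?cs ?I x) \<partial>leb_on ?I)"
  proof (rule nn_integral_cong)
    fix x assume x: "x \<in> space (leb_on ?I)"
    have sp: "?cs ?I x \<in> space (leb_on ?I)"
      by (auto simp: space_PiM PiE_iff)
    have eq: "?cs ?J (x(?b := y)) = (?cs ?I x)(?b := (\<Sum>j\<in>?I. x j) + y)" for y
    proof
      fix i
      have "{a..?b} = insert ?b ?I" by auto
      then have *: "(\<Sum>j=a..?b. (x(?b := y)) j) = (\<Sum>j\<in>?I. x j) + y" by simp
      have "(\<Sum>j=a..i. (x(?b := y)) j) = (\<Sum>j=a..i. x j)" if "i < ?b"
        using that by (intro sum.cong) auto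
      then show "?cs ?J (x(?b := y)) i = ((?cs ?I x)(?b := (\<Sum>j\<in>?I. x j) + y)) i"
        using * by (auto simp: restrict_def)
    qed
    have "?b \<notin> ?I" by simp
    then have "(\<lambda>y. f ((?cs ?I x)(?b := y))) \<in> borel_measurable borel"
      using measurable_comp[OF measurable_component_update[OF sp] f] by (simp add: comp_def)
    from nn_integral_real_affine[OF this, of 1 "\<Sum>j\<in>?I. x j"]
    show "(\<integral>\<^sup>+y. f (?cs ?J (x(?b := y))) \<partial>lborel) = g (?cs ?I x)"
      unfolding eq g_def by simp
  qed
  also have "\<dots> = (\<integral>\<^sup>+x. g x \<partial>leb_on ?I)" by (rule Suc.IH[OF g])
  also have "\<dots> = (\<integral>\<^sup>+w. f w \<partial>leb_on ?J)"
    unfolding J g_def by (rule lborel_prod.product_nn_integral_insert[symmetric]) auto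
  finally show ?case .
qed

section \<open>A path cut into slices\<close>

text \<open>The positions at time \<open>k / m\<close> of the \<open>d\<close> particles, the \<open>i\<close>-th of which runs through the times \<open>i + k / m\<close> and is
  lowered by \<open>i h\<close>.  The walk starts at \<open>0\<close>, and index \<open>0\<close> is not an integration variable; hence the case
  distinction.\<close>

definition walk_slice :: "real \<Rightarrow> nat \<Rightarrow> (nat \<Rightarrow> real) \<Rightarrow> nat \<Rightarrow> nat \<Rightarrow> real" where
  "walk_slice h m w k i = (if i * m + k = 0 then 0 else w (i * m + k)) - real i * h"

definition slice_index :: "nat \<Rightarrow> nat \<Rightarrow> nat \<Rightarrow> nat set" where
  "slice_index d m k = (\<lambda>i. i * m + k) ` {..<d}"

lemma slice_index_inj:
  fixes m :: nat
  assumes "i * m + k = i' * m + k'" "0 < k" "k \<le> m" "0 < k'" "k' \<le> m"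
  shows "k = k'" "i = i'"
proof -
  have "i = i'"
  proof (rule ccontr)
    assume "i \<noteq> i'"
    then consider "Suc i \<le> i'" | "Suc i' \<le> i" by linarith
    then show False
    proof cases
      case 1
      then have "Suc i * m \<le> i' * m" by (rule mult_right_mono) simp
      then show ?thesis using assms by simp
    next
      case 2
      then have "Suc i' * m \<le> i * m" by (rule mult_right_mono) simp
      then show ?thesis using assms by simp
    qed
  qed
  then show "k = k'" "i = i'" using assms by auto
qed

lemma slice_index_disjoint:
  assumes "k \<noteq> k'" "0 < k" "k \<le> m" "0 < k'" "k' \<le> m"
  shows "slice_index d m k \<inter> slice_index d m k' = {}"
  using slice_index_inj[of _ m k _ k'] assms by (auto simp: slice_index_def)

lemma bij_slice_pairs:
  fixes m :: nat
  assumes "m > 0"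
  shows "bij_betw (\<lambda>(i, k). i * m + k) ({..<d} \<times> {1..m}) {1..d * m}"
proof (rule bij_betw_imageI)
  show "inj_on (\<lambda>(i, k). i * m + k) ({..<d} \<times> {1..m})"
  proof (rule inj_onI; clarsimp)
    fix i k i' k' :: nat assume *: "i * m + k = i' * m + k'" "Suc 0 \<le> k" "k \<le> m" "Suc 0 \<le> k'" "k' \<le> m"
    show "i = i' \<and> k = k'"
      using slice_index_inj[OF *(1) _ *(3) _ *(5)] *(2,4) by simp
  qed
  show "(\<lambda>(i, k). i * m + k) ` ({..<d} \<times> {1..m}) = {1..d * m}"
  proof (rule equalityI; rule subsetI)
    fix l assume "l \<in> (\<lambda>(i, k). i * m + k) ` ({..<d} \<times> {1..m})"
    then obtain i k where ik: "i < d" "1 \<le> k" "k \<le> m" "l = i * m + k" by auto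
    have "Suc i * m \<le> d * m" using ik by (intro mult_right_mono) auto
    then show "l \<in> {1..d * m}" using ik by auto
  next
    fix l assume l: "l \<in> {1..d * m}"
    have "l - 1 < d * m" using l by auto
    then have "(l - 1) div m < d" using assms by (simp add: less_mult_imp_div_less)
    moreover have "(l - 1) mod m + 1 \<in> {1..m}" using assms by (auto simp: Suc_le_eq)
    moreover have "(l - 1) div m * m + ((l - 1) mod m + 1) = l" using l by auto
    ultimately show "l \<in> (\<lambda>(i, k). i * m + k) ` ({..<d} \<times> {1..m})"
      by (intro rev_image_eqI[of "((l - 1) div m, (l - 1) mod m + 1)"]) auto
  qed
qed

lemma walk_slice_measurable:
  assumes "\<And>i. i < d \<Longrightarrow> i * m + k \<noteq> 0 \<Longrightarrow> i * m + k \<in> I" "i < d"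
  shows "(\<lambda>w. walk_slice h m w k i) \<in> borel_measurable (leb_on I)"
proof (cases "i * m + k = 0")
  case False
  then have "(\<lambda>w. w (i * m + k)) \<in> borel_measurable (leb_on I)"
    using measurable_component_singleton[of "i * m + k" I "\<lambda>_. lborel"] assms by simp
  then show ?thesis using False unfolding walk_slice_def by simp
qed (simp add: walk_slice_def)

text \<open>Slice \<open>0\<close> is slice \<open>m\<close> moved by one particle: the end of a unit interval is the start of the next.\<close>

lemma slice_zero_index:
  assumes "i < d" "i * m + 0 \<noteq> (0::nat)"
  shows "i * m + 0 \<in> slice_index d m m"
proof -
  obtain j where "i = Suc j" using assms by (cases i) auto
  then show ?thesis using assms by (auto simp: slice_index_def intro!: image_eqI[of _ _ j])
qed

text \<open>Interpolates between the product of \<open>m\<close> one-step determinants (\<open>j = m - 1\<close>) and the single determinant from the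
  first to the last slice (\<open>j = 0\<close>).  The factor \<open>g\<close> tests the value at time \<open>1\<close>, which is the starting value of
  the increment process.\<close>

definition chain_density :: "(real \<Rightarrow> ennreal) \<Rightarrow> nat \<Rightarrow> real \<Rightarrow> nat \<Rightarrow> nat \<Rightarrow> (nat \<Rightarrow> real) \<Rightarrow> ennreal" where
  "chain_density g d h m j w =
     g (w m) * indicator (chamber d) (walk_slice h m w 0) * indicator (chamber d) (walk_slice h m w m) *
     (\<Prod>k=1..j. ennreal (km_det d (1 / m) (walk_slice h m w (k - 1)) (walk_slice h m w k)) *
        indicator (chamber d) (walk_slice h m w k)) *
     ennreal (km_det d (real (m - j) / m) (walk_slice h m w j) (walk_slice h m w m))"

lemma chain_density_measurable:
  assumes "d > 0" "slice_index d m m \<subseteq> I" "\<And>k. 1 \<le> k \<Longrightarrow> k \<le> j \<Longrightarrow> slice_index d m k \<subseteq> I"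
    and [measurable]: "g \<in> borel_measurable borel"
  shows "chain_density g d h m j \<in> borel_measurable (leb_on I)"
proof -
  have sl: "(\<lambda>w. walk_slice h m w k i) \<in> borel_measurable (leb_on I)" if "k \<le> j \<or> k = m" "i < d" for k i
  proof (rule walk_slice_measurable[OF _ that(2)])
    fix i assume i: "i < d" "i * m + k \<noteq> 0"
    show "i * m + k \<in> I"
    proof (cases "k = 0")
      case True
      then show ?thesis using slice_zero_index[of i d m] i assms(2) by force
    next
      case False
      then have "i * m + k \<in> slice_index d m k" using i by (auto simp: slice_index_def)
      then show ?thesis using False that(1) assms(2) assms(3)[of k] by force
    qed
  qed
  have "m \<in> I" using assms(1,2) by (force simp: slice_index_def image_subset_iff)
  then have m: "(\<lambda>w. w m) \<in> borel_measurable (leb_on I)"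
    using measurable_component_singleton[of m I "\<lambda>_. lborel"] by simp
  have ind: "(\<lambda>w. indicator (chamber d) (walk_slice h m w k) :: ennreal) \<in> borel_measurable (leb_on I)"
    if "k \<le> j \<or> k = m" for k
    using chamber_measurable[of d "\<lambda>w. walk_slice h m w k", OF sl[OF that]]
    unfolding pred_def by (intro borel_measurable_indicator') auto
  show ?thesis
    unfolding chain_density_def
    by (intro borel_measurable_times_ennreal borel_measurable_prod_ennreal measurable_compose[OF _ measurable_ennreal]
        km_det_measurable ind sl measurable_compose[OF m assms(4)]) auto
qed

text \<open>Slice \<open>j + 1\<close> occurs in two adjacent determinants only, and the semigroup property integrates it out.\<close>

lemma chain_density_step:
  assumes j: "Suc j < m" and d: "d > 0" and g: "g \<in> borel_measurable borel"
    and I: "I = slice_index d m m \<union> (\<Union>k\<in>{1..j}. slice_index d m k)"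
  shows "(\<integral>\<^sup>+w. chain_density g d h m (Suc j) w \<partial>leb_on (I \<union> slice_index d m (Suc j))) =
    (\<integral>\<^sup>+w. chain_density g d h m j w \<partial>leb_on I)"
proof -
  let ?J = "slice_index d m (Suc j)" and ?C = "chamber d" and ?sl = "walk_slice h m"
  have fin: "finite I" "finite ?J" unfolding I by (auto simp: slice_index_def)
  have dis: "I \<inter> ?J = {}"
  proof -
    have "slice_index d m k \<inter> ?J = {}" if "k \<in> {1..j} \<union> {m}" for k
      using slice_index_disjoint[of k "Suc j" m d] that j by auto
    then show ?thesis unfolding I by blast
  qed
  define e where "e i = i * m + Suc j" for i
  have e: "bij_betw e {..<d} ?J"
    unfolding slice_index_def e_def by (rule inj_on_imp_bij_betw) (use j in \<open>auto simp: inj_on_def\<close>)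
  have old: "?sl (merge I ?J (x, y)) k i = ?sl x k i" if "i < d" "k \<le> j \<or> k = m" for x y k i
  proof -
    have "i * m + k \<noteq> 0 \<Longrightarrow> i * m + k \<in> I"
    proof (cases "k = 0")
      case True
      then show "i * m + k \<noteq> 0 \<Longrightarrow> i * m + k \<in> I" using slice_zero_index[of i d m] that I by auto
    next
      case False
      then show "i * m + k \<in> I" using that unfolding I by (auto simp: slice_index_def)
    qed
    then show ?thesis by (auto simp: walk_slice_def merge_def)
  qed
  have new: "?sl (merge I ?J (x, y)) (Suc j) i = y (e i) - real i * h" if "i < d" for x y i
  proof -
    have "e i \<in> ?J" using that by (auto simp: slice_index_def e_def)
    then have "e i \<notin> I" using dis by auto
    then show ?thesis using \<open>e i \<in> ?J\<close> by (simp add: walk_slice_def merge_def e_def)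
  qed
  have mI: "m \<in> I" unfolding I using d by (auto simp: slice_index_def)
  define PR :: "(nat \<Rightarrow> real) \<Rightarrow> ennreal" where
    "PR x = (\<Prod>k=1..j. ennreal (km_det d (1 / m) (?sl x (k - 1)) (?sl x k)) * indicator ?C (?sl x k))" for x
  define D where "D x = g (x m) * indicator ?C (?sl x 0) * indicator ?C (?sl x m) * PR x" for x
  have chain_Suc: "chain_density g d h m (Suc j) w = D w *
      (ennreal (km_det d (1 / m) (?sl w j) (?sl w (Suc j))) * indicator ?C (?sl w (Suc j))) *
      ennreal (km_det d (real (m - Suc j) / m) (?sl w (Suc j)) (?sl w m))" for w
    unfolding chain_density_def D_def PR_def by (simp add: prod.nat_ivl_Suc' mult_ac)
  define F where "F x v = ennreal (km_det d (1 / m) (?sl x j) v) *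
      ennreal (km_det d (real (m - Suc j) / m) v (?sl x m)) * indicator ?C v" for x v
  have split: "chain_density g d h m (Suc j) (merge I ?J (x, y)) =
      D x * F x (\<lambda>i\<in>{..<d}. y (e i) - real i * h)" for x y
  proof -
    let ?w = "merge I ?J (x, y)" and ?v = "\<lambda>i\<in>{..<d}. y (e i) - real i * h"
    have K: "km_det d t (?sl ?w k) (?sl ?w k') = km_det d t (?sl x k) (?sl x k')"
      if "k \<le> j \<or> k = m" "k' \<le> j \<or> k' = m" for t k k'
      by (rule km_det_cong) (use old that in auto)
    have K1: "km_det d t (?sl ?w j) (?sl ?w (Suc j)) = km_det d t (?sl x j) ?v" for t
      by (rule km_det_cong) (use old new in auto)
    have K2: "km_det d t (?sl ?w (Suc j)) (?sl ?w m) = km_det d t ?v (?sl x m)" for t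
      by (rule km_det_cong) (use old new in auto)
    have C: "(?sl ?w k \<in> ?C) = (?sl x k \<in> ?C)" if "k \<le> j \<or> k = m" for k
      by (rule chamber_cong) (use old that in auto)
    have C1: "(?sl ?w (Suc j) \<in> ?C) = (?v \<in> ?C)"
      by (rule chamber_cong) (use new in auto)
    have P: "PR ?w = PR x"
      unfolding PR_def
    proof (rule prod.cong[OF refl])
      fix k assume "k \<in> {1..j}"
      then have k: "k - 1 \<le> j" "k \<le> j" by auto
      then show "ennreal (km_det d (1 / m) (?sl ?w (k - 1)) (?sl ?w k)) * indicator ?C (?sl ?w k) =
         ennreal (km_det d (1 / m) (?sl x (k - 1)) (?sl x k)) * (indicator ?C (?sl x k) :: ennreal)"
        by (simp add: K C indicator_def)
    qed
    have "?w m = x m" using mI by (simp add: merge_def)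
    then show ?thesis
      unfolding chain_Suc D_def F_def P K1 K2 by (simp add: C C1 indicator_def mult_ac)
  qed
  have "(\<integral>\<^sup>+w. chain_density g d h m (Suc j) w \<partial>leb_on (I \<union> ?J)) =
     (\<integral>\<^sup>+x. (\<integral>\<^sup>+y. D x * F x (\<lambda>i\<in>{..<d}. y (e i) - real i * h) \<partial>leb_on ?J) \<partial>leb_on I)"
  proof (subst lborel_prod.product_nn_integral_fold[OF dis fin])
    show "chain_density g d h m (Suc j) \<in> borel_measurable (leb_on (I \<union> ?J))"
    proof (rule chain_density_measurable[OF d _ _ g])
      fix k assume "1 \<le> k" "k \<le> Suc j"
      then have "k \<in> {1..j} \<or> k = Suc j" by auto
      then show "slice_index d m k \<subseteq> I \<union> ?J" unfolding I by blast
    qed (auto simp: I)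
  qed (simp add: split)
  also have "\<dots> = (\<integral>\<^sup>+x. chain_density g d h m j x \<partial>leb_on I)"
  proof (rule nn_integral_cong)
    fix x
    have Fm: "F x \<in> borel_measurable (leb_on {..<d})"
    proof -
      have c: "(\<lambda>v. v i) \<in> borel_measurable (leb_on {..<d})" if "i < d" for i
        using measurable_component_singleton[of i "{..<d}" "\<lambda>_. lborel"] that by simp
      have "(\<lambda>v. indicator ?C v :: ennreal) \<in> borel_measurable (leb_on {..<d})"
        using chamber_measurable[of d "\<lambda>v. v", OF c]
        unfolding pred_def by (intro borel_measurable_indicator') auto
      then show ?thesis unfolding F_def
        by (intro borel_measurable_times_ennreal measurable_compose[OF _ measurable_ennreal] km_det_measurable c) auto
    qed
    have "(\<integral>\<^sup>+y. D x * F x (\<lambda>i\<in>{..<d}. y (e i) - real i * h) \<partial>leb_on ?J) =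
       (\<integral>\<^sup>+v. D x * F x v \<partial>leb_on {..<d})"
      by (rule nn_integral_PiM_lborel_reindex[OF _ e]) (use Fm in auto)
    also have "\<dots> = D x * (\<integral>\<^sup>+v. F x v \<partial>leb_on {..<d})"
      by (rule nn_integral_cmult[OF Fm])
    also have "\<dots> = chain_density g d h m j x"
    proof (cases "?sl x j \<in> ?C \<and> ?sl x m \<in> ?C")
      case True
      have t: "1 / real m + real (m - Suc j) / real m = real (m - j) / real m"
        using j by (simp add: add_divide_distrib[symmetric] of_nat_diff)
      have "(\<integral>\<^sup>+v. F x v \<partial>leb_on {..<d}) = ennreal (km_det d (real (m - j) / m) (?sl x j) (?sl x m))"
        unfolding F_def t[symmetric] by (rule km_det_semigroup) (use j True in auto)
      then show ?thesis unfolding D_def PR_def chain_density_def by simp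
    next
      case False
      \<comment> \<open>Off the chamber the semigroup property fails, but then the remaining indicators vanish on both sides.\<close>
      have "D x = 0"
      proof (cases "?sl x m \<in> ?C")
        case True
        with False have nj: "?sl x j \<notin> ?C" by simp
        show ?thesis
        proof (cases "j = 0")
          case True
          then show ?thesis using nj by (simp add: D_def)
        next
          case False
          then have "j \<in> {1..j}" by auto
          then have "(\<Prod>k=1..j. ennreal (km_det d (1 / m) (?sl x (k - 1)) (?sl x k)) * (indicator ?C (?sl x k) :: ennreal)) = 0"
            using nj by (intro prod_zero) (auto intro!: bexI[of _ j])
          then show ?thesis unfolding D_def PR_def by simp
        qed
      qed (simp add: D_def)
      moreover from this have "chain_density g d h m j x = 0" unfolding D_def PR_def chain_density_def by simp
      ultimately show ?thesis by simp
    qed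
    finally show "(\<integral>\<^sup>+y. D x * F x (\<lambda>i\<in>{..<d}. y (e i) - real i * h) \<partial>leb_on ?J) =
        chain_density g d h m j x" .
  qed
  finally show ?thesis .
qed

lemma chain_density_integral:
  assumes m: "m > 0" and d: "d > 0" and g: "g \<in> borel_measurable borel"
  shows "(\<integral>\<^sup>+w. chain_density g d h m (m - 1) w \<partial>leb_on {1..d * m}) =
    (\<integral>\<^sup>+w. chain_density g d h m 0 w \<partial>leb_on (slice_index d m m))"
proof -
  define I where "I j = slice_index d m m \<union> (\<Union>k\<in>{1..j}. slice_index d m k)" for j
  have "(\<integral>\<^sup>+w. chain_density g d h m j w \<partial>leb_on (I j)) =
      (\<integral>\<^sup>+w. chain_density g d h m 0 w \<partial>leb_on (slice_index d m m))" if "j < m" for j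
    using that
  proof (induction j)
    case 0
    then show ?case by (simp add: I_def)
  next
    case (Suc j)
    have "I (Suc j) = I j \<union> slice_index d m (Suc j)"
      unfolding I_def by (auto simp: atLeastAtMostSuc_conv)
    then show ?case
      using chain_density_step[OF Suc.prems d g, of "I j" h] Suc by (simp add: I_def)
  qed
  from this[of "m - 1"] m have "(\<integral>\<^sup>+w. chain_density g d h m (m - 1) w \<partial>leb_on (I (m - 1))) =
      (\<integral>\<^sup>+w. chain_density g d h m 0 w \<partial>leb_on (slice_index d m m))" by simp
  moreover have "I (m - 1) = {1..d * m}"
  proof -
    have "{1..m} = insert m {1..m - 1}" using m by auto
    then have "I (m - 1) = (\<Union>k\<in>{1..m}. slice_index d m k)" unfolding I_def by auto
    also have "\<dots> = (\<lambda>(i, k). i * m + k) ` ({..<d} \<times> {1..m})" by (auto simp: slice_index_def)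
    also have "\<dots> = {1..d * m}" using bij_slice_pairs[OF m] by (rule bij_betw_imp_surj_on)
    finally show ?thesis .
  qed
  ultimately show ?thesis by simp
qed

section \<open>The determinant of the shifts as a Karlin--McGregor determinant\<close>

abbreviation shift_det :: "real \<Rightarrow> nat \<Rightarrow> (nat \<Rightarrow> real) \<Rightarrow> real" where
  "shift_det h n s \<equiv> Determinant.det (shift_matrix h n s)"

abbreviation orthant :: "nat \<Rightarrow> real \<Rightarrow> (nat \<Rightarrow> real) set" where
  "orthant n h \<equiv> Pi\<^sub>E {1..n} (\<lambda>_. {..<h})"

text \<open>The end points of the particles are partial sums of \<open>s\<close>, and the shifts \<open>a\<^sub>i\<^sub>j\<close> are the telescoped differences.\<close>

lemma shift_matrix_eq_km_det:
  assumes "d = Suc n"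
  shows "shift_det h n s =
    km_det d 1 (\<lambda>i. (\<Sum>l<i. s l) - real i * h) (\<lambda>j. (\<Sum>l<Suc j. s l) - real j * h)"
proof -
  have entry: "std_normal_density (s i + shift h s i j) =
      heat 1 (((\<Sum>l<i. s l) - real i * h) - ((\<Sum>l<Suc j. s l) - real j * h))" for i j
  proof -
    have eq: "((\<Sum>l<i. s l) - real i * h) - ((\<Sum>l<Suc j. s l) - real j * h) = - (s i + shift h s i j)"
    proof (cases i j rule: linorder_cases)
      case less
      have "{..<Suc j} = {..<i} \<union> {i} \<union> {i + 1..j}" using less by auto
      then have "(\<Sum>l<Suc j. s l) = (\<Sum>l<i. s l) + s i + (\<Sum>l = i + 1..j. s l)"
        by (simp only:) (subst sum.union_disjoint; (simp add: disjoint_iff)?)+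
      then show ?thesis using less by (simp add: shift_def algebra_simps)
    next
      case greater
      have "{..<Suc i} = {..<Suc j} \<union> {j + 1..i}" using greater by auto
      then have "(\<Sum>l<Suc i. s l) = (\<Sum>l<Suc j. s l) + (\<Sum>l = j + 1..i. s l)"
        by (simp only:) (subst sum.union_disjoint; (simp add: disjoint_iff)?)
      then show ?thesis using greater by (simp add: shift_def algebra_simps)
    qed (simp add: shift_def)
    have "normal_density 0 1 (- u) = std_normal_density u" for u :: real by (simp add: normal_density_def)
    then show ?thesis unfolding eq real_sqrt_one by (simp only:)
  qed
  show ?thesis
    unfolding shift_matrix_def km_det_def assms entry by simp
qed

lemma shift_det_measurable:
  assumes "\<And>i. i \<le> n \<Longrightarrow> (\<lambda>w. X w i) \<in> borel_measurable M"
  shows "(\<lambda>w. shift_det h n (X w)) \<in> borel_measurable M"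
  unfolding shift_matrix_eq_km_det[OF refl]
proof (rule km_det_measurable)
  fix i assume "i < Suc n"
  then show "(\<lambda>w. (\<Sum>l<i. X w l) - real i * h) \<in> borel_measurable M"
    by (intro borel_measurable_diff borel_measurable_sum borel_measurable_const) (rule assms, simp)
  from \<open>i < Suc n\<close> show "(\<lambda>w. (\<Sum>l<Suc i. X w l) - real i * h) \<in> borel_measurable M"
    by (intro borel_measurable_diff borel_measurable_sum borel_measurable_const) (rule assms, simp)
qed

text \<open>The two end slices share all constraints except the first and the last, so both are needed to bound \<open>s\<^sub>0\<close> and
  \<open>s\<^sub>n\<close>; for \<open>n = 0\<close> the chamber would impose no constraint.\<close>

lemma chamber_partial_sums:
  assumes "n > 0"
  shows "(\<lambda>i. (\<Sum>l<i. s l) - real i * h) \<in> chamber (Suc n) \<and> (\<lambda>j. (\<Sum>l<Suc j. s l) - real j * h) \<in> chamber (Suc n)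
     \<longleftrightarrow> (\<forall>i\<le>n. s i < h)"
proof
  assume a: "(\<lambda>i. (\<Sum>l<i. s l) - real i * h) \<in> chamber (Suc n) \<and> (\<lambda>j. (\<Sum>l<Suc j. s l) - real j * h) \<in> chamber (Suc n)"
  show "\<forall>i\<le>n. s i < h"
  proof safe
    fix i assume "i \<le> n"
    then consider "i < n" | "i = Suc (n - 1)" "n - 1 < n" using assms by linarith
    then show "s i < h"
      using a by cases (auto simp: chamber_def algebra_simps)
  qed
qed (auto simp: chamber_def algebra_simps)

text \<open>The remaining variables are the end points of the particles; as partial sums of \<open>s\<close> they have Jacobian one, and
  \<open>s\<^sub>0\<close> is the starting value.\<close>

lemma chain_density_zero_integral:
  assumes m: "m > 0" and n: "n > 0" and d: "d = Suc n" and g[measurable]: "g \<in> borel_measurable borel"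
  shows "(\<integral>\<^sup>+w. chain_density g d h m 0 w \<partial>leb_on (slice_index d m m)) =
    (\<integral>\<^sup>+y. g y * indicator {..<h} y * (\<integral>\<^sup>+s. ennreal (shift_det h n (s(0 := y))) *
        indicator (orthant n h) s \<partial>leb_on {1..n}) \<partial>lborel)"
proof -
  let ?C = "chamber d" and ?L = "leb_on {0..<0+d}"
  define A where "A v i = (if i = 0 then 0 else v (i - 1)) - real i * h" for v :: "nat \<Rightarrow> real" and i
  define B where "B v i = v i - real i * h" for v :: "nat \<Rightarrow> real" and i
  define f where "f v = g (v 0) * indicator ?C (A v) * indicator ?C (B v) * ennreal (km_det d 1 (A v) (B v))" for v
  have c: "(\<lambda>v. v i) \<in> borel_measurable ?L" if "i < d" for i
    using measurable_component_singleton[of i "{0..<0+d}" "\<lambda>_. lborel"] that by simp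
  have A: "(\<lambda>v. A v i) \<in> borel_measurable ?L" if "i < d" for i
    unfolding A_def using c[of "i - 1"] that by (cases "i = 0") auto
  have B: "(\<lambda>v. B v i) \<in> borel_measurable ?L" if "i < d" for i
    unfolding B_def using c[OF that] by auto
  have ind: "(\<lambda>v. indicator ?C (X v) :: ennreal) \<in> borel_measurable ?L"
    if "\<And>i. i < d \<Longrightarrow> (\<lambda>v. X v i) \<in> borel_measurable ?L" for X
    using chamber_measurable[of d "X", OF that]
    unfolding pred_def by (intro borel_measurable_indicator') auto
  have f: "f \<in> borel_measurable ?L"
    unfolding f_def
    by (intro borel_measurable_times_ennreal measurable_compose[OF _ measurable_ennreal]
        km_det_measurable ind A B measurable_compose[OF c g]) (auto simp: d)
  define e where "e i = i * m + m" for i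
  have e: "bij_betw e {0..<0+d} (slice_index d m m)"
  proof -
    have "slice_index d m m = e ` {0..<0+d}" by (auto simp: slice_index_def e_def atLeast0LessThan)
    then show ?thesis by (simp only:) (rule inj_on_imp_bij_betw, use m in \<open>auto simp: inj_on_def e_def\<close>)
  qed
  have "(\<integral>\<^sup>+w. chain_density g d h m 0 w \<partial>leb_on (slice_index d m m)) =
      (\<integral>\<^sup>+w. f (\<lambda>i\<in>{0..<0+d}. w (e i) - 0) \<partial>leb_on (slice_index d m m))"
  proof (rule nn_integral_cong)
    fix w :: "nat \<Rightarrow> real"
    let ?v = "\<lambda>i\<in>{0..<0+d}. w (e i) - 0"
    have a: "walk_slice h m w 0 i = A ?v i" if "i < d" for i
      using that m by (cases i) (auto simp: walk_slice_def A_def e_def add.commute)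
    have b: "walk_slice h m w m i = B ?v i" if "i < d" for i
      using that m by (auto simp: walk_slice_def B_def e_def)
    have "w m = ?v 0" by (simp add: e_def d)
    then show "chain_density g d h m 0 w = f ?v"
      unfolding chain_density_def f_def indicator_def
      using km_det_cong[OF a b] chamber_cong[OF a] chamber_cong[OF b] m by simp
  qed
  also have "\<dots> = (\<integral>\<^sup>+v. f v \<partial>?L)"
    by (rule nn_integral_PiM_lborel_reindex[OF _ e f]) simp
  also have "\<dots> = (\<integral>\<^sup>+s. f (\<lambda>i\<in>{0..<0+d}. \<Sum>j=0..i. s j) \<partial>?L)"
    by (rule nn_integral_PiM_lborel_partial_sums[OF f, symmetric])
  also have "\<dots> = (\<integral>\<^sup>+s. g (s 0) * indicator {s. \<forall>i\<le>n. s i < h} s * ennreal (shift_det h n s) \<partial>?L)"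
  proof (rule nn_integral_cong)
    fix s :: "nat \<Rightarrow> real"
    let ?v = "\<lambda>i\<in>{0..<0+d}. \<Sum>j=0..i. s j"
    have a: "A ?v i = (\<Sum>l<i. s l) - real i * h" if "i < d" for i
      using that by (cases i) (auto simp: A_def atLeast0AtMost lessThan_Suc_atMost)
    have b: "B ?v i = (\<Sum>l<Suc i. s l) - real i * h" if "i < d" for i
      using that by (auto simp: B_def atLeast0AtMost lessThan_Suc_atMost)
    have "?v 0 = s 0" by (simp add: d)
    moreover have "(indicator ?C (A ?v) * indicator ?C (B ?v) :: ennreal) = indicator {s. \<forall>i\<le>n. s i < h} s"
      using chamber_partial_sums[OF n, of s h] chamber_cong[OF a] chamber_cong[OF b]
      unfolding d indicator_def by auto
    moreover have "km_det d 1 (A ?v) (B ?v) = shift_det h n s"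
      unfolding shift_matrix_eq_km_det[OF d] by (rule km_det_cong[OF a b])
    ultimately show "f ?v = g (s 0) * indicator {s. \<forall>i\<le>n. s i < h} s * ennreal (shift_det h n s)"
      unfolding f_def by (simp add: mult.assoc)
  qed
  also have "?L = leb_on (insert 0 {1..n})"
    by (rule arg_cong[where f = leb_on]) (auto simp: d)
  also have "(\<integral>\<^sup>+s. g (s 0) * indicator {s. \<forall>i\<le>n. s i < h} s * ennreal (shift_det h n s)
       \<partial>leb_on (insert 0 {1..n})) =
     (\<integral>\<^sup>+y. (\<integral>\<^sup>+x. g ((x(0 := y)) 0) * indicator {s. \<forall>i\<le>n. s i < h} (x(0 := y)) *
        ennreal (shift_det h n (x(0 := y))) \<partial>leb_on {1..n}) \<partial>lborel)"
  proof (rule lborel_prod.product_nn_integral_insert_rev)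
    have c: "(\<lambda>v. v i) \<in> borel_measurable (leb_on (insert 0 {1..n}))" if "i \<le> n" for i
    proof -
      have "i \<in> insert 0 {1..n}" using that by auto
      from measurable_component_singleton[OF this, of "\<lambda>_. lborel"] show ?thesis by simp
    qed
    have ind: "(\<lambda>s. indicator {s. \<forall>i\<le>n. s i < h} s :: ennreal) \<in> borel_measurable (leb_on (insert 0 {1..n}))"
    proof (rule borel_measurable_indicator')
      have "Measurable.pred (leb_on (insert 0 {1..n})) (\<lambda>s. \<forall>i\<in>{..n}. s i < h)"
        by (rule pred_intros_countable_bounded) (auto intro!: borel_measurable_pred_less c simp del: One_nat_def)
      moreover have "x \<in> {s. \<forall>i\<le>n. s i < h} \<longleftrightarrow> (\<forall>i\<in>{..n}. x i < h)" for x by auto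
      ultimately show "{x \<in> space (leb_on (insert 0 {1..n})). x \<in> {s. \<forall>i\<le>n. s i < h}} \<in> sets (leb_on (insert 0 {1..n}))"
        unfolding pred_def by (simp only:)
    qed
    show "(\<lambda>s. g (s 0) * indicator {s. \<forall>i\<le>n. s i < h} s * ennreal (shift_det h n s))
      \<in> borel_measurable (leb_on (insert 0 {1..n}))"
      by (rule borel_measurable_times_ennreal[OF borel_measurable_times_ennreal[OF measurable_compose[OF c[OF le0] g] ind]
            measurable_compose[OF shift_det_measurable[OF c] measurable_ennreal]])
  qed auto
  also have "\<dots> = (\<integral>\<^sup>+y. g y * indicator {..<h} y * (\<integral>\<^sup>+s. ennreal (shift_det h n (s(0 := y))) *
        indicator (orthant n h) s \<partial>leb_on {1..n}) \<partial>lborel)"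
  proof (rule nn_integral_cong)
    fix y :: real
    let ?D = "\<lambda>s. ennreal (shift_det h n (s(0 := y))) * indicator (orthant n h) s"
    have c: "(\<lambda>v. (v(0 := y)) i) \<in> borel_measurable (leb_on {1..n})" if "i \<le> n" for i
    proof (cases "i = 0")
      case False
      then have "i \<in> {1..n}" using that by auto
      from measurable_component_singleton[OF this, of "\<lambda>_. lborel"] show ?thesis using False by simp
    qed simp
    have PE: "orthant n h \<in> sets (leb_on {1..n})"
      by (rule sets_PiM_I_finite) auto
    have Dm: "?D \<in> borel_measurable (leb_on {1..n})"
      by (rule borel_measurable_times_ennreal[OF measurable_compose[OF shift_det_measurable[OF c] measurable_ennreal]
            borel_measurable_indicator[OF PE]])
    have "(\<integral>\<^sup>+x. g ((x(0 := y)) 0) * indicator {s. \<forall>i\<le>n. s i < h} (x(0 := y)) *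
        ennreal (shift_det h n (x(0 := y))) \<partial>leb_on {1..n}) =
      (\<integral>\<^sup>+x. (g y * indicator {..<h} y) * ?D x \<partial>leb_on {1..n})"
    proof (rule nn_integral_cong)
      fix x assume x: "x \<in> space (leb_on {1..n})"
      have "(\<forall>i\<le>n. (x(0 := y)) i < h) \<longleftrightarrow> y < h \<and> (\<forall>i\<in>{1..n}. x i < h)"
      proof safe
        fix i assume "y < h" "\<forall>i\<in>{1..n}. x i < h" "i \<le> n"
        then show "(x(0 := y)) i < h" by (cases "i = 0") auto
      next
        assume *: "\<forall>i\<le>n. (x(0 := y)) i < h"
        show "y < h" using *[rule_format, of 0] by simp
        fix i assume "i \<in> {1..n}"
        then show "x i < h" using *[rule_format, of i] by auto
      qed
      moreover have "x \<in> orthant n h \<longleftrightarrow> (\<forall>i\<in>{1..n}. x i < h)"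
        using x by (auto simp: space_PiM PiE_iff)
      ultimately show "g ((x(0 := y)) 0) * indicator {s. \<forall>i\<le>n. s i < h} (x(0 := y)) *
          ennreal (shift_det h n (x(0 := y))) = (g y * indicator {..<h} y) * ?D x"
        by (simp add: indicator_def)
    qed
    also have "\<dots> = g y * indicator {..<h} y * (\<integral>\<^sup>+s. ?D s \<partial>leb_on {1..n})"
      by (rule nn_integral_cmult[OF Dm])
    finally show "(\<integral>\<^sup>+x. g ((x(0 := y)) 0) * indicator {s. \<forall>i\<le>n. s i < h} (x(0 := y)) *
        ennreal (shift_det h n (x(0 := y))) \<partial>leb_on {1..n}) =
      g y * indicator {..<h} y * (\<integral>\<^sup>+s. ?D s \<partial>leb_on {1..n})" .
  qed
  finally show ?thesis .
qed

section \<open>Comparison with the Gaussian random walk\<close>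

abbreviation walk :: "(nat \<Rightarrow> real) \<Rightarrow> nat \<Rightarrow> real" where
  "walk w l \<equiv> (if l = 0 then 0 else w l)"

abbreviation step_weight :: "nat \<Rightarrow> nat \<Rightarrow> (nat \<Rightarrow> real) \<Rightarrow> real" where
  "step_weight m N w \<equiv> (\<Prod>l=1..N. heat (1 / m) (walk w (l - 1) - walk w l))"

lemma walk_slice_walk: "walk_slice h m w k i = walk w (i * m + k) - real i * h"
  by (simp add: walk_slice_def)

lemma step_weight_slices:
  assumes "m > 0"
  shows "(\<Prod>k=1..m. \<Prod>i<d. heat (1 / m) (walk_slice h m w (k - 1) i - walk_slice h m w k i)) =
    step_weight m (d * m) w"
proof -
  let ?p = "\<lambda>l. heat (1 / m) (walk w (l - 1) - walk w l)"
  have "(\<Prod>k=1..m. \<Prod>i<d. heat (1 / m) (walk_slice h m w (k - 1) i - walk_slice h m w k i)) =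
      (\<Prod>k=1..m. \<Prod>i<d. ?p (i * m + k))"
    by (intro prod.cong refl arg_cong[where f = "heat (1 / m)"]) (auto simp: walk_slice_walk)
  also have "\<dots> = (\<Prod>i<d. \<Prod>k=1..m. ?p (i * m + k))" by (rule prod.swap)
  also have "\<dots> = (\<Prod>(i, k)\<in>{..<d} \<times> {1..m}. ?p (i * m + k))" by (rule prod.cartesian_product)
  also have "\<dots> = (\<Prod>x\<in>{..<d} \<times> {1..m}. ?p ((\<lambda>(i, k). i * m + k) x))"
    by (intro prod.cong refl) (simp only: case_prod_beta')
  also have "\<dots> = (\<Prod>l=1..d * m. ?p l)"
    by (rule prod.reindex_bij_betw[OF bij_slice_pairs[OF assms]])
  finally show ?thesis .
qed

text \<open>The gap between neighbouring particles in slice \<open>k\<close> is \<open>h\<close> minus the increment of the walk over the window of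
  length \<open>m\<close> that begins at \<open>i m + k\<close>.\<close>

lemma walk_slices_grid:
  assumes "n > 0"
  shows "(\<forall>k\<le>m. \<forall>i. Suc i < Suc n \<longrightarrow> P (walk_slice h m w k i - walk_slice h m w k (Suc i))) \<longleftrightarrow>
    (\<forall>q\<le>n * m. P (h - (walk w (q + m) - walk w q)))"
proof -
  have eq: "walk_slice h m w k i - walk_slice h m w k (Suc i) = h - (walk w ((i * m + k) + m) - walk w (i * m + k))" for i k
    unfolding walk_slice_walk by (simp add: algebra_simps)
  show ?thesis unfolding eq
  proof (intro iffI allI impI)
    fix q assume *: "\<forall>k\<le>m. \<forall>i. Suc i < Suc n \<longrightarrow> P (h - (walk w ((i * m + k) + m) - walk w (i * m + k)))" and q: "q \<le> n * m"
    show "P (h - (walk w (q + m) - walk w q))"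
    proof (cases "q = n * m")
      case True
      then have "q = (n - 1) * m + m" using assms by (cases n) auto
      then show ?thesis using *[rule_format, of m "n - 1"] assms by (simp only:)
    next
      case False
      then have "q < n * m" using q by simp
      then have "m > 0" "q div m < n" by (auto simp: less_mult_imp_div_less intro: gr0I)
      then have "P (h - (walk w ((q div m * m + q mod m) + m) - walk w (q div m * m + q mod m)))"
        by (intro *[rule_format]) (auto simp: less_imp_le)
      then show ?thesis by (simp only: div_mult_mod_eq)
    qed
  next
    fix k i assume *: "\<forall>q\<le>n * m. P (h - (walk w (q + m) - walk w q))" and "k \<le> m" "Suc i < Suc n"
    then have "Suc i * m \<le> n * m" by (intro mult_right_mono) auto
    then have "i * m + k \<le> n * m" using \<open>k \<le> m\<close> by simp
    then show "P (h - (walk w ((i * m + k) + m) - walk w (i * m + k)))" using * by blast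
  qed
qed

lemma chain_density_eq:
  assumes m: "m > 0" and True: "\<forall>k\<le>m. walk_slice h m w k \<in> chamber d"
  shows "chain_density g d h m (m - 1) w =
    g (w m) * ennreal (\<Prod>k=1..m. km_det d (1 / m) (walk_slice h m w (k - 1)) (walk_slice h m w k))"
proof -
  let ?sl = "walk_slice h m w" and ?C = "chamber d"
  have p1: "(\<Prod>k=1..m - 1. ennreal (km_det d (1 / m) (?sl (k - 1)) (?sl k)) * indicator ?C (?sl k)) =
      (\<Prod>k=1..m - 1. ennreal (km_det d (1 / m) (?sl (k - 1)) (?sl k)))"
    using True by (intro prod.cong refl) auto
  have p2: "(\<Prod>k=1..m. ennreal (km_det d (1 / m) (?sl (k - 1)) (?sl k))) =
      (\<Prod>k=1..m - 1. ennreal (km_det d (1 / m) (?sl (k - 1)) (?sl k))) * ennreal (km_det d (1 / m) (?sl (m - 1)) (?sl m))"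
    using m by (cases m) (auto simp: prod.nat_ivl_Suc' mult.commute)
  have p3: "real (m - (m - 1)) / real m = 1 / real m" using m by simp
  have p4: "ennreal (\<Prod>k=1..m. km_det d (1 / m) (?sl (k - 1)) (?sl k)) =
      (\<Prod>k=1..m. ennreal (km_det d (1 / m) (?sl (k - 1)) (?sl k)))"
    using True m by (intro prod_ennreal[symmetric] km_det_bounds(1)) auto
  have p5: "indicator ?C (?sl 0) = (1::ennreal)" "indicator ?C (?sl m) = (1::ennreal)" using True by auto
  show ?thesis unfolding chain_density_def p1 p3 p4 p2 p5 by (simp only: mult_1_right mult.assoc)
qed

lemma chain_density_upper:
  assumes m: "m > 0" and n: "n > 0" and d: "d = Suc n"
  shows "chain_density g d h m (m - 1) w \<le>
    g (w m) * indicator {w. \<forall>q\<le>n * m. walk w (q + m) - walk w q < h} w * ennreal (step_weight m (d * m) w)"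
proof -
  let ?sl = "walk_slice h m w" and ?C = "chamber d"
  have grid: "(\<forall>k\<le>m. ?sl k \<in> ?C) \<longleftrightarrow> (\<forall>q\<le>n * m. walk w (q + m) - walk w q < h)"
    using walk_slices_grid[OF n, of m "\<lambda>x. 0 < x" h w] by (simp add: chamber_def d)
  show ?thesis
  proof (cases "\<forall>k\<le>m. ?sl k \<in> ?C")
    case True
    then have eq: "chain_density g d h m (m - 1) w = g (w m) * ennreal (\<Prod>k=1..m. km_det d (1 / m) (?sl (k - 1)) (?sl k))"
      using chain_density_eq[OF m] by blast
    have "(\<Prod>k=1..m. km_det d (1 / m) (?sl (k - 1)) (?sl k)) \<le>
       (\<Prod>k=1..m. \<Prod>i<d. heat (1 / m) (?sl (k - 1) i - ?sl k i))"
      using True m by (intro prod_mono conjI km_det_bounds) auto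
    then show ?thesis
      using True grid unfolding eq step_weight_slices[OF m]
      by (auto intro!: mult_left_mono ennreal_leI)
  next
    case False
    then obtain k where k: "k \<le> m" "?sl k \<notin> ?C" by blast
    have "chain_density g d h m (m - 1) w = 0"
    proof (cases "k = 0 \<or> k = m")
      case False
      then have "(\<Prod>k=1..m - 1. ennreal (km_det d (1 / m) (?sl (k - 1)) (?sl k)) * (indicator ?C (?sl k) :: ennreal)) = 0"
        using k by (intro prod_zero) (auto intro!: bexI[of _ k])
      then show ?thesis unfolding chain_density_def by simp
    qed (use k in \<open>auto simp: chain_density_def\<close>)
    then show ?thesis by simp
  qed
qed

lemma chain_density_lower:
  assumes m: "m > 0" and n: "n > 0" and d: "d = Suc n" and e: "\<epsilon> > 0"
    and c: "c = fact d * exp (- \<epsilon>\<^sup>2 / (1 / m))" "c \<le> 1"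
  shows "ennreal ((1 - c) ^ m) * (g (w m) * indicator {w. \<forall>q\<le>n * m. walk w (q + m) - walk w q \<le> h - \<epsilon>} w *
      ennreal (step_weight m (d * m) w)) \<le> chain_density g d h m (m - 1) w"
proof (cases "\<forall>q\<le>n * m. walk w (q + m) - walk w q \<le> h - \<epsilon>")
  case True
  let ?sl = "walk_slice h m w" and ?C = "chamber d"
  have "\<forall>q\<le>n * m. \<epsilon> \<le> h - (walk w (q + m) - walk w q)" using True by (simp add: le_diff_eq add.commute)
  then have gap: "\<epsilon> \<le> ?sl k i - ?sl k (Suc i)" if "k \<le> m" "Suc i < d" for k i
    using walk_slices_grid[OF n, of m "\<lambda>x. \<epsilon> \<le> x" h w] that d by blast
  have "?sl k (Suc i) < ?sl k i" if "k \<le> m" "Suc i < d" for k i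
    using gap[OF that] e by linarith
  then have ch: "\<forall>k\<le>m. ?sl k \<in> ?C" by (simp add: chamber_def)
  have "(1 - c) ^ m * step_weight m (d * m) w =
      (\<Prod>k=1..m. (1 - c) * (\<Prod>i<d. heat (1 / m) (?sl (k - 1) i - ?sl k i)))"
    unfolding step_weight_slices[OF m, symmetric, where h = h] by (simp add: prod.distrib)
  also have "\<dots> \<le> (\<Prod>k=1..m. km_det d (1 / m) (?sl (k - 1)) (?sl k))"
  proof (rule prod_mono, rule conjI)
    fix k assume k: "k \<in> {1..m}"
    show "0 \<le> (1 - c) * (\<Prod>i<d. heat (1 / m) (?sl (k - 1) i - ?sl k i))"
      using c(2) by (intro mult_nonneg_nonneg prod_nonneg) auto
    show "(1 - c) * (\<Prod>i<d. heat (1 / m) (?sl (k - 1) i - ?sl k i)) \<le> km_det d (1 / m) (?sl (k - 1)) (?sl k)"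
      unfolding c(1) by (rule km_det_lower) (use k m e gap in auto)
  qed
  finally have "ennreal ((1 - c) ^ m * step_weight m (d * m) w) \<le> ennreal (\<Prod>k=1..m. km_det d (1 / m) (?sl (k - 1)) (?sl k))"
    by (rule ennreal_leI)
  then have "g (w m) * ennreal ((1 - c) ^ m * step_weight m (d * m) w) \<le> chain_density g d h m (m - 1) w"
    unfolding chain_density_eq[OF m ch] by (rule mult_left_mono) simp
  moreover have "ennreal ((1 - c) ^ m * step_weight m (d * m) w) = ennreal ((1 - c) ^ m) * ennreal (step_weight m (d * m) w)"
    using c(2) by (intro ennreal_mult) (auto intro!: prod_nonneg)
  ultimately show ?thesis using True by (simp add: mult_ac)
qed simp

section \<open>Box probabilities are determined by characteristic functions\<close>

text \<open>One-dimensional uniqueness for finite measures, by normalization to probability measures.\<close>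

lemma weighted_levy_uniqueness:
  fixes f :: "'a \<Rightarrow> real" and g :: "'b \<Rightarrow> real"
  assumes f: "integrable A f" "\<And>a. 0 \<le> f a" and X[measurable]: "X \<in> borel_measurable A"
    and g: "integrable B g" "\<And>b. 0 \<le> g b" and Y[measurable]: "Y \<in> borel_measurable B"
    and eq: "\<And>v. (CLINT a|A. of_real (f a) * iexp (v * X a)) = (CLINT b|B. of_real (g b) * iexp (v * Y b))"
    and C[measurable]: "C \<in> sets borel"
  shows "(LINT a|A. f a * indicator C (X a)) = (LINT b|B. g b * indicator C (Y b))"
proof -
  define c where "c = (LINT a|A. f a)"
  have "complex_of_real c = complex_of_real (LINT b|B. g b)"
    using eq[of 0] by (simp add: c_def integral_complex_of_real)
  then have cg: "c = (LINT b|B. g b)" by (simp only: of_real_eq_iff)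
  show ?thesis
  proof (cases "c = 0")
    case True
    have "AE a in A. f a = 0" using integral_nonneg_eq_0_iff_AE[OF f(1)] f(2) True c_def by simp
    moreover have "AE b in B. g b = 0" using integral_nonneg_eq_0_iff_AE[OF g(1)] g(2) True cg by simp
    ultimately have "(LINT a|A. f a * indicator C (X a)) = 0" "(LINT b|B. g b * indicator C (Y b)) = 0"
      by (auto intro!: integral_eq_zero_AE)
    then show ?thesis by simp
  next
    case False
    moreover have "c \<ge> 0" unfolding c_def by (rule Bochner_Integration.integral_nonneg) (rule f(2))
    ultimately have c: "c > 0" by simp
    have main: "real_distribution (distr (density D (\<lambda>a. ennreal (w a / c))) borel Z) \<and>
       char (distr (density D (\<lambda>a. ennreal (w a / c))) borel Z) = (\<lambda>v. (CLINT a|D. of_real (w a) * iexp (v * Z a)) / c) \<and>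
       measure (distr (density D (\<lambda>a. ennreal (w a / c))) borel Z) C = (LINT a|D. w a * indicator C (Z a)) / c"
      if w: "integrable D w" "\<And>a. 0 \<le> w a" "(LINT a|D. w a) = c" and Z[measurable]: "Z \<in> borel_measurable D"
      for D :: "'c measure" and w :: "'c \<Rightarrow> real" and Z
    proof -
      let ?N = "density D (\<lambda>a. ennreal (w a / c))"
      have [measurable]: "w \<in> borel_measurable D" using w(1) by simp
      have Zm: "Z \<in> ?N \<rightarrow>\<^sub>M borel" by simp
      have N: "prob_space ?N"
      proof
        have "emeasure ?N (space ?N) = (\<integral>\<^sup>+a. ennreal (w a / c) \<partial>D)"
          by (simp add: emeasure_density cong: nn_integral_cong)
        also have "\<dots> = ennreal (LINT a|D. w a / c)"
          using w c by (intro nn_integral_eq_integral) auto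
        also have "(LINT a|D. w a / c) = 1" using w c by simp
        finally show "emeasure ?N (space ?N) = 1" by simp
      qed
      then interpret N: prob_space ?N .
      have rd: "real_distribution (distr ?N borel Z)" by (rule N.real_distribution_distr) simp
      then interpret rd: real_distribution "distr ?N borel Z" .
      have ch: "char (distr ?N borel Z) v = (CLINT a|D. of_real (w a) * iexp (v * Z a)) / c" for v
      proof -
        have "char (distr ?N borel Z) v = (CLINT a|?N. iexp (v * Z a))"
          unfolding char_def by (subst integral_distr[OF Zm]) auto
        also have "\<dots> = (CLINT a|D. (w a / c) *\<^sub>R iexp (v * Z a))"
          using w(2) c by (subst integral_density) auto
        also have "\<dots> = (CLINT a|D. (of_real (w a) * iexp (v * Z a)) / c)"
          by (intro Bochner_Integration.integral_cong refl) (simp add: scaleR_conv_of_real)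
        finally show ?thesis by simp
      qed
      have "measure (distr ?N borel Z) C = (LINT z|distr ?N borel Z. indicator C z)"
        by simp
      also have "\<dots> = (LINT a|?N. indicator C (Z a))"
        by (subst integral_distr[OF Zm]) auto
      also have "\<dots> = (LINT a|D. (w a / c) *\<^sub>R indicator C (Z a))"
        using w(2) c by (subst integral_density) auto
      also have "\<dots> = (LINT a|D. (w a * indicator C (Z a)) / c)"
        by (intro Bochner_Integration.integral_cong refl) simp
      finally have "measure (distr ?N borel Z) C = (LINT a|D. w a * indicator C (Z a)) / c" by simp
      then show ?thesis using rd ch by blast
    qed
    note mA = main[OF f c_def[symmetric] X] and mB = main[OF g cg[symmetric] Y]
    have "distr (density A (\<lambda>a. ennreal (f a / c))) borel X = distr (density B (\<lambda>a. ennreal (g a / c))) borel Y"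
      by (rule Levy_uniqueness) (use mA mB eq in auto)
    then have "(LINT a|A. f a * indicator C (X a)) / c = (LINT b|B. g b * indicator C (Y b)) / c"
      using conjunct2[OF conjunct2[OF mA]] conjunct2[OF conjunct2[OF mB]] by metis
    then show ?thesis using c by simp
  qed
qed

text \<open>One-dimensional uniqueness needs nonnegative weights.  The weights \<open>1 + cos T\<close> and \<open>1 + sin T\<close> have this property
  and together encode the complex exponential of \<open>T\<close>.\<close>

lemma (in prob_space) trig_weight_transform:
  fixes v :: real
  assumes [measurable]: "p \<in> borel_measurable M" "T \<in> borel_measurable M" "X \<in> borel_measurable M"
    and p: "\<And>a. 0 \<le> p a" "\<And>a. p a \<le> 1"
    and E: "E = (\<lambda>s :: real. CLINT a|M. of_real (p a) * iexp (v * X a + s * T a))"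
  shows "(CLINT a|M. of_real (p a) * iexp (v * X a)) = E 0"
    "(CLINT a|M. of_real (p a * (1 + cos (T a))) * iexp (v * X a)) = E 0 + (E 1 + E (-1)) / 2"
    "(CLINT a|M. of_real (p a * (1 + sin (T a))) * iexp (v * X a)) = E 0 + (E 1 - E (-1)) / (2 * \<i>)"
    "integrable M (\<lambda>a. p a * cos (T a))" "integrable M (\<lambda>a. p a * sin (T a))" "integrable M p"
proof -
  have int: "integrable M (\<lambda>a. of_real (p a) * iexp (v * X a + s * T a))" for s
    by (rule integrable_const_bound[where B = 1]) (use p in \<open>auto simp: norm_mult abs_le_iff intro: order_trans[of _ 0]\<close>)
  have hb: "has_bochner_integral M (\<lambda>a. of_real (p a) * iexp (v * X a + s * T a)) (E s)" for s
    unfolding E by (rule has_bochner_integral_integrable[OF int])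
  show "(CLINT a|M. of_real (p a) * iexp (v * X a)) = E 0" by (simp add: E)
  have cos_eq: "of_real (p a * (1 + cos (T a))) * iexp (v * X a) =
      of_real (p a) * iexp (v * X a + 0 * T a) +
      (of_real (p a) * iexp (v * X a + 1 * T a) + of_real (p a) * iexp (v * X a + -1 * T a)) / 2" for a
  proof -
    have "complex_of_real (cos (T a)) = (iexp (T a) + iexp (- T a)) / 2"
      using cos_exp_eq[of "of_real (T a)"] by (simp add: cos_of_real)
    moreover have "iexp (v * X a + 1 * T a) = iexp (v * X a) * iexp (T a)"
      "iexp (v * X a + -1 * T a) = iexp (v * X a) * iexp (- T a)"
      by (simp_all add: algebra_simps flip: exp_add)
    ultimately show ?thesis by (simp add: distrib_left distrib_right right_diff_distrib left_diff_distrib add_divide_distrib diff_divide_distrib mult_ac)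
  qed
  show "(CLINT a|M. of_real (p a * (1 + cos (T a))) * iexp (v * X a)) = E 0 + (E 1 + E (-1)) / 2"
    unfolding cos_eq
    by (rule has_bochner_integral_integral_eq,
        intro has_bochner_integral_add has_bochner_integral_diff has_bochner_integral_divide_zero
          hb[of 0] hb[of 1] hb[of "-1"])
  have sin_eq: "of_real (p a * (1 + sin (T a))) * iexp (v * X a) =
      of_real (p a) * iexp (v * X a + 0 * T a) +
      (of_real (p a) * iexp (v * X a + 1 * T a) - of_real (p a) * iexp (v * X a + -1 * T a)) / (2 * \<i>)" for a
  proof -
    have "complex_of_real (sin (T a)) = (iexp (T a) - iexp (- T a)) / (2 * \<i>)"
      using sin_exp_eq[of "of_real (T a)"] by (simp add: sin_of_real)
    moreover have "iexp (v * X a + 1 * T a) = iexp (v * X a) * iexp (T a)"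
      "iexp (v * X a + -1 * T a) = iexp (v * X a) * iexp (- T a)"
      by (simp_all add: algebra_simps flip: exp_add)
    ultimately show ?thesis by (simp add: distrib_left distrib_right right_diff_distrib left_diff_distrib add_divide_distrib diff_divide_distrib mult_ac)
  qed
  show "(CLINT a|M. of_real (p a * (1 + sin (T a))) * iexp (v * X a)) = E 0 + (E 1 - E (-1)) / (2 * \<i>)"
    unfolding sin_eq
    by (rule has_bochner_integral_integral_eq,
        intro has_bochner_integral_add has_bochner_integral_diff has_bochner_integral_divide_zero
          hb[of 0] hb[of 1] hb[of "-1"])
  have "\<bar>p a * y\<bar> \<le> 1" if "\<bar>y\<bar> \<le> 1" for a y
    using mult_mono[of "\<bar>p a\<bar>" 1 "\<bar>y\<bar>" 1] p that by (auto simp: abs_mult)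
  then show "integrable M (\<lambda>a. p a * cos (T a))" "integrable M (\<lambda>a. p a * sin (T a))"
    by (auto intro!: integrable_const_bound[where B = 1])
  show "integrable M p"
    by (rule integrable_const_bound[where B = 1]) (use p in auto)
qed

lemma integral_mult_iexp:
  fixes q t :: "'a \<Rightarrow> real"
  assumes "integrable M (\<lambda>a. q a * cos (t a))" "integrable M (\<lambda>a. q a * sin (t a))"
  shows "(CLINT a|M. of_real (q a) * iexp (t a)) =
    of_real (LINT a|M. q a * cos (t a)) + \<i> * of_real (LINT a|M. q a * sin (t a))"
proof -
  have split: "of_real p * iexp u = complex_of_real (p * cos u) + \<i> * complex_of_real (p * sin u)" for p u :: real
    unfolding cis_conv_exp[symmetric] by (simp add: complex_eq_iff)
  have "(CLINT a|M. of_real (q a) * iexp (t a)) =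
      (CLINT a|M. complex_of_real (q a * cos (t a))) + (CLINT a|M. \<i> * complex_of_real (q a * sin (t a)))"
    unfolding split by (intro Bochner_Integration.integral_add integrable_mult_right integrable_of_real assms)
  then show ?thesis by (simp only: integral_complex_of_real integral_mult_right_zero)
qed

text \<open>The Cramer--Wold device: the characters of the coordinates are exchanged for indicators one coordinate at a time.
  At each stage the exponential of the remaining coordinates acts as a weight for the current one.\<close>

lemma box_probability_unique:
  fixes X :: "nat \<Rightarrow> 'a \<Rightarrow> real" and Y :: "nat \<Rightarrow> 'b \<Rightarrow> real"
  assumes A: "prob_space A" and B: "prob_space B"
    and X: "\<And>k. k < K \<Longrightarrow> X k \<in> borel_measurable A" and Y: "\<And>k. k < K \<Longrightarrow> Y k \<in> borel_measurable B"
    and char_eq: "\<And>u. (CLINT a|A. iexp (\<Sum>k<K. u k * X k a)) = (CLINT b|B. iexp (\<Sum>k<K. u k * Y k b))"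
    and C: "\<And>k. C k \<in> sets borel"
  shows "measure A {a \<in> space A. \<forall>k<K. X k a \<in> C k} = measure B {b \<in> space B. \<forall>k<K. Y k b \<in> C k}"
proof -
  interpret A: prob_space A by fact
  interpret B: prob_space B by fact
  have "(CLINT a|A. of_real (\<Prod>i<k. indicator (C i) (X i a)) * iexp (\<Sum>i=k..<K. u i * X i a)) =
      (CLINT b|B. of_real (\<Prod>i<k. indicator (C i) (Y i b)) * iexp (\<Sum>i=k..<K. u i * Y i b))" if "k \<le> K" for u k
    using that
  proof (induction k arbitrary: u)
    case 0
    then show ?case using char_eq[of u] by (simp add: atLeast0LessThan)
  next
    case (Suc k)
    then have k: "k < K" by simp
    define pA where "pA a = (\<Prod>i<k. indicat_real (C i) (X i a))" for a
    define pB where "pB b = (\<Prod>i<k. indicat_real (C i) (Y i b))" for b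
    define TA where "TA a = (\<Sum>i=Suc k..<K. u i * X i a)" for a
    define TB where "TB b = (\<Sum>i=Suc k..<K. u i * Y i b)" for b
    note Xk[measurable] = X[OF k] and Yk[measurable] = Y[OF k]
    have mA[measurable]: "pA \<in> borel_measurable A" "TA \<in> borel_measurable A"
      unfolding pA_def TA_def using k X C
      by (auto intro!: borel_measurable_prod borel_measurable_sum borel_measurable_times
          measurable_compose[OF _ borel_measurable_indicator])
    have mB[measurable]: "pB \<in> borel_measurable B" "TB \<in> borel_measurable B"
      unfolding pB_def TB_def using k Y C
      by (auto intro!: borel_measurable_prod borel_measurable_sum borel_measurable_times
          measurable_compose[OF _ borel_measurable_indicator])
    have bA: "0 \<le> pA a" "pA a \<le> 1" for a unfolding pA_def by (auto intro!: prod_nonneg prod_le_1)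
    have bB: "0 \<le> pB a" "pB a \<le> 1" for a unfolding pB_def by (auto intro!: prod_nonneg prod_le_1)
    have E: "(CLINT a|A. of_real (pA a) * iexp (v * X k a + s * TA a)) =
        (CLINT b|B. of_real (pB b) * iexp (v * Y k b + s * TB b))" for v s
    proof -
      define u' where "u' i = (if i = k then v else s * u i)" for i
      have "(\<Sum>i=k..<K. u' i * Z i) = v * Z k + s * (\<Sum>i=Suc k..<K. u i * Z i)" for Z :: "nat \<Rightarrow> real"
        using k by (simp add: sum.atLeast_Suc_lessThan u'_def sum_distrib_left mult.assoc)
      then show ?thesis using Suc.IH[of u'] k unfolding pA_def pB_def TA_def TB_def by simp
    qed
    note tA = A.trig_weight_transform[OF mA Xk bA refl] and tB = B.trig_weight_transform[OF mB Yk bB refl]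
    have c1: "0 \<le> 1 + cos t" "0 \<le> 1 + sin t" for t :: real
      using cos_ge_minus_one[of t] sin_ge_minus_one[of t] by linarith+
    have intA: "integrable A (\<lambda>a. pA a * (1 + cos (TA a)))" "integrable A (\<lambda>a. pA a * (1 + sin (TA a)))"
      using tA(4-6) by (auto simp: distrib_left)
    have intB: "integrable B (\<lambda>a. pB a * (1 + cos (TB a)))" "integrable B (\<lambda>a. pB a * (1 + sin (TB a)))"
      using tB(4-6) by (auto simp: distrib_left)
    have 0: "(LINT a|A. pA a * indicator (C k) (X k a)) = (LINT b|B. pB b * indicator (C k) (Y k b))"
      by (rule weighted_levy_uniqueness[OF tA(6) bA(1) Xk tB(6) bB(1) Yk _ C]) (simp only: tA(1) tB(1) E)
    have 1: "(LINT a|A. (pA a * (1 + cos (TA a))) * indicator (C k) (X k a)) =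
        (LINT b|B. (pB b * (1 + cos (TB b))) * indicator (C k) (Y k b))"
      by (rule weighted_levy_uniqueness[OF intA(1) _ Xk intB(1) _ Yk _ C])
         (simp_all only: tA(2) tB(2) E mult_nonneg_nonneg bA bB c1)
    have 2: "(LINT a|A. (pA a * (1 + sin (TA a))) * indicator (C k) (X k a)) =
        (LINT b|B. (pB b * (1 + sin (TB b))) * indicator (C k) (Y k b))"
      by (rule weighted_levy_uniqueness[OF intA(2) _ Xk intB(2) _ Yk _ C])
         (simp_all only: tA(3) tB(3) E mult_nonneg_nonneg bA bB c1)
    note [measurable] = C[of k]
    have rA: "integrable A (\<lambda>a. q a * indicator (C k) (X k a))" if "integrable A q" for q :: "'a \<Rightarrow> real"
      by (rule Bochner_Integration.integrable_bound[OF that]) (use that in \<open>auto simp: indicator_def\<close>)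
    have rB: "integrable B (\<lambda>a. q a * indicator (C k) (Y k a))" if "integrable B q" for q :: "'b \<Rightarrow> real"
      by (rule Bochner_Integration.integrable_bound[OF that]) (use that in \<open>auto simp: indicator_def\<close>)
    note iA = rA[OF tA(4)] rA[OF tA(5)] rA[OF tA(6)] and iB = rB[OF tB(4)] rB[OF tB(5)] rB[OF tB(6)]
    have cosE: "(LINT a|A. pA a * cos (TA a) * indicator (C k) (X k a)) = (LINT b|B. pB b * cos (TB b) * indicator (C k) (Y k b))"
      using 1 0 iA iB by (simp add: distrib_left distrib_right)
    have sinE: "(LINT a|A. pA a * sin (TA a) * indicator (C k) (X k a)) = (LINT b|B. pB b * sin (TB b) * indicator (C k) (Y k b))"
      using 2 0 iA iB by (simp add: distrib_left distrib_right)
    have "(CLINT a|A. of_real (pA a * indicator (C k) (X k a)) * iexp (TA a)) =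
        of_real (LINT a|A. pA a * indicator (C k) (X k a) * cos (TA a)) +
        \<i> * of_real (LINT a|A. pA a * indicator (C k) (X k a) * sin (TA a))"
      by (rule integral_mult_iexp) (use iA in \<open>simp_all add: mult_ac\<close>)
    also have "\<dots> = of_real (LINT b|B. pB b * indicator (C k) (Y k b) * cos (TB b)) +
        \<i> * of_real (LINT b|B. pB b * indicator (C k) (Y k b) * sin (TB b))"
      using cosE sinE by (simp add: mult_ac)
    also have "\<dots> = (CLINT b|B. of_real (pB b * indicator (C k) (Y k b)) * iexp (TB b))"
      by (rule integral_mult_iexp[symmetric]) (use iB in \<open>simp_all add: mult_ac\<close>)
    finally show ?case unfolding pA_def pB_def TA_def TB_def by simp
  qed
  from this[of K "\<lambda>_. 0"]
  have "(CLINT a|A. complex_of_real (\<Prod>i<K. indicator (C i) (X i a))) = (CLINT b|B. complex_of_real (\<Prod>i<K. indicator (C i) (Y i b)))"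
    by (simp del: of_real_prod)
  then have eq: "(LINT a|A. (\<Prod>i<K. indicator (C i) (X i a))) = (LINT b|B. (\<Prod>i<K. indicat_real (C i) (Y i b)))"
    unfolding integral_complex_of_real of_real_eq_iff .
  have ind: "(LINT a|D. (\<Prod>i<K. indicat_real (C i) (Z i a))) = measure D {a \<in> space D. \<forall>k<K. Z k a \<in> C k}"
    for D :: "'c measure" and Z :: "nat \<Rightarrow> 'c \<Rightarrow> real"
  proof -
    let ?S = "{a \<in> space D. \<forall>k<K. Z k a \<in> C k}"
    have "(LINT a|D. (\<Prod>i<K. indicat_real (C i) (Z i a))) = (LINT a|D. indicator ?S a)"
      by (rule Bochner_Integration.integral_cong[OF refl]) (auto simp: indicator_def)
    also have "\<dots> = measure D (?S \<inter> space D)" by (rule Bochner_Integration.integral_indicator)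
    also have "?S \<inter> space D = ?S" by (rule Int_absorb2) (rule Collect_restrict)
    finally show ?thesis .
  qed
  show ?thesis using eq unfolding ind .
qed

section \<open>Characteristic functions of Gaussian processes\<close>

lemma normal_rv_char:
  assumes "prob_space M" "normal_rv M X \<mu> \<sigma>"
  shows "(CLINT w|M. iexp (t * X w)) = iexp (t * \<mu>) * of_real (exp (- (t\<^sup>2 * \<sigma>\<^sup>2) / 2))"
proof -
  interpret prob_space M by fact
  have [measurable]: "X \<in> borel_measurable M" using assms by (simp add: normal_rv_def)
  show ?thesis
  proof (cases "\<sigma> = 0")
    case True
    then have "AE w in M. X w = \<mu>" using assms(2) by (auto simp: normal_rv_def)
    then have "(CLINT w|M. iexp (t * X w)) = (CLINT w|M. iexp (t * \<mu>))"
      by (intro integral_cong_AE) auto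
    then show ?thesis using True by (simp add: prob_space)
  next
    case False
    then have s: "\<sigma> > 0" and d: "distributed M lborel X (normal_density \<mu> \<sigma>)"
      using assms(2) by (auto simp: normal_rv_def)
    define Z where "Z w = (X w - \<mu>) / \<sigma>" for w
    have [measurable]: "Z \<in> borel_measurable M" unfolding Z_def by measurable
    have "distributed M lborel Z std_normal_density"
      unfolding Z_def using normal_standard_normal_convert[OF s] d by blast
    then have D: "distr M lborel Z = std_normal_distribution" by (simp add: distributed_def)
    have "(CLINT w|M. iexp (t * \<sigma> * Z w)) = (CLINT z|distr M lborel Z. iexp (t * \<sigma> * z))"
      by (subst integral_distr) auto
    also have "\<dots> = char std_normal_distribution (t * \<sigma>)" unfolding D char_def ..
    also have "\<dots> = of_real (exp (- (t\<^sup>2 * \<sigma>\<^sup>2) / 2))"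
      by (simp add: char_std_normal_distribution power_mult_distrib)
    finally have eq: "(CLINT w|M. iexp (t * \<sigma> * Z w)) = of_real (exp (- (t\<^sup>2 * \<sigma>\<^sup>2) / 2))" .
    have "t * X w = t * \<mu> + t * \<sigma> * Z w" for w using s by (simp add: Z_def field_simps)
    then have "(CLINT w|M. iexp (t * X w)) = (CLINT w|M. iexp (t * \<mu>) * iexp (t * \<sigma> * Z w))"
      by (simp add: exp_add distrib_left)
    then show ?thesis using eq by simp
  qed
qed

lemma normal_rv_moments:
  assumes "prob_space M" "normal_rv M X \<mu> \<sigma>"
  shows "(LINT w|M. X w) = \<mu>" "(LINT w|M. (X w - \<mu>)\<^sup>2) = \<sigma>\<^sup>2"
proof -
  interpret prob_space M by fact
  have [measurable]: "X \<in> borel_measurable M" using assms by (simp add: normal_rv_def)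
  have "(LINT w|M. X w) = \<mu> \<and> (LINT w|M. (X w - \<mu>)\<^sup>2) = \<sigma>\<^sup>2"
  proof (cases "\<sigma> = 0")
    case True
    then have ae: "AE w in M. X w = \<mu>" using assms(2) by (auto simp: normal_rv_def)
    have "(LINT w|M. X w) = (LINT w|M. \<mu>)"
      by (rule integral_cong_AE) (use ae in auto)
    moreover have "(LINT w|M. (X w - \<mu>)\<^sup>2) = (LINT w|M. 0)"
      by (rule integral_cong_AE) (use ae in auto)
    ultimately show ?thesis using True by (simp add: prob_space)
  next
    case False
    then have s: "\<sigma> > 0" and d: "distributed M lborel X (normal_density \<mu> \<sigma>)"
      using assms(2) by (auto simp: normal_rv_def)
    show ?thesis using normal_distributed_expectation[OF s d] normal_distributed_variance[OF s d] by simp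
  qed
  then show "(LINT w|M. X w) = \<mu>" "(LINT w|M. (X w - \<mu>)\<^sup>2) = \<sigma>\<^sup>2" by auto
qed

lemma gaussian_process_char:
  fixes X :: "'t \<Rightarrow> 'a \<Rightarrow> real" and \<tau> :: "'k \<Rightarrow> 't"
  assumes g: "gaussian_process M T X" and K: "finite K" "inj_on \<tau> K" "\<tau> ` K \<subseteq> T"
  shows "(CLINT w|M. iexp (\<Sum>k\<in>K. u k * X (\<tau> k) w)) =
    iexp (\<Sum>k\<in>K. u k * mean_fn M X (\<tau> k)) *
    of_real (exp (- (\<Sum>k\<in>K. \<Sum>l\<in>K. u k * u l * cov_fn M X (\<tau> k) (\<tau> l)) / 2))"
proof -
  interpret prob_space M using g by (simp add: gaussian_process_def)
  have Xm: "X t \<in> borel_measurable M" if "t \<in> T" for t using g that by (simp add: gaussian_process_def)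
  have lin: "\<exists>\<mu> \<sigma>. normal_rv M (\<lambda>w. \<Sum>t\<in>I. c t * X t w) \<mu> \<sigma>" if "finite I" "I \<subseteq> T" for I c
    using g that by (simp add: gaussian_process_def)
  have sq: "integrable M (\<lambda>w. (X t w)\<^sup>2)" if t: "t \<in> T" for t
    using lin[of "{t}" "\<lambda>_. 1"] t normal_rv_square_integrable[OF prob_space_axioms] by auto
  have i1: "integrable M (X t)" if t: "t \<in> T" for t
    by (rule square_integrable_imp_integrable[OF Xm[OF t] sq[OF t]])
  have i2: "integrable M (\<lambda>w. (X s w - a) * (X t w - b))" if "s \<in> T" "t \<in> T" for s t a b
  proof -
    have "integrable M (\<lambda>w. X s w * X t w)"
    proof (rule Bochner_Integration.integrable_bound)
      show "integrable M (\<lambda>w. (X s w)\<^sup>2 + (X t w)\<^sup>2)" using that sq by simp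
      show "(\<lambda>w. X s w * X t w) \<in> borel_measurable M" using that Xm by measurable
      have "\<bar>a * b\<bar> \<le> a\<^sup>2 + b\<^sup>2" for a b :: real
        using sum_squares_bound[of "\<bar>a\<bar>" "\<bar>b\<bar>"] zero_le_power2[of a] zero_le_power2[of b]
          abs_ge_zero[of "a * b"] unfolding abs_mult power2_abs by linarith
      then show "AE w in M. norm (X s w * X t w) \<le> norm ((X s w)\<^sup>2 + (X t w)\<^sup>2)" by simp
    qed
    then show ?thesis using i1 that by (simp add: algebra_simps)
  qed
  define L where "L w = (\<Sum>k\<in>K. u k * X (\<tau> k) w)" for w
  have L: "L = (\<lambda>w. \<Sum>t\<in>\<tau> ` K. u (the_inv_into K \<tau> t) * X t w)"
    unfolding L_def by (intro ext, subst sum.reindex[OF K(2)]) (simp add: the_inv_into_f_f[OF K(2)])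
  have "finite (\<tau> ` K)" using K(1) by simp
  then obtain \<mu> \<sigma> where "normal_rv M (\<lambda>w. \<Sum>t\<in>\<tau> ` K. u (the_inv_into K \<tau> t) * X t w) \<mu> \<sigma>"
    using lin[of "\<tau> ` K" "\<lambda>t. u (the_inv_into K \<tau> t)"] K(3) by blast
  then have n: "normal_rv M L \<mu> \<sigma>" unfolding L .
  have kT: "\<tau> k \<in> T" if "k \<in> K" for k using K(3) that by auto
  have mu: "\<mu> = (\<Sum>k\<in>K. u k * mean_fn M X (\<tau> k))"
    using normal_rv_moments(1)[OF prob_space_axioms n] i1 kT by (simp add: L_def mean_fn_def)
  have "\<sigma>\<^sup>2 = (LINT w|M. (L w - \<mu>)\<^sup>2)" using normal_rv_moments(2)[OF prob_space_axioms n] by simp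
  also have "\<dots> = (LINT w|M. (\<Sum>k\<in>K. \<Sum>l\<in>K. u k * u l *
      ((X (\<tau> k) w - mean_fn M X (\<tau> k)) * (X (\<tau> l) w - mean_fn M X (\<tau> l)))))"
  proof (intro Bochner_Integration.integral_cong refl)
    fix w
    have "L w - \<mu> = (\<Sum>k\<in>K. u k * (X (\<tau> k) w - mean_fn M X (\<tau> k)))"
      unfolding L_def mu by (simp add: sum_subtractf right_diff_distrib)
    then show "(L w - \<mu>)\<^sup>2 = (\<Sum>k\<in>K. \<Sum>l\<in>K. u k * u l *
      ((X (\<tau> k) w - mean_fn M X (\<tau> k)) * (X (\<tau> l) w - mean_fn M X (\<tau> l))))"
      by (simp add: power2_eq_square sum_product mult_ac)
  qed
  also have "\<dots> = (\<Sum>k\<in>K. \<Sum>l\<in>K. u k * u l * cov_fn M X (\<tau> k) (\<tau> l))"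
    using i2 kT unfolding cov_fn_def by simp
  finally have var: "\<sigma>\<^sup>2 = (\<Sum>k\<in>K. \<Sum>l\<in>K. u k * u l * cov_fn M X (\<tau> k) (\<tau> l))" .
  show ?thesis
    using normal_rv_char[OF prob_space_axioms n, of 1] unfolding var mu L_def by simp
qed

section \<open>The random walk with Gaussian steps\<close>

definition walk_measure :: "nat \<Rightarrow> nat \<Rightarrow> (nat \<Rightarrow> real) measure" where
  "walk_measure m N = density (leb_on {1..N}) (\<lambda>\<xi>. ennreal (\<Prod>l=1..N. heat (1 / m) (\<xi> l)))"

abbreviation psum :: "(nat \<Rightarrow> real) \<Rightarrow> nat \<Rightarrow> real" where
  "psum \<xi> l \<equiv> (\<Sum>j=1..l. \<xi> j)"

abbreviation walk_event :: "nat \<Rightarrow> nat \<Rightarrow> real set \<Rightarrow> real set \<Rightarrow> (nat \<Rightarrow> real) set" where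
  "walk_event m n B S \<equiv> {\<xi> \<in> space (walk_measure m (Suc n * m)). psum \<xi> m \<in> B \<and>
     (\<forall>q\<le>n * m. psum \<xi> (q + m) - psum \<xi> q \<in> S)}"

lemma coordinate_measurable:
  assumes "l \<in> I"
  shows "(\<lambda>\<xi>. \<xi> l) \<in> borel_measurable (leb_on I)"
  using measurable_component_singleton[OF assms, of "\<lambda>_. lborel"] by simp

lemma sets_walk_measure: "sets (walk_measure m N) = sets (leb_on {1..N})"
  by (simp add: walk_measure_def)

lemma space_walk_measure: "space (walk_measure m N) = space (leb_on {1..N})"
  by (simp add: walk_measure_def)

lemma measurable_walk_measure: "borel_measurable (walk_measure m N) = borel_measurable (leb_on {1..N})"
  by (rule measurable_cong_sets) (auto simp: sets_walk_measure)

lemma increments_density_measurable: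
  "(\<lambda>\<xi>. \<Prod>l=1..N. normal_density 0 \<sigma> (\<xi> l)) \<in> borel_measurable (leb_on {1..N})"
  by (intro borel_measurable_prod measurable_compose[OF coordinate_measurable borel_measurable_normal_density])

lemma step_weight_measurable:
  "(\<lambda>w. step_weight m N w) \<in> borel_measurable (leb_on {1..N})"
proof -
  have w: "(\<lambda>w. walk w l) \<in> borel_measurable (leb_on {1..N})" if "l \<le> N" for l
    using coordinate_measurable[of l "{1..N}"] that by (cases "l = 0") auto
  show ?thesis
    by (intro borel_measurable_prod measurable_compose[OF _ borel_measurable_normal_density] borel_measurable_diff)
       (rule w, force)+
qed

text \<open>Passes from positions to increments, in which the weight is a product of Gaussian densities.\<close>

lemma nn_integral_step_weight:
  assumes H: "H \<in> borel_measurable (leb_on {1..N})"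
  shows "(\<integral>\<^sup>+w. H w * ennreal (step_weight m N w) \<partial>leb_on {1..N}) =
    (\<integral>\<^sup>+\<xi>. H (\<lambda>i\<in>{1..N}. psum \<xi> i) \<partial>walk_measure m N)"
proof -
  have I: "{1..<1 + N} = {1..N}" by auto
  let ?cs = "\<lambda>\<xi>. \<lambda>i\<in>{1..N}. psum \<xi> i"
  have cs: "?cs \<in> leb_on {1..N} \<rightarrow>\<^sub>M leb_on {1..N}"
  proof (rule measurable_restrict)
    fix i assume "i \<in> {1..N}"
    then have "(\<lambda>\<xi>. psum \<xi> i) \<in> borel_measurable (leb_on {1..N})"
      by (intro borel_measurable_sum coordinate_measurable) auto
    then show "(\<lambda>\<xi>. psum \<xi> i) \<in> leb_on {1..N} \<rightarrow>\<^sub>M lborel" by simp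
  qed
  have Hcs: "(\<lambda>\<xi>. H (?cs \<xi>)) \<in> borel_measurable (leb_on {1..N})"
    by (rule measurable_compose[OF cs H])
  have m: "(\<lambda>w. H w * ennreal (step_weight m N w)) \<in> borel_measurable (leb_on {1..N})"
    by (intro borel_measurable_times_ennreal H measurable_compose[OF step_weight_measurable measurable_ennreal])
  have sw: "step_weight m N (?cs \<xi>) = (\<Prod>l=1..N. heat (1 / m) (\<xi> l))" for \<xi>
  proof (rule prod.cong[OF refl])
    fix l assume l: "l \<in> {1..N}"
    have w: "walk (?cs \<xi>) k = psum \<xi> k" if "k \<le> N" for k using that by (cases "k = 0") auto
    obtain k where k: "l = Suc k" using l by (cases l) auto
    have "walk (?cs \<xi>) (l - 1) - walk (?cs \<xi>) l = psum \<xi> k - psum \<xi> (Suc k)"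
    proof -
      have "walk (?cs \<xi>) k = psum \<xi> k" "walk (?cs \<xi>) (Suc k) = psum \<xi> (Suc k)"
        using l k by (intro w; simp)+
      then show ?thesis unfolding k diff_Suc_1 by (simp only:)
    qed
    also have "\<dots> = - \<xi> l" unfolding k by (simp add: sum.nat_ivl_Suc')
    finally show "heat (1 / m) (walk (?cs \<xi>) (l - 1) - walk (?cs \<xi>) l) = heat (1 / m) (\<xi> l)"
      by (simp only:) (simp add: normal_density_def)
  qed
  have "(\<integral>\<^sup>+w. H w * ennreal (step_weight m N w) \<partial>leb_on {1..N}) =
      (\<integral>\<^sup>+\<xi>. H (?cs \<xi>) * ennreal (step_weight m N (?cs \<xi>)) \<partial>leb_on {1..N})"
    using nn_integral_PiM_lborel_partial_sums[of _ 1 N, unfolded I, OF m] by (rule sym)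
  also have "\<dots> = (\<integral>\<^sup>+\<xi>. ennreal (\<Prod>l=1..N. heat (1 / m) (\<xi> l)) * H (?cs \<xi>) \<partial>leb_on {1..N})"
    unfolding sw by (simp only: mult.commute)
  also have "\<dots> = (\<integral>\<^sup>+\<xi>. H (?cs \<xi>) \<partial>walk_measure m N)"
    unfolding walk_measure_def
    by (rule nn_integral_density[symmetric, OF measurable_compose[OF increments_density_measurable measurable_ennreal] Hcs])
  finally show ?thesis .
qed

lemma prob_space_walk_measure:
  assumes "m > 0"
  shows "prob_space (walk_measure m N)"
proof
  have "emeasure (walk_measure m N) (space (walk_measure m N)) =
      (\<integral>\<^sup>+\<xi>. (\<Prod>l=1..N. ennreal (heat (1 / m) (\<xi> l))) \<partial>leb_on {1..N})"
    unfolding walk_measure_def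
    by (subst emeasure_density[OF measurable_compose[OF increments_density_measurable measurable_ennreal]])
       (auto intro!: nn_integral_cong simp: prod_ennreal)
  also have "\<dots> = (\<Prod>l=1..N. \<integral>\<^sup>+x. ennreal (heat (1 / m) x) \<partial>lborel)"
    by (rule lborel_prod.product_nn_integral_prod) auto
  also have "\<dots> = 1"
  proof (rule prod.neutral, rule ballI)
    interpret N: prob_space "density lborel (heat (1 / real m))"
      by (rule prob_space_normal_density) (use assms in simp)
    show "(\<integral>\<^sup>+x. ennreal (heat (1 / m) x) \<partial>lborel) = 1"
      using N.emeasure_space_1 by (simp add: emeasure_density)
  qed
  finally show "emeasure (walk_measure m N) (space (walk_measure m N)) = 1" .
qed

lemma walk_measure_char:
  fixes c :: "nat \<Rightarrow> real"
  assumes m: "m > 0"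
  shows "(CLINT \<xi>|walk_measure m N. iexp (\<Sum>l=1..N. c l * \<xi> l)) = of_real (exp (- (\<Sum>l=1..N. (c l)\<^sup>2 / m) / 2))"
proof -
  let ?\<sigma> = "sqrt (1 / real m)"
  have s: "?\<sigma> > 0" using m by simp
  have one: "has_bochner_integral lborel (\<lambda>x. of_real (normal_density 0 ?\<sigma> x) * iexp (u * x)) (of_real (exp (- (u\<^sup>2 / m) / 2)))" for u
  proof -
    let ?D = "density lborel (\<lambda>x. ennreal (normal_density 0 ?\<sigma> x))"
    interpret D: prob_space ?D by (rule prob_space_normal_density[OF s])
    have n: "normal_rv ?D (\<lambda>x. x) 0 ?\<sigma>"
      unfolding normal_rv_def distributed_def using s by (simp add: distr_id2)
    have "integrable ?D (\<lambda>x. iexp (u * x))"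
      by (rule D.integrable_const_bound[where B = 1]) auto
    then have "integrable lborel (\<lambda>x. normal_density 0 ?\<sigma> x *\<^sub>R iexp (u * x))"
      by (subst (asm) integrable_density) auto
    moreover have "(CLINT x|lborel. normal_density 0 ?\<sigma> x *\<^sub>R iexp (u * x)) = of_real (exp (- (u\<^sup>2 / m) / 2))"
      using normal_rv_char[OF D.prob_space_axioms n, of u] m
      by (subst (asm) integral_density) auto
    ultimately show ?thesis by (simp add: has_bochner_integral_iff scaleR_conv_of_real)
  qed
  have "(CLINT \<xi>|walk_measure m N. iexp (\<Sum>l=1..N. c l * \<xi> l)) =
      (CLINT \<xi>|leb_on {1..N}. (\<Prod>l=1..N. normal_density 0 ?\<sigma> (\<xi> l)) *\<^sub>R iexp (\<Sum>l=1..N. c l * \<xi> l))"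
    unfolding walk_measure_def
  proof (rule integral_density)
    have "(\<lambda>\<xi>. \<Sum>l=1..N. c l * \<xi> l) \<in> borel_measurable (leb_on {1..N})"
      by (intro borel_measurable_sum borel_measurable_times borel_measurable_const coordinate_measurable)
    then show "(\<lambda>\<xi>. iexp (\<Sum>l=1..N. c l * \<xi> l)) \<in> borel_measurable (leb_on {1..N})"
      by measurable
  qed (auto intro!: increments_density_measurable prod_nonneg)
  also have "\<dots> = (CLINT \<xi>|leb_on {1..N}. (\<Prod>l=1..N. of_real (normal_density 0 ?\<sigma> (\<xi> l)) * iexp (c l * \<xi> l)))"
    by (intro Bochner_Integration.integral_cong refl)
       (simp add: scaleR_conv_of_real prod.distrib sum_distrib_left exp_sum)
  also have "\<dots> = (\<Prod>l=1..N. CLINT x|lborel. of_real (normal_density 0 ?\<sigma> x) * iexp (c l * x))"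
    by (rule lborel_prod.product_integral_prod) (use one in \<open>auto simp: has_bochner_integral_iff\<close>)
  also have "\<dots> = (\<Prod>l=1..N. of_real (exp (- ((c l)\<^sup>2 / m) / 2)))"
    using one by (simp add: has_bochner_integral_iff)
  also have "\<dots> = of_real (exp (\<Sum>l=1..N. - ((c l)\<^sup>2 / m) / 2))"
    by (simp only: exp_sum[OF finite_atLeastAtMost] of_real_prod)
  also have "(\<Sum>l=1..N. - ((c l)\<^sup>2 / m) / 2) = - (\<Sum>l=1..N. (c l)\<^sup>2 / m) / 2"
    by (simp add: sum_negf sum_divide_distrib)
  finally show ?thesis .
qed

section \<open>The determinant formula between two walk probabilities\<close>

text \<open>The mass that the determinant formula assigns to starting values in \<open>B\<close>.\<close>

definition det_mass :: "real set \<Rightarrow> real \<Rightarrow> nat \<Rightarrow> ennreal" where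
  "det_mass B h n = (\<integral>\<^sup>+y. indicator B y * indicator {..<h} y *
     (\<integral>\<^sup>+s. ennreal (shift_det h n (s(0 := y))) * indicator (orthant n h) s
       \<partial>leb_on {1..n}) \<partial>lborel)"

abbreviation increments_in :: "nat \<Rightarrow> nat \<Rightarrow> real set \<Rightarrow> (nat \<Rightarrow> real) set" where
  "increments_in n m S \<equiv> {w. \<forall>q\<le>n * m. walk w (q + m) - walk w q \<in> S}"

lemma walk_event_measurable:
  assumes m: "m > 0" and B: "B \<in> sets borel" and S: "S \<in> sets borel"
  shows "(\<lambda>w. indicator B (w m) * indicator (increments_in n m S) w :: ennreal)
    \<in> borel_measurable (leb_on {1..Suc n * m})"
proof (rule borel_measurable_times_ennreal)
  let ?N = "Suc n * m"
  let ?L = "leb_on {1..?N}"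
  have w: "(\<lambda>w. walk w l) \<in> borel_measurable ?L" if "l \<le> ?N" for l
    using coordinate_measurable[of l "{1..?N}"] that by (cases "l = 0") auto
  show "(\<lambda>w. indicator B (w m) :: ennreal) \<in> borel_measurable ?L"
    by (rule measurable_compose[OF coordinate_measurable borel_measurable_indicator[OF B]]) (use m in auto)
  have "{w \<in> space ?L. \<forall>q\<in>{..n * m}. walk w (q + m) - walk w q \<in> S} \<in> sets ?L"
  proof (rule sets.sets_Collect_finite_All)
    fix q assume "q \<in> {..n * m}"
    then have "(\<lambda>w. walk w (q + m) - walk w q) \<in> borel_measurable ?L"
      by (intro borel_measurable_diff w) auto
    from measurable_sets[OF this S] show "{w \<in> space ?L. walk w (q + m) - walk w q \<in> S} \<in> sets ?L"
      by (simp only: vimage_def Int_def mem_Collect_eq conj_commute)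
  qed simp
  moreover have "{w \<in> space ?L. w \<in> (increments_in n m S)} =
      {w \<in> space ?L. \<forall>q\<in>{..n * m}. walk w (q + m) - walk w q \<in> S}"
    by (rule Collect_cong) blast
  ultimately show "(\<lambda>w. indicator (increments_in n m S) w :: ennreal) \<in> borel_measurable ?L"
    by (intro borel_measurable_indicator') (simp only:)
qed

lemma walk_event_integral:
  assumes m: "m > 0" and B: "B \<in> sets borel" and S: "S \<in> sets borel"
  shows "(\<integral>\<^sup>+w. indicator B (w m) * indicator (increments_in n m S) w *
      ennreal (step_weight m (Suc n * m) w) \<partial>leb_on {1..Suc n * m}) =
    emeasure (walk_measure m (Suc n * m)) (walk_event m n B S)"
proof -
  let ?N = "Suc n * m"
  let ?L = "leb_on {1..?N}"
  have p: "(\<lambda>\<xi>. psum \<xi> l) \<in> borel_measurable ?L" if "l \<le> ?N" for l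
    by (rule borel_measurable_sum, rule coordinate_measurable) (use that in auto)
  have gen: "{\<xi> \<in> space ?L. \<forall>q\<in>{..n * m}. f (q + m) \<xi> - f q \<xi> \<in> S} \<in> sets ?L"
    if "\<And>l. l \<le> ?N \<Longrightarrow> f l \<in> borel_measurable ?L" for f :: "nat \<Rightarrow> (nat \<Rightarrow> real) \<Rightarrow> real"
  proof (rule sets.sets_Collect_finite_All)
    fix q assume "q \<in> {..n * m}"
    then have "(\<lambda>\<xi>. f (q + m) \<xi> - f q \<xi>) \<in> borel_measurable ?L"
      by (intro borel_measurable_diff that) auto
    from measurable_sets[OF this S] show "{\<xi> \<in> space ?L. f (q + m) \<xi> - f q \<xi> \<in> S} \<in> sets ?L"
      by (simp add: vimage_def Int_def conj_commute)
  qed simp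
  have E2: "{\<xi> \<in> space ?L. \<forall>q\<in>{..n * m}. psum \<xi> (q + m) - psum \<xi> q \<in> S} \<in> sets ?L"
    by (rule gen[of "\<lambda>l w. psum w l"]) (rule p)
  have E3: "{\<xi> \<in> space ?L. psum \<xi> m \<in> B} \<in> sets ?L"
    using measurable_sets[OF p[of m] B] by (simp add: vimage_def Int_def conj_commute)
  let ?H = "\<lambda>w. indicator B (w m) * indicator (increments_in n m S) w :: ennreal"
  have H: "?H \<in> borel_measurable ?L" by (rule walk_event_measurable[OF m B S])
  let ?E = "{\<xi> \<in> space (walk_measure m ?N). psum \<xi> m \<in> B \<and> (\<forall>q\<le>n * m. psum \<xi> (q + m) - psum \<xi> q \<in> S)}"
  have "?E = {\<xi> \<in> space ?L. psum \<xi> m \<in> B} \<inter> {\<xi> \<in> space ?L. \<forall>q\<in>{..n * m}. psum \<xi> (q + m) - psum \<xi> q \<in> S}"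
    unfolding space_walk_measure by blast
  then have E: "?E \<in> sets (walk_measure m ?N)" unfolding sets_walk_measure using E2 E3 by (simp only: sets.Int)
  have "(\<integral>\<^sup>+w. ?H w * ennreal (step_weight m ?N w) \<partial>?L) = (\<integral>\<^sup>+\<xi>. ?H (\<lambda>i\<in>{1..?N}. psum \<xi> i) \<partial>walk_measure m ?N)"
    by (rule nn_integral_step_weight[OF H])
  also have "\<dots> = (\<integral>\<^sup>+\<xi>. indicator ?E \<xi> \<partial>walk_measure m ?N)"
  proof (rule nn_integral_cong)
    fix \<xi> assume \<xi>: "\<xi> \<in> space (walk_measure m ?N)"
    let ?cs = "\<lambda>i\<in>{1..?N}. psum \<xi> i"
    have w: "walk ?cs k = psum \<xi> k" if "k \<le> ?N" for k using that by (cases "k = 0") auto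
    have "walk ?cs (q + m) - walk ?cs q = psum \<xi> (q + m) - psum \<xi> q" if "q \<le> n * m" for q
      using w[of "q + m"] w[of q] that by simp
    then have "?cs \<in> (increments_in n m S) \<longleftrightarrow> (\<forall>q\<le>n * m. psum \<xi> (q + m) - psum \<xi> q \<in> S)"
      unfolding mem_Collect_eq by (metis (no_types))
    moreover have "?cs m = psum \<xi> m" using m by simp
    ultimately show "?H ?cs = indicator ?E \<xi>"
      using \<xi> unfolding indicator_def by simp
  qed
  also have "\<dots> = emeasure (walk_measure m ?N) ?E" by (rule nn_integral_indicator[OF E])
  finally show ?thesis .
qed

lemma det_mass_upper:
  assumes m: "m > 0" and n: "n > 0" and B: "B \<in> sets borel"
  shows "det_mass B h n \<le> emeasure (walk_measure m (Suc n * m)) (walk_event m n B {..<h})"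
proof -
  have g: "indicator B \<in> borel_measurable borel" using B by simp
  have "det_mass B h n = (\<integral>\<^sup>+w. chain_density (indicator B) (Suc n) h m (m - 1) w \<partial>leb_on {1..Suc n * m})"
    unfolding det_mass_def chain_density_zero_integral[OF m n refl g, symmetric]
    by (rule chain_density_integral[symmetric, OF m _ g]) simp
  also have "\<dots> \<le> (\<integral>\<^sup>+w. indicator B (w m) * indicator (increments_in n m {..<h}) w *
      ennreal (step_weight m (Suc n * m) w) \<partial>leb_on {1..Suc n * m})"
    using chain_density_upper[OF m n refl] unfolding lessThan_iff by (rule nn_integral_mono)
  finally show ?thesis unfolding walk_event_integral[OF m B lessThan_borel] .
qed

lemma det_mass_lower:
  assumes m: "m > 0" and n: "n > 0" and B: "B \<in> sets borel" and e: "\<epsilon> > 0"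
    and c: "c = fact (Suc n) * exp (- \<epsilon>\<^sup>2 / (1 / m))" "c \<le> 1"
  shows "ennreal ((1 - c) ^ m) * emeasure (walk_measure m (Suc n * m)) (walk_event m n B {..h - \<epsilon>}) \<le> det_mass B h n"
proof -
  have g: "indicator B \<in> borel_measurable borel" using B by simp
  let ?F = "\<lambda>w. indicator B (w m) * indicator (increments_in n m {..h - \<epsilon>}) w *
      ennreal (step_weight m (Suc n * m) w)"
  have "ennreal ((1 - c) ^ m) * (\<integral>\<^sup>+w. ?F w \<partial>leb_on {1..Suc n * m}) =
      (\<integral>\<^sup>+w. ennreal ((1 - c) ^ m) * ?F w \<partial>leb_on {1..Suc n * m})"
    by (rule nn_integral_cmult[symmetric, OF borel_measurable_times_ennreal[OF walk_event_measurable[OF m B atMost_borel]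
          measurable_compose[OF step_weight_measurable measurable_ennreal]]])
  also have "\<dots> \<le> (\<integral>\<^sup>+w. chain_density (indicator B) (Suc n) h m (m - 1) w \<partial>leb_on {1..Suc n * m})"
    using chain_density_lower[OF m n refl e c] unfolding atMost_iff by (rule nn_integral_mono)
  also have "\<dots> = det_mass B h n"
    unfolding det_mass_def chain_density_zero_integral[OF m n refl g, symmetric]
    by (rule chain_density_integral[OF m _ g]) simp
  finally show ?thesis unfolding walk_event_integral[OF m B atMost_borel] .
qed

section \<open>Grid values of the conditioned process\<close>

text \<open>The covariance of two increments over windows of unit length is the length of the overlap.\<close>

lemma card_window_overlap:
  fixes k l m :: nat
  assumes "m > 0"
  shows "real (card ({k+1..k+m} \<inter> {l+1..l+m})) / m = slepian_R (real l / m - real k / m)"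
proof -
  have "{k+1..k+m} \<inter> {l+1..l+m} = {max k l + 1..min k l + m}" by auto
  then have c: "card ({k+1..k+m} \<inter> {l+1..l+m}) = min k l + m - max k l" by simp
  have r: "\<bar>real l / m - real k / m\<bar> = real (max k l - min k l) / m"
    using assms by (cases "k \<le> l") (auto simp: max_def min_def abs_if field_simps of_nat_diff)
  show ?thesis
  proof (cases "max k l - min k l \<le> m")
    case True
    then have "card ({k+1..k+m} \<inter> {l+1..l+m}) = m - (max k l - min k l)" unfolding c by arith
    then have "real (card ({k+1..k+m} \<inter> {l+1..l+m})) / m = (real m - real (max k l - min k l)) / m"
      using True by (simp only: of_nat_diff)
    also have "\<dots> = 1 - real (max k l - min k l) / m" using assms by (simp add: diff_divide_distrib)
    also have "\<dots> = slepian_R (real l / m - real k / m)"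
      unfolding slepian_R_def r using True assms by simp
    finally show ?thesis .
  next
    case False
    then have "min k l + m - max k l = 0" by simp
    moreover have "1 - real (max k l - min k l) / m \<le> 0" using False assms by (simp add: field_simps)
    ultimately show ?thesis unfolding slepian_R_def r c by simp
  qed
qed

lemma walk_increment_char:
  fixes u :: "nat \<Rightarrow> real"
  assumes m: "m > 0"
  shows "(CLINT \<xi>|walk_measure m (Suc n * m). iexp (\<Sum>k<Suc (n * m). u k * (psum \<xi> (k + m) - psum \<xi> k))) =
    of_real (exp (- (\<Sum>k<Suc (n * m). \<Sum>l<Suc (n * m). u k * u l * slepian_R (real l / m - real k / m)) / 2))"
proof -
  let ?K = "Suc (n * m)" and ?N = "Suc n * m"
  define ind where "ind k l = indicat_real {k+1..k+m} l" for k l :: nat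
  define c where "c l = (\<Sum>k<?K. u k * ind k l)" for l
  have sub: "{k+1..k+m} \<subseteq> {1..?N}" if "k < ?K" for k using that by auto
  have incr: "psum \<xi> (k + m) - psum \<xi> k = (\<Sum>l=1..?N. ind k l * \<xi> l)" if "k < ?K" for \<xi> :: "nat \<Rightarrow> real" and k
  proof -
    have "{1..k + m} = {1..k} \<union> {k+1..k+m}" by auto
    then have "psum \<xi> (k + m) = psum \<xi> k + (\<Sum>l=k+1..k+m. \<xi> l)"
      by (simp only:) (rule sum.union_disjoint, auto)
    also have "(\<Sum>l=k+1..k+m. \<xi> l) = (\<Sum>l=1..?N. ind k l * \<xi> l)"
      using sub[OF that] by (intro sum.mono_neutral_cong_left) (auto simp: ind_def)
    finally show ?thesis by simp
  qed
  have lin: "(\<Sum>k<?K. u k * (psum \<xi> (k + m) - psum \<xi> k)) = (\<Sum>l=1..?N. c l * \<xi> l)" for \<xi> :: "nat \<Rightarrow> real"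
  proof -
    have "(\<Sum>k<?K. u k * (psum \<xi> (k + m) - psum \<xi> k)) = (\<Sum>k<?K. \<Sum>l=1..?N. u k * ind k l * \<xi> l)"
      by (rule sum.cong[OF refl]) (simp only: incr lessThan_iff sum_distrib_left mult.assoc)
    also have "\<dots> = (\<Sum>l=1..?N. \<Sum>k<?K. u k * ind k l * \<xi> l)" by (rule sum.swap)
    also have "\<dots> = (\<Sum>l=1..?N. c l * \<xi> l)" unfolding c_def sum_distrib_right ..
    finally show ?thesis .
  qed
  have ov: "(\<Sum>l=1..?N. ind k l * ind k' l) / m = slepian_R (real k' / m - real k / m)" if "k < ?K" for k k'
  proof -
    have "(\<Sum>l=1..?N. ind k l * ind k' l) = (\<Sum>l\<in>{k+1..k+m} \<inter> {k'+1..k'+m}. 1)"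
      using sub[OF that] by (intro sum.mono_neutral_cong_right) (auto simp: ind_def indicator_def)
    then show ?thesis using card_window_overlap[OF m, of k k'] by simp
  qed
  have "(\<Sum>l=1..?N. (c l)\<^sup>2 / m) = (\<Sum>l=1..?N. \<Sum>k<?K. \<Sum>k'<?K. u k * u k' * (ind k l * ind k' l) / m)"
    unfolding c_def power2_eq_square sum_product sum_divide_distrib
    by (intro sum.cong refl) (simp add: mult_ac)
  also have "\<dots> = (\<Sum>k<?K. \<Sum>k'<?K. \<Sum>l=1..?N. u k * u k' * (ind k l * ind k' l) / m)"
    by (rule trans[OF sum.swap sum.cong[OF refl sum.swap]])
  also have "\<dots> = (\<Sum>k<?K. \<Sum>k'<?K. u k * u k' * ((\<Sum>l=1..?N. ind k l * ind k' l) / m))"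
    unfolding sum_distrib_left sum_divide_distrib by (simp only: times_divide_eq_right)
  also have "\<dots> = (\<Sum>k<?K. \<Sum>k'<?K. u k * u k' * slepian_R (real k' / m - real k / m))"
    by (intro sum.cong refl) (simp only: ov lessThan_iff)
  finally show ?thesis
    unfolding lin walk_measure_char[OF m] by (simp only:)
qed

text \<open>The conditional law, with the covariance of \<open>S\<close> inserted.\<close>

locale conditioned_slepian =
  fixes P :: "(real \<Rightarrow> real) measure" and x :: real
  assumes sets_P: "sets P = sets path_space"
    and gauss: "gaussian_process P {0..} (\<lambda>t f. f t)"
    and mean: "\<And>t. t \<ge> 0 \<Longrightarrow> mean_fn P (\<lambda>t f. f t) t = x * slepian_R t"
    and cov: "\<And>s t. s \<ge> 0 \<Longrightarrow> t \<ge> 0 \<Longrightarrow> cov_fn P (\<lambda>t f. f t) s t = slepian_R (t - s) - slepian_R s * slepian_R t"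
begin

sublocale prob_space P using gauss by (simp add: gaussian_process_def)

lemma eval_measurable: "t \<ge> 0 \<Longrightarrow> (\<lambda>f. f t) \<in> borel_measurable P"
  using gauss by (simp add: gaussian_process_def)

lemma path_continuous: "f \<in> space P \<Longrightarrow> continuous_on {0..} f"
  using sets_eq_imp_space_eq[OF sets_P] by (simp add: path_space_def space_restrict_space)

lemma start_AE: "AE f in P. f 0 = x"
proof -
  have "\<exists>\<mu> \<sigma>. normal_rv P (\<lambda>f. \<Sum>t\<in>{0}. 1 * f t) \<mu> \<sigma>"
    using gauss unfolding gaussian_process_def by (elim conjE) (erule allE[of _ "{0}"], erule allE[of _ "\<lambda>_. 1"], simp)
  then obtain \<mu> \<sigma> where n: "normal_rv P (\<lambda>f. f 0) \<mu> \<sigma>" by auto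
  note mom = normal_rv_moments[OF prob_space_axioms n]
  have "\<mu> = x" using mom(1) mean[of 0] by (simp add: mean_fn_def slepian_R_def)
  moreover have "\<sigma>\<^sup>2 = 0" using mom cov[of 0 0] by (simp add: cov_fn_def mean_fn_def slepian_R_def power2_eq_square)
  ultimately show ?thesis using n by (simp add: normal_rv_def)
qed

abbreviation randomized_start :: "(real \<times> (real \<Rightarrow> real)) measure" where
  "randomized_start \<equiv> std_normal_distribution \<Otimes>\<^sub>M P"

abbreviation restarted :: "nat \<Rightarrow> nat \<Rightarrow> real \<times> (real \<Rightarrow> real) \<Rightarrow> real" where
  "restarted m k \<equiv> (\<lambda>(z, f). f (real k / m) + slepian_R (real k / m) * (z - x))"

text \<open>The variance of \<open>z\<close> adds the rank-one term \<open>R s R t\<close> that conditioning has removed from the covariance, and the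
  shift by \<open>- x\<close> cancels the conditional mean.\<close>

lemma restarted_char:
  fixes u :: "nat \<Rightarrow> real"
  assumes m: "m > 0"
  shows "(CLINT w|randomized_start. iexp (\<Sum>k<K. u k * restarted m k w)) =
    of_real (exp (- (\<Sum>k<K. \<Sum>l<K. u k * u l * slepian_R (real l / m - real k / m)) / 2))"
proof -
  interpret Z: real_distribution std_normal_distribution by (rule real_dist_normal_dist)
  interpret pair_prob_space std_normal_distribution P ..
  define \<rho> where "\<rho> = (\<Sum>k<K. u k * slepian_R (real k / m))"
  define L where "L f = (\<Sum>k<K. u k * f (real k / m))" for f :: "real \<Rightarrow> real"
  have Lm: "L \<in> borel_measurable P"
    unfolding L_def by (intro borel_measurable_sum borel_measurable_times borel_measurable_const eval_measurable) simp
  have split: "iexp (\<Sum>k<K. u k * restarted m k w) = (iexp (- x * \<rho>) * iexp (\<rho> * fst w)) * iexp (L (snd w))" for w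
  proof -
    have "(\<Sum>k<K. u k * restarted m k w) = - x * \<rho> + \<rho> * fst w + L (snd w)"
      unfolding \<rho>_def L_def by (cases w) (simp add: algebra_simps sum.distrib sum_subtractf sum_distrib_left sum_distrib_right sum_negf)
    then show ?thesis by (simp only: of_real_add distrib_left exp_add)
  qed
  have meas: "(\<lambda>w. (iexp (- x * \<rho>) * iexp (\<rho> * fst w)) * iexp (L (snd w))) \<in> borel_measurable randomized_start"
    using Lm by measurable
  have int: "integrable randomized_start (\<lambda>w. (iexp (- x * \<rho>) * iexp (\<rho> * fst w)) * iexp (L (snd w)))"
    by (rule P.integrable_const_bound[where B = 1]) (use meas in \<open>auto simp: norm_mult\<close>)
  have charL: "(CLINT f|P. iexp (L f)) = iexp (x * \<rho>) *
      of_real (exp (- (\<Sum>k<K. \<Sum>l<K. u k * u l * (slepian_R (real l / m - real k / m) - slepian_R (real k / m) * slepian_R (real l / m))) / 2))"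
  proof -
    have inj: "inj_on (\<lambda>k. real k / m) {..<K}" using m by (auto simp: inj_on_def)
    have "(\<Sum>k<K. u k * mean_fn P (\<lambda>t f. f t) (real k / m)) = x * \<rho>"
      unfolding \<rho>_def sum_distrib_left by (intro sum.cong refl) (simp add: mean)
    moreover have "(\<Sum>k<K. \<Sum>l<K. u k * u l * cov_fn P (\<lambda>t f. f t) (real k / m) (real l / m)) =
       (\<Sum>k<K. \<Sum>l<K. u k * u l * (slepian_R (real l / m - real k / m) - slepian_R (real k / m) * slepian_R (real l / m)))"
      by (intro sum.cong refl) (simp add: cov)
    moreover have "(\<lambda>k. real k / m) ` {..<K} \<subseteq> {0..}" by auto
    ultimately show ?thesis
      using gaussian_process_char[OF gauss finite_lessThan inj, of u] unfolding L_def by simp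
  qed
  have rho2: "(\<Sum>k<K. \<Sum>l<K. u k * u l * (slepian_R (real k / m) * slepian_R (real l / m))) = \<rho>\<^sup>2"
    unfolding \<rho>_def power2_eq_square sum_product by (intro sum.cong refl) (simp add: mult_ac)
  have charZ: "(CLINT z|std_normal_distribution. iexp (\<rho> * z)) = of_real (exp (- (\<rho>\<^sup>2) / 2))"
    using char_std_normal_distribution unfolding char_def by (metis (no_types, lifting))
  have "(CLINT w|randomized_start. iexp (\<Sum>k<K. u k * restarted m k w)) =
      (CLINT w|randomized_start. (iexp (- x * \<rho>) * iexp (\<rho> * fst w)) * iexp (L (snd w)))"
    unfolding split ..
  also have "\<dots> = (CLINT z|std_normal_distribution. (CLINT f|P. (iexp (- x * \<rho>) * iexp (\<rho> * z)) * iexp (L f)))"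
    using integral_fst'[OF int] by simp
  also have "\<dots> = iexp (- x * \<rho>) * (CLINT z|std_normal_distribution. iexp (\<rho> * z)) * (CLINT f|P. iexp (L f))"
    by (simp only: integral_mult_right_zero integral_mult_left_zero mult.assoc)
  also have "\<dots> = (iexp (- x * \<rho>) * iexp (x * \<rho>)) * of_real (exp (- (\<rho>\<^sup>2) / 2) *
      exp (- (\<Sum>k<K. \<Sum>l<K. u k * u l * (slepian_R (real l / m - real k / m) - slepian_R (real k / m) * slepian_R (real l / m))) / 2))"
    unfolding charL charZ by (simp only: of_real_mult mult_ac)
  also have "iexp (- x * \<rho>) * iexp (x * \<rho>) = 1" by (simp add: exp_minus)
  also have "exp (- (\<rho>\<^sup>2) / 2) *
      exp (- (\<Sum>k<K. \<Sum>l<K. u k * u l * (slepian_R (real l / m - real k / m) - slepian_R (real k / m) * slepian_R (real l / m))) / 2) =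
      exp (- (\<Sum>k<K. \<Sum>l<K. u k * u l * slepian_R (real l / m - real k / m)) / 2)"
    unfolding right_diff_distrib sum_subtractf rho2 exp_add[symmetric]
    by (rule arg_cong[where f = exp]) (simp add: field_simps)
  finally show ?thesis by simp
qed

lemma restarted_measurable:
  assumes "m > 0"
  shows "restarted m k \<in> borel_measurable randomized_start"
proof -
  have e: "(\<lambda>f. f (real k / m)) \<in> borel_measurable P" by (rule eval_measurable) simp
  have "(\<lambda>w. snd w (real k / m)) \<in> borel_measurable randomized_start"
    by (rule measurable_compose[OF measurable_snd e])
  moreover have "fst \<in> borel_measurable randomized_start"
    using measurable_fst[of std_normal_distribution P] by simp
  ultimately show ?thesis unfolding case_prod_beta'
    by (intro borel_measurable_add borel_measurable_times borel_measurable_diff borel_measurable_const)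
qed

lemma walk_event_restarted:
  assumes m: "m > 0" and B: "B \<in> sets borel" and S: "S \<in> sets borel"
  shows "measure (walk_measure m (Suc n * m)) (walk_event m n B S) =
    measure randomized_start {w \<in> space randomized_start. restarted m 0 w \<in> B \<and> (\<forall>q\<le>n * m. restarted m q w \<in> S)}"
proof -
  interpret Z: real_distribution std_normal_distribution by (rule real_dist_normal_dist)
  interpret pair_prob_space std_normal_distribution P ..
  let ?N = "Suc n * m" and ?K = "Suc (n * m)"
  \<comment> \<open>The increment at grid point 0 is the walk at time 1, so both conditions fall on coordinate 0.\<close>
  define C where "C k = (if k = 0 then B \<inter> S else S)" for k :: nat
  have C: "C k \<in> sets borel" for k using B S by (simp add: C_def)
  have box: "(\<forall>k<?K. g k \<in> C k) \<longleftrightarrow> g 0 \<in> B \<and> (\<forall>q\<le>n * m. g q \<in> S)" for g :: "nat \<Rightarrow> real"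
  proof
    assume a: "\<forall>k<?K. g k \<in> C k"
    have "g 0 \<in> B \<inter> S" using a[rule_format, of 0] by (simp add: C_def)
    moreover have "g q \<in> S" if "q \<le> n * m" for q
      using a[rule_format, of q] that by (cases "q = 0") (auto simp: C_def)
    ultimately show "g 0 \<in> B \<and> (\<forall>q\<le>n * m. g q \<in> S)" by blast
  qed (auto simp: C_def less_Suc_eq_le)
  have Ym: "(\<lambda>\<xi>. psum \<xi> (k + m) - psum \<xi> k) \<in> borel_measurable (walk_measure m ?N)" if "k < ?K" for k
  proof -
    have "(\<lambda>\<xi>. psum \<xi> l) \<in> borel_measurable (walk_measure m ?N)" if "l \<le> ?N" for l
      unfolding measurable_walk_measure by (rule borel_measurable_sum, rule coordinate_measurable) (use that in auto)
    then show ?thesis using that by (intro borel_measurable_diff) auto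
  qed
  have "measure (walk_measure m ?N) {\<xi> \<in> space (walk_measure m ?N). \<forall>k<?K. psum \<xi> (k + m) - psum \<xi> k \<in> C k} =
      measure randomized_start {w \<in> space randomized_start. \<forall>k<?K. restarted m k w \<in> C k}"
    by (rule box_probability_unique[OF prob_space_walk_measure[OF m] P.prob_space_axioms Ym restarted_measurable[OF m] _ C], assumption)
       (rule trans[OF walk_increment_char[OF m] restarted_char[OF m, symmetric]])
  moreover have "psum \<xi> (0 + m) - psum \<xi> 0 = psum \<xi> m" for \<xi> :: "nat \<Rightarrow> real" by simp
  ultimately show ?thesis unfolding box by (simp only:)
qed

definition grid_below :: "nat \<Rightarrow> nat \<Rightarrow> real \<Rightarrow> (real \<Rightarrow> real) set" where
  "grid_below n m c = {f \<in> space P. \<forall>q\<le>n * m. f (real q / m) \<le> c}"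

lemma grid_below_sets: "grid_below n m c \<in> sets P"
proof -
  have "grid_below n m c = {f \<in> space P. \<forall>q\<in>{..n * m}. f (real q / m) \<le> c}"
    unfolding grid_below_def by (rule Collect_cong) blast
  also have "\<dots> \<in> sets P"
  proof (rule sets.sets_Collect_finite_All)
    fix q
    have "(\<lambda>f. f (real q / m)) \<in> borel_measurable P" by (rule eval_measurable) simp
    from measurable_sets[OF this, of "{..c}"] show "{f \<in> space P. f (real q / m) \<le> c} \<in> sets P"
      by (simp add: vimage_def Int_def conj_commute)
  qed simp
  finally show ?thesis .
qed

lemma product_mass:
  assumes "B \<in> sets borel" "A \<in> sets P"
  shows "measure randomized_start (B \<times> A) = measure std_normal_distribution B * measure P A"
proof -
  have "B \<in> sets std_normal_distribution" using assms by simp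
  from emeasure_pair_measure_Times[OF this assms(2)] show ?thesis
    by (simp only: measure_def enn2real_mult)
qed

lemma product_null:
  assumes "N \<in> sets P" "emeasure P N = 0"
  shows "UNIV \<times> N \<in> null_sets randomized_start"
proof -
  have U: "UNIV \<in> sets std_normal_distribution" by simp
  have "emeasure randomized_start (UNIV \<times> N) = 0"
    unfolding emeasure_pair_measure_Times[OF U assms(1)] assms(2) by simp
  moreover have "UNIV \<times> N \<in> sets randomized_start" by (rule pair_measureI[OF U assms(1)])
  ultimately show ?thesis by (rule null_setsI)
qed

text \<open>Since \<open>R \<ge> 0\<close>, a start to the right of \<open>x\<close> raises the whole path and a start to the left lowers it.  So the two
  kinds of intervals give the two directions of the comparison, with the path started at \<open>x\<close> independent of \<open>z\<close>.\<close>

lemma walk_event_bounds: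
  assumes m: "m > 0"
  shows "\<delta> \<ge> 0 \<Longrightarrow> measure (walk_measure m (Suc n * m)) (walk_event m n {x..x+\<delta>} {..<h}) \<le>
      measure std_normal_distribution {x..x+\<delta>} * measure P (grid_below n m h)" (is "_ \<Longrightarrow> ?U")
    and "\<delta> \<ge> 0 \<Longrightarrow> measure std_normal_distribution {x-\<delta>..x} * measure P (grid_below n m c) \<le>
      measure (walk_measure m (Suc n * m)) (walk_event m n {x-\<delta>..x} {..c})" (is "_ \<Longrightarrow> ?L")
proof -
  interpret Z: real_distribution std_normal_distribution by (rule real_dist_normal_dist)
  interpret pair_prob_space std_normal_distribution P ..
  obtain N where N: "{f \<in> space P. f 0 \<noteq> x} \<subseteq> N" "N \<in> sets P" "emeasure P N = 0"
    using start_AE by (auto elim: AE_E)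
  have null: "UNIV \<times> N \<in> null_sets randomized_start"
    by (rule product_null[OF N(2,3)])
  have R: "slepian_R t \<ge> 0" for t by (simp add: slepian_R_def)
  have R0: "slepian_R 0 = 1" by (simp add: slepian_R_def)
  have Em: "{w \<in> space randomized_start. restarted m 0 w \<in> B \<and> (\<forall>q\<le>n * m. restarted m q w \<in> S)} \<in> sets randomized_start"
    if "B \<in> sets borel" "S \<in> sets borel" for B S
  proof -
    have "{w \<in> space randomized_start. restarted m 0 w \<in> B \<and> (\<forall>q\<le>n * m. restarted m q w \<in> S)} =
      (restarted m 0 -` B \<inter> space randomized_start) \<inter> {w \<in> space randomized_start. \<forall>q\<in>{..n * m}. restarted m q w \<in> S}"
      by auto
    moreover have "{w \<in> space randomized_start. \<forall>q\<in>{..n * m}. restarted m q w \<in> S} \<in> sets randomized_start"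
    proof (rule sets.sets_Collect_finite_All)
      fix q
      from measurable_sets[OF restarted_measurable[OF m, of q] that(2)]
      show "{w \<in> space randomized_start. restarted m q w \<in> S} \<in> sets randomized_start"
        by (simp only: vimage_def Int_def mem_Collect_eq conj_commute)
    qed simp
    ultimately show ?thesis using measurable_sets[OF restarted_measurable[OF m, of 0] that(1)] by (simp only: sets.Int)
  qed
  have GS: "B \<times> grid_below n m c \<in> sets randomized_start" if "B \<in> sets borel" for B c
    using that grid_below_sets by (intro pair_measureI) simp_all
  show ?U if d: "\<delta> \<ge> 0"
  proof -
    let ?E = "{w \<in> space randomized_start. restarted m 0 w \<in> {x..x+\<delta>} \<and> (\<forall>q\<le>n * m. restarted m q w \<in> {..<h})}"
    have "?E \<subseteq> ({x..x+\<delta>} \<times> grid_below n m h) \<union> (UNIV \<times> N)"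
    proof
      fix w assume w: "w \<in> ?E"
      obtain z f where zf: "w = (z, f)" by (cases w)
      have f: "f \<in> space P" using w zf by (simp add: space_pair_measure)
      show "w \<in> ({x..x+\<delta>} \<times> grid_below n m h) \<union> (UNIV \<times> N)"
      proof (cases "f 0 = x")
        case True
        then have z: "x \<le> z" "z \<le> x + \<delta>" using w zf by (auto simp: R0)
        have "f (real q / m) \<le> h" if "q \<le> n * m" for q
        proof -
          have "f (real q / m) + slepian_R (real q / m) * (z - x) < h" using w zf that by auto
          moreover have "0 \<le> slepian_R (real q / m) * (z - x)" using R z by (intro mult_nonneg_nonneg) auto
          ultimately show ?thesis by linarith
        qed
        then show ?thesis using z f zf by (simp add: grid_below_def)
      next
        case False
        then show ?thesis using N(1) f zf by auto
      qed
    qed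
    then have "measure randomized_start ?E \<le> measure randomized_start (({x..x+\<delta>} \<times> grid_below n m h) \<union> (UNIV \<times> N))"
      using GS null by (intro P.finite_measure_mono) auto
    also have "\<dots> = measure randomized_start ({x..x+\<delta>} \<times> grid_below n m h)"
      by (rule measure_Un_null_set[OF GS null]) simp
    also have "\<dots> = measure std_normal_distribution {x..x+\<delta>} * measure P (grid_below n m h)"
      by (rule product_mass[OF _ grid_below_sets]) simp
    finally show ?thesis by (subst walk_event_restarted[OF m]) simp_all
  qed
  show ?L if d: "\<delta> \<ge> 0"
  proof -
    let ?E = "{w \<in> space randomized_start. restarted m 0 w \<in> {x-\<delta>..x} \<and> (\<forall>q\<le>n * m. restarted m q w \<in> {..c})}"
    have "{x-\<delta>..x} \<times> grid_below n m c \<subseteq> ?E \<union> (UNIV \<times> N)"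
    proof
      fix w assume w: "w \<in> {x-\<delta>..x} \<times> grid_below n m c"
      obtain z f where zf: "w = (z, f)" by (cases w)
      have f: "f \<in> space P" using w zf by (simp add: grid_below_def)
      show "w \<in> ?E \<union> (UNIV \<times> N)"
      proof (cases "f 0 = x")
        case True
        have "f (real q / m) + slepian_R (real q / m) * (z - x) \<le> c" if "q \<le> n * m" for q
        proof -
          have "f (real q / m) \<le> c" using w zf that by (auto simp: grid_below_def)
          moreover have "slepian_R (real q / m) * (z - x) \<le> 0" using R w zf by (intro mult_nonneg_nonpos) auto
          ultimately show ?thesis by linarith
        qed
        then show ?thesis using w f zf True by (auto simp: space_pair_measure R0)
      next
        case False
        then show ?thesis using N(1) f zf by auto
      qed
    qed
    moreover have ES: "?E \<in> sets randomized_start" by (rule Em) simp_all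
    ultimately have "measure randomized_start ({x-\<delta>..x} \<times> grid_below n m c) \<le> measure randomized_start (?E \<union> (UNIV \<times> N))"
      by (intro P.finite_measure_mono sets.Un null_setsD2[OF null])
    also have "\<dots> = measure randomized_start ?E"
      by (rule measure_Un_null_set[OF ES null])
    finally show ?thesis
      by (subst walk_event_restarted[OF m]) (simp_all add: product_mass grid_below_sets)
  qed
qed

end

section \<open>Bounds and continuity of the determinant integral\<close>

definition det_integral :: "nat \<Rightarrow> real \<Rightarrow> real \<Rightarrow> real" where
  "det_integral n y h = (LINT s : orthant n h | leb_on {1..n}.
     shift_det h n (s(0 := y)))"

abbreviation gauss_product :: "nat \<Rightarrow> (nat \<Rightarrow> real) \<Rightarrow> real" where
  "gauss_product n s \<equiv> (\<Prod>i\<in>{1..n}. std_normal_density (s i))"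

text \<open>The diagonal of the shift matrix is \<open>\<phi> (s\<^sub>0), \<dots>, \<phi> (s\<^sub>n)\<close>.  The resulting dominating function depends on neither
  \<open>h\<close> nor the starting value.\<close>

lemma shift_det_bounds:
  assumes n: "n > 0" and y: "y < h" and s: "\<And>i. i \<in> {1..n} \<Longrightarrow> s i < h"
  shows "0 \<le> shift_det h n (s(0 := y))"
    "shift_det h n (s(0 := y)) \<le> std_normal_density y * gauss_product n s"
proof -
  let ?s = "s(0 := y)"
  have "\<forall>i\<le>n. ?s i < h" using y s by auto
  then have ch: "(\<lambda>i. (\<Sum>l<i. ?s l) - real i * h) \<in> chamber (Suc n)" "(\<lambda>j. (\<Sum>l<Suc j. ?s l) - real j * h) \<in> chamber (Suc n)"
    using chamber_partial_sums[OF n, of ?s h] by blast+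
  have one: "(0::real) < 1" by simp
  note b = km_det_bounds[OF one ch]
  show "0 \<le> shift_det h n ?s"
    unfolding shift_matrix_eq_km_det[OF refl] by (rule b(1))
  have "shift_det h n ?s \<le>
      (\<Prod>i<Suc n. heat 1 (((\<Sum>l<i. ?s l) - real i * h) - ((\<Sum>l<Suc i. ?s l) - real i * h)))"
    unfolding shift_matrix_eq_km_det[OF refl] by (rule b(2))
  also have "\<dots> = (\<Prod>i<Suc n. std_normal_density (?s i))"
    by (intro prod.cong refl) (simp add: normal_density_def)
  also have "\<dots> = std_normal_density y * gauss_product n s"
    by (simp only: prod.lessThan_Suc_shift One_nat_def prod.atLeast1_atMost_eq) simp
  finally show "shift_det h n ?s \<le> std_normal_density y * gauss_product n s" .
qed

lemma std_normal_density_le_1: "std_normal_density y \<le> 1"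
proof -
  have "1 \<le> sqrt (2 * pi)" using pi_ge_two by (intro real_le_rsqrt) simp
  then have "1 / sqrt (2 * pi) \<le> 1" by simp
  then show ?thesis unfolding std_normal_density_def
    by (intro mult_le_one) auto
qed

lemma gauss_product_nonneg: "0 \<le> gauss_product n s"
  by (intro prod_nonneg) simp

lemma integrable_gauss_product: "integrable (leb_on {1..n}) (gauss_product n)"
  by (rule lborel_prod.product_integrable_prod) auto

lemma update_zero_measurable:
  assumes "i \<le> n"
  shows "(\<lambda>s. (s(0 := y)) i) \<in> borel_measurable (leb_on {1..n})"
proof (cases "i = 0")
  case False
  then have "i \<in> {1..n}" using assms by auto
  then show ?thesis using coordinate_measurable[of i "{1..n}"] False by simp
qed simp

lemma quadrant_sets: "orthant n h \<in> sets (leb_on {1..n})"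
  by (rule sets_PiM_I_finite) auto

lemma det_integrand_measurable:
  "(\<lambda>s. indicator (orthant n h) s *\<^sub>R shift_det h n (s(0 := y)))
    \<in> borel_measurable (leb_on {1..n})"
  by (intro borel_measurable_scaleR borel_measurable_indicator quadrant_sets shift_det_measurable update_zero_measurable)

lemma det_integrand_bound:
  assumes "n > 0" "y < h"
  shows "norm (indicator (orthant n h) s *\<^sub>R shift_det h n (s(0 := y))) \<le> gauss_product n s"
proof (cases "s \<in> orthant n h")
  case True
  then have s: "\<And>i. i \<in> {1..n} \<Longrightarrow> s i < h" by auto
  have "std_normal_density y * gauss_product n s \<le> 1 * gauss_product n s"
    by (rule mult_right_mono[OF std_normal_density_le_1 gauss_product_nonneg])
  then have "\<bar>shift_det h n (s(0 := y))\<bar> \<le> gauss_product n s"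
    using shift_det_bounds[where s = s, OF assms s] by linarith
  then show ?thesis using True by simp
next
  case False
  then show ?thesis using gauss_product_nonneg[of s n] by simp
qed

lemma det_set_integrable:
  assumes "n > 0" "y < h"
  shows "set_integrable (leb_on {1..n}) (orthant n h)
     (\<lambda>s. shift_det h n (s(0 := y)))"
  unfolding set_integrable_def
  using det_integrand_bound[OF assms] gauss_product_nonneg
  by (intro Bochner_Integration.integrable_bound[OF integrable_gauss_product det_integrand_measurable]) simp

lemma shift_det_tendsto:
  assumes h: "(hh \<longlongrightarrow> h) F" and y: "(yy \<longlongrightarrow> y) F"
  shows "((\<lambda>k. shift_det (hh k) n (s(0 := yy k))) \<longlongrightarrow> shift_det h n (s(0 := y))) F"
proof -
  have c: "((\<lambda>k. (s(0 := yy k)) l) \<longlongrightarrow> (s(0 := y)) l) F" for l using y by (cases "l = 0") auto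
  have d: "isCont (heat 1) u" for u
    unfolding normal_density_def by (intro continuous_intros) auto
  show ?thesis
    unfolding shift_matrix_eq_km_det[OF refl] km_det_leibniz
    by (intro tendsto_sum tendsto_mult tendsto_prod tendsto_const isCont_tendsto_compose[OF d] tendsto_diff c h)
qed

text \<open>The restriction \<open>hh k \<le> h\<close> makes the indicators converge everywhere, also for points with a coordinate equal
  to \<open>h\<close>.\<close>

lemma det_integral_tendsto:
  assumes n: "n > 0" and yh: "\<And>k. yy k < hh k" "\<And>k. hh k \<le> h"
    and lim: "yy \<longlonglongrightarrow> y" "hh \<longlonglongrightarrow> h"
  shows "(\<lambda>k. det_integral n (yy k) (hh k)) \<longlonglongrightarrow> det_integral n y h"
  unfolding det_integral_def set_lebesgue_integral_def
proof (rule integral_dominated_convergence[OF det_integrand_measurable det_integrand_measurable integrable_gauss_product])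
  show "AE s in leb_on {1..n}. norm (indicator (orthant n (hh k)) s *\<^sub>R
      shift_det (hh k) n (s(0 := yy k))) \<le> gauss_product n s" for k
    using det_integrand_bound[OF n yh(1)] by simp
  show "AE s in leb_on {1..n}.
      (\<lambda>k. indicator (orthant n (hh k)) s *\<^sub>R shift_det (hh k) n (s(0 := yy k))) \<longlonglongrightarrow>
      indicator (orthant n h) s *\<^sub>R shift_det h n (s(0 := y))"
  proof (intro AE_I2 tendsto_scaleR shift_det_tendsto lim)
    fix s :: "nat \<Rightarrow> real" assume "s \<in> space (leb_on {1..n})"
    then have sp: "s \<in> orthant n c \<longleftrightarrow> (\<forall>i\<in>{1..n}. s i < c)" for c
      by (auto simp: space_PiM PiE_iff)
    show "(\<lambda>k. indicat_real (orthant n (hh k)) s) \<longlonglongrightarrow> indicat_real (orthant n h) s"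
    proof (cases "\<forall>i\<in>{1..n}. s i < h")
      case True
      then have "\<forall>\<^sub>F k in sequentially. \<forall>i\<in>{1..n}. s i < hh k"
        using order_tendstoD(1)[OF lim(2)] by (intro eventually_ball_finite) auto
      then have "\<forall>\<^sub>F k in sequentially. indicat_real (orthant n (hh k)) s = indicat_real (orthant n h) s"
        by (rule eventually_mono) (simp add: indicator_def sp True del: One_nat_def)
      then show ?thesis by (rule tendsto_eventually)
    next
      case False
      then obtain i where i: "i \<in> {1..n}" "h \<le> s i" by force
      then have "\<not> (\<forall>i\<in>{1..n}. s i < hh k)" for k using yh(2)[of k] by force
      then have "indicat_real (orthant n (hh k)) s = indicat_real (orthant n h) s" for k
        using False by (simp only: indicator_def sp)
      then show ?thesis by simp
    qed
  qed
qed

lemma det_integral_nonneg: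
  assumes "n > 0" "y < h"
  shows "0 \<le> det_integral n y h"
  unfolding det_integral_def set_lebesgue_integral_def
proof (rule Bochner_Integration.integral_nonneg)
  fix s
  show "0 \<le> indicator (orthant n h) s *\<^sub>R shift_det h n (s(0 := y))"
  proof (cases "s \<in> orthant n h")
    case True
    then have "\<And>i. i \<in> {1..n} \<Longrightarrow> s i < h" by auto
    from shift_det_bounds(1)[OF assms this] show ?thesis by simp
  qed simp
qed

lemma det_nn_integral:
  assumes "n > 0" "y < h"
  shows "(\<integral>\<^sup>+s. ennreal (shift_det h n (s(0 := y))) * indicator (orthant n h) s
      \<partial>leb_on {1..n}) = ennreal (det_integral n y h)"
proof -
  let ?Q = "orthant n h"
  have "(\<integral>\<^sup>+s. ennreal (shift_det h n (s(0 := y))) * indicator ?Q s \<partial>leb_on {1..n}) =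
      (\<integral>\<^sup>+s. ennreal (indicator ?Q s *\<^sub>R shift_det h n (s(0 := y))) \<partial>leb_on {1..n})"
  proof (rule nn_integral_cong)
    fix s
    show "ennreal (shift_det h n (s(0 := y))) * indicator ?Q s =
        ennreal (indicator ?Q s *\<^sub>R shift_det h n (s(0 := y)))"
      by (cases "s \<in> ?Q") simp_all
  qed
  also have "\<dots> = ennreal (det_integral n y h)"
    unfolding det_integral_def set_lebesgue_integral_def
  proof (rule nn_integral_eq_integral)
    show "integrable (leb_on {1..n}) (\<lambda>s. indicat_real ?Q s *\<^sub>R shift_det h n (s(0 := y)))"
      using det_set_integrable[OF assms] unfolding set_integrable_def .
    show "AE s in leb_on {1..n}. 0 \<le> indicat_real ?Q s *\<^sub>R shift_det h n (s(0 := y))"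
    proof (rule AE_I2)
      fix s
      show "0 \<le> indicat_real ?Q s *\<^sub>R shift_det h n (s(0 := y))"
      proof (cases "s \<in> ?Q")
        case True
        then have "\<And>i. i \<in> {1..n} \<Longrightarrow> s i < h" by auto
        from shift_det_bounds(1)[OF assms this] show ?thesis by simp
      qed simp
    qed
  qed
  finally show ?thesis .
qed

lemma det_integral_measurable:
  assumes n: "n > 0"
  shows "(\<lambda>y. ennreal (det_integral n y h) * indicator {..<h} y) \<in> borel_measurable borel"
proof -
  let ?L = "leb_on {1..n}" and ?Q = "orthant n h"
  interpret finite_product_sigma_finite "\<lambda>_::nat. lborel :: real measure" "{1..n}" by standard simp
  have comp: "(\<lambda>w. ((snd w)(0 := fst w)) i) \<in> borel_measurable (borel \<Otimes>\<^sub>M ?L)" if "i \<le> n" for i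
  proof (cases "i = 0")
    case False
    then have "i \<in> {1..n}" using that by auto
    from measurable_compose[OF measurable_snd coordinate_measurable[OF this]] False show ?thesis by simp
  qed simp
  have "(\<lambda>w. ennreal (shift_det h n ((snd w)(0 := fst w))) * indicator ?Q (snd w)) \<in> borel_measurable (borel \<Otimes>\<^sub>M ?L)"
    by (intro borel_measurable_times_ennreal measurable_compose[OF shift_det_measurable measurable_ennreal] comp
        measurable_compose[OF measurable_snd borel_measurable_indicator[OF quadrant_sets]])
  then have "(\<lambda>y. \<integral>\<^sup>+s. ennreal (shift_det h n (s(0 := y))) * indicator ?Q s \<partial>?L) \<in> borel_measurable borel"
    by (intro borel_measurable_nn_integral) (simp add: case_prod_beta')
  then have "(\<lambda>y. (\<integral>\<^sup>+s. ennreal (shift_det h n (s(0 := y))) * indicator ?Q s \<partial>?L) * indicator {..<h} y) \<in> borel_measurable borel"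
    by (intro borel_measurable_times_ennreal) auto
  also have "(\<lambda>y. (\<integral>\<^sup>+s. ennreal (shift_det h n (s(0 := y))) * indicator ?Q s \<partial>?L) * indicator {..<h} y) =
      (\<lambda>y. ennreal (det_integral n y h) * indicator {..<h} y)"
  proof
    fix y
    show "(\<integral>\<^sup>+s. ennreal (shift_det h n (s(0 := y))) * indicator ?Q s \<partial>?L) * indicator {..<h} y =
        ennreal (det_integral n y h) * indicator {..<h} y"
      using det_nn_integral[OF n, of y h] by (cases "y < h") simp_all
  qed
  finally show ?thesis .
qed

lemma det_mass_eq:
  assumes n: "n > 0" and B: "B \<subseteq> {..<h}"
  shows "det_mass B h n = (\<integral>\<^sup>+y. (ennreal (det_integral n y h) * indicator {..<h} y) * indicator B y \<partial>lborel)"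
  unfolding det_mass_def
proof (rule nn_integral_cong)
  fix y
  show "indicator B y * indicator {..<h} y * (\<integral>\<^sup>+s. ennreal (shift_det h n (s(0 := y))) *
        indicator (orthant n h) s \<partial>leb_on {1..n}) =
      (ennreal (det_integral n y h) * indicator {..<h} y) * indicator B y"
    using det_nn_integral[OF n, of y h] by (cases "y < h") (simp_all add: mult_ac)
qed

text \<open>A mean value principle, by which averages over shrinking intervals are compared pointwise.\<close>

lemma ex_point_of_nn_integral_le:
  fixes f g :: "real \<Rightarrow> ennreal"
  assumes [measurable]: "f \<in> borel_measurable borel" "g \<in> borel_measurable borel" and ab: "a < b"
    and le: "(\<integral>\<^sup>+y. f y * indicator {a..b} y \<partial>lborel) \<le> (\<integral>\<^sup>+y. g y * indicator {a..b} y \<partial>lborel)"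
    and fin: "(\<integral>\<^sup>+y. f y * indicator {a..b} y \<partial>lborel) \<noteq> \<infinity>"
  shows "\<exists>y\<in>{a..b}. f y \<le> g y"
proof (rule ccontr)
  assume "\<not> (\<exists>y\<in>{a..b}. f y \<le> g y)"
  then have lt: "g y < f y" if "y \<in> {a..b}" for y using that by (auto simp: not_le)
  have gle: "g y * indicator {a..b} y \<le> f y * indicator {a..b} y" for y
    using lt[of y] by (cases "y \<in> {a..b}") (auto simp: less_imp_le)
  have "(\<integral>\<^sup>+y. g y * indicator {a..b} y \<partial>lborel) \<le> (\<integral>\<^sup>+y. f y * indicator {a..b} y \<partial>lborel)"
    by (rule nn_integral_mono) (rule gle)
  then have gfin: "(\<integral>\<^sup>+y. g y * indicator {a..b} y \<partial>lborel) \<noteq> \<infinity>" using fin by (auto simp: top_unique)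
  have "(\<integral>\<^sup>+y. g y * indicator {a..b} y \<partial>lborel) < (\<integral>\<^sup>+y. f y * indicator {a..b} y \<partial>lborel)"
  proof (rule nn_integral_less[OF _ _ gfin])
    show "AE y in lborel. g y * indicator {a..b} y \<le> f y * indicator {a..b} y" using gle by simp
    show "\<not> (AE y in lborel. f y * indicator {a..b} y \<le> g y * indicator {a..b} y)"
    proof
      assume ae: "AE y in lborel. f y * indicator {a..b} y \<le> g y * indicator {a..b} y"
      have "AE y in lborel. y \<notin> {a..b}"
        using ae
      proof (rule eventually_mono)
        fix y assume *: "f y * indicator {a..b} y \<le> g y * indicator {a..b} y"
        show "y \<notin> {a..b}" using * lt[of y] by (cases "y \<in> {a..b}") (auto simp: not_le[symmetric])
      qed
      then have "emeasure lborel {a..b} = 0"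
        using AE_iff_null_sets[of "{a..b}" lborel] by (simp add: null_setsD1 del: atLeastAtMost_iff)
      then show False using ab by simp
    qed
  qed measurable
  then show False using le by simp
qed

lemma std_normal_interval:
  assumes "p \<ge> 0"
  shows "ennreal (measure std_normal_distribution {a..b} * p) =
    (\<integral>\<^sup>+y. ennreal (p * std_normal_density y) * indicator {a..b} y \<partial>lborel)"
proof -
  interpret Z: real_distribution std_normal_distribution by (rule real_dist_normal_dist)
  have "ennreal (measure std_normal_distribution {a..b} * p) = ennreal p * emeasure std_normal_distribution {a..b}"
    using assms by (simp add: Z.emeasure_eq_measure ennreal_mult mult.commute)
  also have "\<dots> = ennreal p * (\<integral>\<^sup>+y. ennreal (std_normal_density y) * indicator {a..b} y \<partial>lborel)"
    by (subst emeasure_density) auto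
  also have "\<dots> = (\<integral>\<^sup>+y. ennreal p * (ennreal (std_normal_density y) * indicator {a..b} y) \<partial>lborel)"
    by (rule nn_integral_cmult[symmetric]) measurable
  also have "\<dots> = (\<integral>\<^sup>+y. ennreal (p * std_normal_density y) * indicator {a..b} y \<partial>lborel)"
    using assms by (intro nn_integral_cong) (simp add: ennreal_mult mult.assoc)
  finally show ?thesis .
qed

lemma isCont_std_normal_density: "isCont std_normal_density u"
  unfolding std_normal_density_def by (intro continuous_intros) auto

lemma survival_factor_tendsto:
  fixes \<epsilon> K :: real
  assumes e: "\<epsilon> > 0"
  shows "(\<lambda>m. real m * (K * exp (- \<epsilon>\<^sup>2 / (1 / real m)))) \<longlonglongrightarrow> 0"
proof -
  have "norm (exp (- \<epsilon>\<^sup>2)) < 1" using e by simp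
  from tendsto_mult[OF tendsto_const[of K] powser_times_n_limit_0[OF this]]
  have "(\<lambda>m. K * (real m * exp (- \<epsilon>\<^sup>2) ^ m)) \<longlonglongrightarrow> 0" by simp
  moreover have "K * (real m * exp (- \<epsilon>\<^sup>2) ^ m) = real m * (K * exp (- \<epsilon>\<^sup>2 / (1 / real m)))" for m
    by (simp add: exp_of_nat_mult[symmetric] mult.commute)
  ultimately show ?thesis by simp
qed

section \<open>From the grid to the continuum\<close>

context conditioned_slepian
begin

definition below :: "nat \<Rightarrow> real \<Rightarrow> (real \<Rightarrow> real) set" where
  "below n c = {f \<in> space P. \<forall>t\<in>{0..real n}. f t \<le> c}"

lemma below_subset_grid: "m > 0 \<Longrightarrow> below n c \<subseteq> grid_below n m c"
proof
  fix f assume m: "m > 0" and f: "f \<in> below n c"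
  have "real q / m \<in> {0..real n}" if "q \<le> n * m" for q
  proof -
    have "real q \<le> real (n * m)" using that by (simp only: of_nat_le_iff)
    then show ?thesis using m by (simp add: divide_le_eq)
  qed
  then show "f \<in> grid_below n m c" using f by (simp add: below_def grid_below_def)
qed

lemma below_dyadic: "below n c = (\<Inter>j. grid_below n (2 ^ j) c)"
proof
  show "below n c \<subseteq> (\<Inter>j. grid_below n (2 ^ j) c)" by (intro INT_greatest below_subset_grid) simp
  show "(\<Inter>j. grid_below n (2 ^ j) c) \<subseteq> below n c"
  proof
    fix f assume f: "f \<in> (\<Inter>j. grid_below n (2 ^ j) c)"
    then have fP: "f \<in> space P" by (simp add: grid_below_def)
    have "f t \<le> c" if t: "t \<in> {0..real n}" for t
    proof -
      define q where "q j = nat \<lfloor>t * 2 ^ j\<rfloor>" for j :: nat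
      have q: "real (q j) \<le> t * 2 ^ j" "t * 2 ^ j - 1 \<le> real (q j)" for j
        using t by (auto simp: q_def)
      have "real (q j) \<le> real (n * 2 ^ j)" for j
      proof -
        have "t * 2 ^ j \<le> real n * 2 ^ j" using t by (intro mult_right_mono) auto
        then have "real (q j) \<le> real n * 2 ^ j" using q(1)[of j] by (rule order_trans[rotated])
        then show ?thesis by simp
      qed
      then have "q j \<le> n * 2 ^ j" for j by (simp only: of_nat_le_iff)
      then have le: "f (real (q j) / 2 ^ j) \<le> c" for j
        using f by (auto simp: grid_below_def)
      have "(\<lambda>j. real (q j) / 2 ^ j) \<longlonglongrightarrow> t"
      proof (rule real_tendsto_sandwich)
        have "(\<lambda>j. t - (1 / 2) ^ j) \<longlonglongrightarrow> t - 0" by (intro tendsto_intros LIMSEQ_power_zero) simp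
        then show "(\<lambda>j. t - (1 / 2) ^ j) \<longlonglongrightarrow> t" by simp
        show "\<forall>\<^sub>F j in sequentially. t - (1 / 2) ^ j \<le> real (q j) / 2 ^ j"
        proof (intro always_eventually allI)
          fix j
          have "t - (1 / 2) ^ j = (t * 2 ^ j - 1) / 2 ^ j" by (simp add: power_divide diff_divide_distrib)
          also have "\<dots> \<le> real (q j) / 2 ^ j" by (rule divide_right_mono[OF q(2)]) simp
          finally show "t - (1 / 2) ^ j \<le> real (q j) / 2 ^ j" .
        qed
        show "\<forall>\<^sub>F j in sequentially. real (q j) / 2 ^ j \<le> t"
          using q(1) by (intro always_eventually allI) (simp add: divide_le_eq)
      qed simp
      then have "(\<lambda>j. f (real (q j) / 2 ^ j)) \<longlonglongrightarrow> f t"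
        by (rule continuous_on_tendsto_compose[OF path_continuous[OF fP]]) (use t in auto)
      then show ?thesis by (rule LIMSEQ_le_const2) (use le in auto)
    qed
    then show "f \<in> below n c" using fP by (simp add: below_def)
  qed
qed

lemma below_sets: "below n c \<in> sets P"
  unfolding below_dyadic using grid_below_sets by (intro sets.countable_INT) auto

lemma prob_grid_tendsto: "(\<lambda>j. prob (grid_below n (2 ^ j) c)) \<longlonglongrightarrow> prob (below n c)"
  unfolding below_dyadic
proof (rule finite_Lim_measure_decseq)
  show "range (\<lambda>j. grid_below n (2 ^ j) c) \<subseteq> events" using grid_below_sets by auto
  show "decseq (\<lambda>j. grid_below n (2 ^ j) c)"
  proof (rule decseq_SucI, rule subsetI)
    fix j f assume f: "f \<in> grid_below n (2 ^ Suc j) c"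
    have "f (real q / real (2 ^ j)) \<le> c" if q: "q \<le> n * 2 ^ j" for q
    proof -
      have "2 * q \<le> n * 2 ^ Suc j" using q by simp
      then have "f (real (2 * q) / real (2 ^ Suc j)) \<le> c" using f unfolding grid_below_def by blast
      then show ?thesis by simp
    qed
    then show "f \<in> grid_below n (2 ^ j) c" using f by (simp add: grid_below_def)
  qed
qed

text \<open>A continuous path below \<open>h\<close> on a compact interval attains its maximum and so keeps a positive distance.\<close>

lemma strict_event: "{f \<in> space P. \<forall>t\<in>{0..real n}. f t < h} = (\<Union>i. below n (h - 1 / real (Suc i)))"
proof
  show "(\<Union>i. below n (h - 1 / real (Suc i))) \<subseteq> {f \<in> space P. \<forall>t\<in>{0..real n}. f t < h}"
  proof
    fix f assume "f \<in> (\<Union>i. below n (h - 1 / real (Suc i)))"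
    then obtain i where i: "f \<in> space P" "\<forall>t\<in>{0..real n}. f t \<le> h - 1 / real (Suc i)" by (auto simp: below_def)
    have "0 < 1 / real (Suc i)" by simp
    then have "h - 1 / real (Suc i) < h" by linarith
    then have "f t < h" if "t \<in> {0..real n}" for t using i(2) that by (meson le_less_trans)
    then show "f \<in> {f \<in> space P. \<forall>t\<in>{0..real n}. f t < h}" using i(1) by blast
  qed
  show "{f \<in> space P. \<forall>t\<in>{0..real n}. f t < h} \<subseteq> (\<Union>i. below n (h - 1 / real (Suc i)))"
  proof
    fix f assume f: "f \<in> {f \<in> space P. \<forall>t\<in>{0..real n}. f t < h}"
    have "continuous_on {0..real n} f" by (rule continuous_on_subset[OF path_continuous]) (use f in auto)
    then obtain s where s: "s \<in> {0..real n}" "\<forall>t\<in>{0..real n}. f t \<le> f s"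
      using continuous_attains_sup[of "{0..real n}" f] by auto
    have "f s < h" using f s(1) by blast
    then obtain i where "inverse (real (Suc i)) < h - f s" using reals_Archimedean[of "h - f s"] by auto
    then have "f s \<le> h - 1 / real (Suc i)" by (simp add: inverse_eq_divide)
    then have "f t \<le> h - 1 / real (Suc i)" if "t \<in> {0..real n}" for t using s(2) that by (meson order_trans)
    then have "f \<in> below n (h - 1 / real (Suc i))" using f by (simp add: below_def)
    then show "f \<in> (\<Union>i. below n (h - 1 / real (Suc i)))" by blast
  qed
qed

lemma prob_strict_tendsto:
  "(\<lambda>i. prob (below n (h - 1 / real (Suc i)))) \<longlonglongrightarrow> prob {f \<in> space P. \<forall>t\<in>{0..real n}. f t < h}"
  unfolding strict_event
proof (rule finite_Lim_measure_incseq)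
  show "range (\<lambda>i. below n (h - 1 / real (Suc i))) \<subseteq> events" using below_sets by auto
  show "incseq (\<lambda>i. below n (h - 1 / real (Suc i)))"
  proof (rule incseq_SucI, rule subsetI)
    fix i f assume f: "f \<in> below n (h - 1 / real (Suc i))"
    have "1 / real (Suc (Suc i)) \<le> 1 / real (Suc i)" by (simp add: field_simps)
    then have "h - 1 / real (Suc i) \<le> h - 1 / real (Suc (Suc i))" by linarith
    then have "f t \<le> h - 1 / real (Suc (Suc i))" if "t \<in> {0..real n}" for t
      using f that unfolding below_def by (blast intro: order_trans)
    then show "f \<in> below n (h - 1 / real (Suc (Suc i)))" using f by (simp add: below_def)
  qed
qed

lemma det_mass_upper_bound:
  assumes n: "n > 0" and d: "\<delta> \<ge> 0"
  shows "det_mass {x..x+\<delta>} h n \<le> ennreal (measure std_normal_distribution {x..x+\<delta>} * prob (below n h))"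
proof (rule LIMSEQ_le_const)
  show "(\<lambda>j. ennreal (measure std_normal_distribution {x..x+\<delta>} * prob (grid_below n (2 ^ j) h))) \<longlonglongrightarrow>
      ennreal (measure std_normal_distribution {x..x+\<delta>} * prob (below n h))"
    by (intro tendsto_ennrealI tendsto_mult tendsto_const prob_grid_tendsto)
  have "det_mass {x..x+\<delta>} h n \<le> ennreal (measure std_normal_distribution {x..x+\<delta>} * prob (grid_below n (2 ^ j) h))" for j
  proof -
    have m: "(2::nat) ^ j > 0" by simp
    interpret W: prob_space "walk_measure (2 ^ j) (Suc n * 2 ^ j)" by (rule prob_space_walk_measure[OF m])
    show ?thesis
      using det_mass_upper[OF m n, of "{x..x+\<delta>}" h] walk_event_bounds(1)[OF m d, of n h]
      unfolding W.emeasure_eq_measure by (auto elim!: order_trans intro: ennreal_leI)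
  qed
  then show "\<exists>N. \<forall>j\<ge>N. det_mass {x..x+\<delta>} h n \<le> ennreal (measure std_normal_distribution {x..x+\<delta>} * prob (grid_below n (2 ^ j) h))"
    by blast
qed

text \<open>The loss over all \<open>m\<close> steps is at most \<open>m\<close> times the loss \<open>c m\<close> of one step, by Bernoulli's inequality, and this
  vanishes because \<open>c m\<close> decays exponentially.\<close>

lemma det_mass_lower_bound:
  assumes n: "n > 0" and d: "\<delta> \<ge> 0" and e: "\<epsilon> > 0"
  shows "ennreal (measure std_normal_distribution {x-\<delta>..x} * prob (below n (h - \<epsilon>))) \<le> det_mass {x-\<delta>..x} h n"
proof -
  define a where "a = measure std_normal_distribution {x-\<delta>..x} * prob (below n (h - \<epsilon>))"
  have a: "a \<ge> 0" by (simp add: a_def)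
  define c where "c m = fact (Suc n) * exp (- \<epsilon>\<^sup>2 / (1 / real m))" for m :: nat
  have lim: "(\<lambda>m. real m * c m) \<longlonglongrightarrow> 0" unfolding c_def by (rule survival_factor_tendsto[OF e])
  have "\<forall>\<^sub>F m in sequentially. ennreal ((1 - real m * c m) * a) \<le> det_mass {x-\<delta>..x} h n"
  proof -
    have "\<forall>\<^sub>F m in sequentially. real m * c m < 1" using order_tendstoD(2)[OF lim, of 1] by simp
    then show ?thesis
      using eventually_gt_at_top[of 0]
    proof eventually_elim
      case (elim m)
      have cm: "c m \<ge> 0" by (simp add: c_def)
      have "1 * c m \<le> real m * c m" using elim(2) cm by (intro mult_right_mono) auto
      then have c1: "c m \<le> 1" using elim(1) by linarith
      interpret W: prob_space "walk_measure m (Suc n * m)" by (rule prob_space_walk_measure[OF elim(2)])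
      let ?w = "W.prob (walk_event m n {x-\<delta>..x} {..h - \<epsilon>})"
      have "prob (below n (h - \<epsilon>)) \<le> prob (grid_below n m (h - \<epsilon>))"
        by (intro finite_measure_mono below_subset_grid grid_below_sets elim(2))
      then have "a \<le> measure std_normal_distribution {x-\<delta>..x} * prob (grid_below n m (h - \<epsilon>))"
        unfolding a_def by (rule mult_left_mono) simp
      also have "\<dots> \<le> ?w" by (rule walk_event_bounds(2)[OF elim(2) d])
      finally have aw: "a \<le> ?w" .
      have "1 + real m * (- c m) \<le> (1 + (- c m)) ^ m" by (rule Bernoulli_inequality) (use c1 in simp)
      then have "(1 - real m * c m) * a \<le> (1 - c m) ^ m * ?w"
        using aw a elim(1) c1 by (intro mult_mono) auto
      then have "ennreal ((1 - real m * c m) * a) \<le> ennreal ((1 - c m) ^ m * ?w)" by (rule ennreal_leI)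
      also have "\<dots> = ennreal ((1 - c m) ^ m) * ennreal ?w" using c1 by (intro ennreal_mult) auto
      also have "\<dots> \<le> det_mass {x-\<delta>..x} h n"
        using det_mass_lower[OF elim(2) n _ e c_def[of m] c1, of "{x-\<delta>..x}" h]
        unfolding W.emeasure_eq_measure by simp
      finally show ?case .
    qed
  qed
  moreover have "(\<lambda>m. ennreal ((1 - real m * c m) * a)) \<longlonglongrightarrow> ennreal ((1 - 0) * a)"
    by (intro tendsto_ennrealI tendsto_mult tendsto_diff tendsto_const lim)
  ultimately have "ennreal ((1 - 0) * a) \<le> det_mass {x-\<delta>..x} h n"
    by (intro tendsto_upperbound[of _ _ sequentially]) auto
  then show ?thesis by (simp add: a_def)
qed

text \<open>Arbitrarily close above \<open>x\<close> some starting value satisfies the inequality, by \<open>ex_point_of_nn_integral_le\<close>;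
  continuity carries it to \<open>x\<close>.\<close>

lemma det_integral_upper:
  assumes n: "n > 0" and xh: "x < h"
  shows "det_integral n x h \<le> prob (below n h) * std_normal_density x"
proof -
  \<comment> \<open>The denominator keeps the interval strictly below the barrier.\<close>
  define \<delta> where "\<delta> k = (h - x) / real (k + 2)" for k :: nat
  have d: "\<delta> k > 0" "x + \<delta> k < h" for k
  proof -
    show "\<delta> k > 0" using xh by (simp add: \<delta>_def)
    have "(h - x) * 1 < (h - x) * real (k + 2)" using xh by (intro mult_strict_left_mono) auto
    then show "x + \<delta> k < h" by (simp add: \<delta>_def field_simps)
  qed
  have "\<exists>y\<in>{x..x + \<delta> k}. ennreal (det_integral n y h) * indicator {..<h} y \<le> ennreal (prob (below n h) * std_normal_density y)" for k
  proof (rule ex_point_of_nn_integral_le)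
    have sub: "{x..x + \<delta> k} \<subseteq> {..<h}" using d(2)[of k] by auto
    show le: "(\<integral>\<^sup>+y. ennreal (det_integral n y h) * indicator {..<h} y * indicator {x..x + \<delta> k} y \<partial>lborel) \<le>
        (\<integral>\<^sup>+y. ennreal (prob (below n h) * std_normal_density y) * indicator {x..x + \<delta> k} y \<partial>lborel)"
      using det_mass_upper_bound[OF n less_imp_le[OF d(1)], of k h]
      unfolding det_mass_eq[OF n sub] std_normal_interval[OF measure_nonneg] .
    show "(\<integral>\<^sup>+y. ennreal (det_integral n y h) * indicator {..<h} y * indicator {x..x + \<delta> k} y \<partial>lborel) \<noteq> \<infinity>"
      using le unfolding std_normal_interval[OF measure_nonneg, symmetric] by (auto simp: top_unique)
  qed (use det_integral_measurable[OF n] d(1)[of k] in auto)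
  then obtain y where y: "\<And>k. y k \<in> {x..x + \<delta> k}"
    "\<And>k. ennreal (det_integral n (y k) h) * indicator {..<h} (y k) \<le> ennreal (prob (below n h) * std_normal_density (y k))" by metis
  have yh: "y k < h" for k using y(1)[of k] d(2)[of k] by auto
  have ylim: "y \<longlonglongrightarrow> x"
  proof (rule real_tendsto_sandwich)
    show "\<forall>\<^sub>F k in sequentially. x \<le> y k" using y(1) by simp
    show "\<forall>\<^sub>F k in sequentially. y k \<le> x + \<delta> k" using y(1) by simp
    have "\<delta> \<longlonglongrightarrow> 0"
      unfolding \<delta>_def by (rule LIMSEQ_ignore_initial_segment[of "\<lambda>k. (h - x) / real k" 0 2]) (rule lim_const_over_n)
    from tendsto_add[OF tendsto_const[of x] this] show "(\<lambda>k. x + \<delta> k) \<longlonglongrightarrow> x" by simp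
  qed simp
  have "det_integral n (y k) h \<le> prob (below n h) * std_normal_density (y k)" for k
    using y(2)[of k] yh[of k] by (simp add: ennreal_le_iff)
  moreover have "(\<lambda>k. det_integral n (y k) h) \<longlonglongrightarrow> det_integral n x h"
    by (rule det_integral_tendsto[OF n yh _ ylim]) simp_all
  moreover have "(\<lambda>k. prob (below n h) * std_normal_density (y k)) \<longlonglongrightarrow> prob (below n h) * std_normal_density x"
    by (intro tendsto_mult tendsto_const isCont_tendsto_compose[OF isCont_std_normal_density] ylim)
  ultimately show ?thesis by (intro LIMSEQ_le) auto
qed

lemma det_integral_lower:
  assumes n: "n > 0" and xh: "x < h" and e: "\<epsilon> > 0"
  shows "prob (below n (h - \<epsilon>)) * std_normal_density x \<le> det_integral n x h"
proof -
  define \<delta> where "\<delta> k = 1 / real (Suc k)" for k :: nat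
  have d: "\<delta> k > 0" for k by (simp add: \<delta>_def)
  let ?p = "prob (below n (h - \<epsilon>))"
  have "\<exists>y\<in>{x - \<delta> k..x}. ennreal (?p * std_normal_density y) \<le> ennreal (det_integral n y h) * indicator {..<h} y" for k
  proof (rule ex_point_of_nn_integral_le)
    have sub: "{x - \<delta> k..x} \<subseteq> {..<h}" using xh by auto
    show "(\<integral>\<^sup>+y. ennreal (?p * std_normal_density y) * indicator {x - \<delta> k..x} y \<partial>lborel) \<le>
        (\<integral>\<^sup>+y. ennreal (det_integral n y h) * indicator {..<h} y * indicator {x - \<delta> k..x} y \<partial>lborel)"
      using det_mass_lower_bound[OF n less_imp_le[OF d] e, of k h]
      unfolding det_mass_eq[OF n sub] std_normal_interval[OF measure_nonneg] .
    show "(\<integral>\<^sup>+y. ennreal (?p * std_normal_density y) * indicator {x - \<delta> k..x} y \<partial>lborel) \<noteq> \<infinity>"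
      unfolding std_normal_interval[OF measure_nonneg, symmetric] by simp
  qed (use det_integral_measurable[OF n] d[of k] in auto)
  then obtain y where y: "\<And>k. y k \<in> {x - \<delta> k..x}"
    "\<And>k. ennreal (?p * std_normal_density (y k)) \<le> ennreal (det_integral n (y k) h) * indicator {..<h} (y k)" by metis
  have yh: "y k < h" for k using y(1)[of k] xh by auto
  have ylim: "y \<longlonglongrightarrow> x"
  proof (rule real_tendsto_sandwich)
    have "\<delta> \<longlonglongrightarrow> 0" unfolding \<delta>_def using LIMSEQ_inverse_real_of_nat by (simp add: inverse_eq_divide)
    from tendsto_diff[OF tendsto_const[of x] this] show "(\<lambda>k. x - \<delta> k) \<longlonglongrightarrow> x" by simp
    show "\<forall>\<^sub>F k in sequentially. x - \<delta> k \<le> y k" using y(1) by simp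
    show "\<forall>\<^sub>F k in sequentially. y k \<le> x" using y(1) by simp
  qed simp
  have "?p * std_normal_density (y k) \<le> det_integral n (y k) h" for k
    using y(2)[of k] yh[of k] det_integral_nonneg[OF n yh[of k]] by (simp add: ennreal_le_iff)
  moreover have "(\<lambda>k. det_integral n (y k) h) \<longlonglongrightarrow> det_integral n x h"
    by (rule det_integral_tendsto[OF n yh _ ylim]) simp_all
  moreover have "(\<lambda>k. ?p * std_normal_density (y k)) \<longlonglongrightarrow> ?p * std_normal_density x"
    by (intro tendsto_mult tendsto_const isCont_tendsto_compose[OF isCont_std_normal_density] ylim)
  ultimately show ?thesis by (intro LIMSEQ_le) auto
qed

text \<open>The lower bound holds with the barrier lowered by any \<open>\<epsilon>\<close>, and the upper bound bounds the integral for a lower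
  barrier by the event for \<open>h\<close>; continuity in \<open>h\<close> closes the gap.\<close>

lemma first_passage:
  assumes n: "n > 0" and xh: "x < h"
  shows "prob {f \<in> space P. \<forall>t\<in>{0..real n}. f t < h} * std_normal_density x = det_integral n x h"
proof (rule antisym)
  let ?F = "prob {f \<in> space P. \<forall>t\<in>{0..real n}. f t < h}"
  show "?F * std_normal_density x \<le> det_integral n x h"
  proof (rule LIMSEQ_le_const2)
    show "(\<lambda>i. prob (below n (h - 1 / real (Suc i))) * std_normal_density x) \<longlonglongrightarrow> ?F * std_normal_density x"
      by (intro tendsto_mult tendsto_const prob_strict_tendsto)
    show "\<exists>N. \<forall>i\<ge>N. prob (below n (h - 1 / real (Suc i))) * std_normal_density x \<le> det_integral n x h"
      using det_integral_lower[OF n xh] by simp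
  qed
  define hh where "hh k = h - (h - x) / real (k + 2)" for k :: nat
  have hh: "x < hh k" "hh k < h" for k
  proof -
    have "(h - x) * 1 < (h - x) * real (k + 2)" using xh by (intro mult_strict_left_mono) auto
    then show "x < hh k" by (simp add: hh_def field_simps)
    show "hh k < h" using xh by (simp add: hh_def)
  qed
  have hlim: "hh \<longlonglongrightarrow> h"
  proof -
    have "(\<lambda>k. (h - x) / real (k + 2)) \<longlonglongrightarrow> 0"
      by (rule LIMSEQ_ignore_initial_segment[of "\<lambda>k. (h - x) / real k" 0 2]) (rule lim_const_over_n)
    from tendsto_diff[OF tendsto_const[of h] this] show ?thesis by (simp add: hh_def[abs_def])
  qed
  have "det_integral n x (hh k) \<le> ?F * std_normal_density x" for k
  proof -
    have "below n (hh k) \<subseteq> {f \<in> space P. \<forall>t\<in>{0..real n}. f t < h}"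
      using hh(2)[of k] unfolding below_def by (blast intro: le_less_trans)
    moreover have "{f \<in> space P. \<forall>t\<in>{0..real n}. f t < h} \<in> events"
      unfolding strict_event using below_sets by (intro sets.countable_UN) auto
    ultimately have "prob (below n (hh k)) \<le> ?F" by (rule finite_measure_mono)
    then have "prob (below n (hh k)) * std_normal_density x \<le> ?F * std_normal_density x"
      by (rule mult_right_mono) simp
    then show ?thesis using det_integral_upper[OF n hh(1)] by (rule order_trans[rotated])
  qed
  moreover have "(\<lambda>k. det_integral n x (hh k)) \<longlonglongrightarrow> det_integral n x h"
    by (rule det_integral_tendsto[OF n hh(1) less_imp_le[OF hh(2)] tendsto_const hlim])
  ultimately show "det_integral n x h \<le> ?F * std_normal_density x"
    by (intro LIMSEQ_le_const2) auto
qed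

end

theorem mainTheorem2:
  fixes M :: "'a measure" and S :: "real \<Rightarrow> 'a \<Rightarrow> real" and P :: "(real \<Rightarrow> real) measure"
    and h x :: real and n :: nat
  assumes "stationary_gaussian_process M S slepian_R"
    and "gaussian_conditional_law M S x P"
    and "n > 0"
    and "x < h"
  shows "set_integrable (Pi\<^sub>M {1..n} (\<lambda>_. lborel)) (Pi\<^sub>E {1..n} (\<lambda>_. {..<h}))
           (\<lambda>s. Determinant.det (shift_matrix h n (s(0 := x)))) \<and>
    \<P>(f in P. \<forall>t\<in>{0..real n}. f t < h) =
      1 / std_normal_density x *
      (LINT s : Pi\<^sub>E {1..n} (\<lambda>_. {..<h}) | Pi\<^sub>M {1..n} (\<lambda>_. lborel).
         Determinant.det (shift_matrix h n (s(0 := x))))"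
proof
  show "set_integrable (Pi\<^sub>M {1..n} (\<lambda>_. lborel)) (Pi\<^sub>E {1..n} (\<lambda>_. {..<h}))
      (\<lambda>s. Determinant.det (shift_matrix h n (s(0 := x))))"
    by (rule det_set_integrable[OF assms(3,4)])
  interpret conditioned_slepian P x
    using assms(2) unfolding conditional_law_slepian_iff[OF assms(1)] by unfold_locales blast+
  have "std_normal_density x > 0" by (rule normal_density_pos) simp
  then show "\<P>(f in P. \<forall>t\<in>{0..real n}. f t < h) =
      1 / std_normal_density x *
      (LINT s : Pi\<^sub>E {1..n} (\<lambda>_. {..<h}) | Pi\<^sub>M {1..n} (\<lambda>_. lborel).
         Determinant.det (shift_matrix h n (s(0 := x))))"
    using first_passage[OF assms(3,4)] unfolding det_integral_def by (simp add: field_simps)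
qed

end
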